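(* Let $\lambda,\mu_1,\mu_2\in\Omega^*$ be given. Suppose that the product systems $\overline{E}_{\lambda,\mu_1}$ and $\overline{E}_{\lambda,\mu_2}$ are isomorphic. Then $\mu_1$ and $\mu_2$ are scalar multiples of each other.
   Context: $P\subset\mathbb{R}^d$ is a closed convex cone with $P-P=\mathbb{R}^d$ and $P\cap-P=\{0\}$. $\Omega^*=\{\lambda\in\mathbb{R}^d:\langle\lambda|x\rangle>0\ \forall x\in P\setminus\{0\}\}$ is the interior of the dual cone of $P$. Inner products are linear in the first variable. Definition of $\overline{E}_{\lambda,\mu}$ for $\lambda,\mu\in\Omega^*$: let $\{S_t\}_{t\ge0}$ be the shift semigroup on $L^2(0,\infty)$ ($S_tf(x)=f(x-t)$ for $x>t$ and $0$ otherwise). For $a,b\in P$ put $\chi(a)=\langle\lambda|a\rangle$, $h_b=1_{(0,\langle\mu|b\rangle)}\in L^2(0,\infty)$, $V_a=S_{\langle\mu|a\rangle}$. On the symmetric Fock space $\Gamma=\Gamma(L^2(0,\infty))$ with exponential vectors $e(\eta)$, the Weyl operators are $W(\xi)e(\eta)=e^{-\frac{\|\xi\|^2}{2}-\langle\eta|\xi\rangle}e(\xi+\eta)$. The CCR flow $\alpha^V=\{\alpha_x\}_{x\in P}$ is the unique semigroup of unital normal $*$-endomorphisms of $B(\Gamma)$, with $x\mapsto\langle\alpha_x(A)\xi|\eta\rangle$ continuous for all $A,\xi,\eta$, such that $\alpha_x(W(\xi))=W(V_x\xi)$. Its product system $E$ has fibres $E(x)=\{T\in B(\Gamma):\alpha_x(A)T=TA\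 \forall A\in B(\Gamma)\}$, with inner product $\langle S|T\rangle1=T^*S$; a section $x\mapsto T_x\in E(x)$ is measurable if $x\mapsto\langle T_x\xi|\eta\rangle$ is measurable for all $\xi,\eta$. $\overline{E}_{\lambda,\mu}$ has the same fibres, Hilbert space structure and measurable structure as $E$, but the product $$S.T=S\,W(\chi(a)h_b)\,T\qquad(S\in\overline{E}_{\lambda,\mu}(a),\ T\in\overline{E}_{\lambda,\mu}(b),\ a,b\in P),$$ which is well defined and associative. Two product systems are isomorphic if there is a family of unitaries between the fibres over each $x\in P$ which is multiplicative with respect to the products and carries measurable sections to measurable sections. *)

theory Defs
  imports "HOL-Analysis.Analysis" "HOL-Combinatorics.Permutations"
begin

section \<open>Complex inner product spaces\<close>

text \<open>Inner products are linear in the first variable. The underlying real inner product is the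
  real part, so norm, topology and \<^const>\<open>bounded_linear\<close> are those of \<^class>\<open>real_inner\<close>.\<close>

class complex_inner = real_inner +
  fixes scaleC :: "complex \<Rightarrow> 'a \<Rightarrow> 'a" (infixr "*\<^sub>C" 75)
    and cinner :: "'a \<Rightarrow> 'a \<Rightarrow> complex"
  assumes scaleC_add_right: "c *\<^sub>C (x + y) = c *\<^sub>C x + c *\<^sub>C y"
    and scaleC_add_left: "(b + c) *\<^sub>C x = b *\<^sub>C x + c *\<^sub>C x"
    and scaleC_scaleC: "b *\<^sub>C c *\<^sub>C x = (b * c) *\<^sub>C x"
    and scaleR_scaleC: "r *\<^sub>R x = complex_of_real r *\<^sub>C x"
    and cinner_commute: "cinner x y = cnj (cinner y x)"
    and cinner_add_left: "cinner (x + y) z = cinner x z + cinner y z"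
    and cinner_scaleC_left: "cinner (c *\<^sub>C x) y = c * cinner x y"
    and inner_eq_Re_cinner: "inner x y = Re (cinner x y)"

section \<open>Square integrable functions\<close>

definition sqint :: "'a measure \<Rightarrow> ('a \<Rightarrow> complex) \<Rightarrow> bool" where
  "sqint M f \<longleftrightarrow> f \<in> borel_measurable M \<and> integrable M (\<lambda>x. (cmod (f x))\<^sup>2)"

definition ip :: "'a measure \<Rightarrow> ('a \<Rightarrow> complex) \<Rightarrow> ('a \<Rightarrow> complex) \<Rightarrow> complex" where
  "ip M f g = (\<integral>x. f x * cnj (g x) \<partial>M)"

lemma norm_add_sq_le: "(cmod (a + b))\<^sup>2 \<le> 2 * (cmod a)\<^sup>2 + 2 * (cmod b)\<^sup>2"
proof -
  have "(cmod (a + b))\<^sup>2 \<le> (cmod a + cmod b)\<^sup>2"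
    by (intro power_mono norm_triangle_ineq) auto
  also have "\<dots> \<le> 2 * (cmod a)\<^sup>2 + 2 * (cmod b)\<^sup>2"
    using sum_squares_bound[of "cmod a" "cmod b"] by (simp add: power2_sum)
  finally show ?thesis .
qed

lemma norm_mult_cnj_le: "cmod (a * cnj b) \<le> (cmod a)\<^sup>2 + (cmod b)\<^sup>2"
proof -
  have "2 * (cmod a * cmod b) \<le> (cmod a)\<^sup>2 + (cmod b)\<^sup>2"
    using sum_squares_bound[of "cmod a" "cmod b"] by (simp add: algebra_simps)
  moreover have "0 \<le> cmod a * cmod b" by simp
  ultimately show ?thesis unfolding norm_mult complex_mod_cnj by linarith
qed

lemma borel_measurable_cnj [measurable]: "cnj \<in> borel_measurable borel"
  by (intro borel_measurable_continuous_onI continuous_intros)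

lemma sqint_0: "sqint M (\<lambda>_. 0)"
  by (simp add: sqint_def)

lemma sqint_scale: "sqint M f \<Longrightarrow> sqint M (\<lambda>x. c * f x)"
  by (auto simp: sqint_def norm_mult power_mult_distrib)

lemma sqint_add: 
  assumes "sqint M f" "sqint M g" shows "sqint M (\<lambda>x. f x + g x)"
proof -
  have [measurable]: "f \<in> borel_measurable M" "g \<in> borel_measurable M"
    using assms by (auto simp: sqint_def)
  have "integrable M (\<lambda>x. (cmod (f x + g x))\<^sup>2)"
    by (rule Bochner_Integration.integrable_bound
        [of _ "\<lambda>x. 2 * (cmod (f x))\<^sup>2 + 2 * (cmod (g x))\<^sup>2"])
       (use assms norm_add_sq_le in \<open>auto simp: sqint_def\<close>)
  then show ?thesis by (simp add: sqint_def)
qed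

lemma sqint_cong_AE: "sqint M f \<Longrightarrow> g \<in> borel_measurable M \<Longrightarrow> AE x in M. f x = g x \<Longrightarrow> sqint M g"
  unfolding sqint_def
  by (auto elim!: AE_mp intro!: integrable_cong_AE_imp[where g = "\<lambda>x. (cmod (f x))\<^sup>2"])

lemma ip_integrable:
  assumes "sqint M f" "sqint M g" shows "integrable M (\<lambda>x. f x * cnj (g x))"
proof -
  have [measurable]: "f \<in> borel_measurable M" "g \<in> borel_measurable M"
    using assms by (auto simp: sqint_def)
  show ?thesis
    by (rule Bochner_Integration.integrable_bound
        [of _ "\<lambda>x. (cmod (f x))\<^sup>2 + (cmod (g x))\<^sup>2"])
       (use assms norm_mult_cnj_le in \<open>auto simp: sqint_def\<close>)
qed

lemma ip_add: "sqint M f \<Longrightarrow> sqint M g \<Longrightarrow> sqint M h \<Longrightarrow> 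
    ip M (\<lambda>x. f x + g x) h = ip M f h + ip M g h"
  unfolding ip_def by (simp add: ring_distribs ip_integrable)

lemma ip_scale: "ip M (\<lambda>x. c * f x) g = c * ip M f g"
  unfolding ip_def by (simp add: mult.assoc)

lemma ip_commute: "ip M f g = cnj (ip M g f)"
  unfolding ip_def Bochner_Integration.integral_cnj[symmetric] by (simp add: mult.commute)

lemma ip_self: "ip M f f = complex_of_real (\<integral>x. (cmod (f x))\<^sup>2 \<partial>M)"
  unfolding ip_def complex_norm_square[symmetric] integral_complex_of_real[symmetric] by simp

lemma ip_self_eq_0: "sqint M f \<Longrightarrow> ip M f f = 0 \<longleftrightarrow> (AE x in M. f x = 0)"
  unfolding ip_self of_real_eq_0_iff
  by (subst integral_nonneg_eq_0_iff_AE) (auto simp: sqint_def)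

lemma ip_cong_AE:
  assumes "sqint M f" "sqint M f'" "sqint M g" "sqint M g'" 
    and "AE x in M. f x = f' x" "AE x in M. g x = g' x"
  shows "ip M f g = ip M f' g'"
proof -
  have [measurable]: "f \<in> borel_measurable M" "g \<in> borel_measurable M"
    "f' \<in> borel_measurable M" "g' \<in> borel_measurable M"
    using assms by (auto simp: sqint_def)
  show ?thesis
    unfolding ip_def using assms(5,6) by (intro integral_cong_AE) auto
qed

lemma norm_ip_le:
  assumes "sqint M f" "sqint M g"
  shows "cmod (ip M f g) \<le> (\<integral>x. (cmod (f x))\<^sup>2 \<partial>M) + (\<integral>x. (cmod (g x))\<^sup>2 \<partial>M)"
proof -
  have "cmod (ip M f g) \<le> (\<integral>x. (cmod (f x))\<^sup>2 + (cmod (g x))\<^sup>2 \<partial>M)"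
    unfolding ip_def using ip_integrable[OF assms] assms norm_mult_cnj_le
    by (intro Bochner_Integration.integral_norm_bound[THEN order_trans] integral_mono)
       (auto simp: sqint_def)
  then show ?thesis using assms by (simp add: sqint_def)
qed

section \<open>The Hilbert space \<open>L\<^sup>2(0,\<infinity>)\<close>\<close>

definition half_line :: "real measure" where
  "half_line = restrict_space lborel {0<..}"

definition l2_rel :: "(real \<Rightarrow> complex) \<Rightarrow> (real \<Rightarrow> complex) \<Rightarrow> bool" where
  "l2_rel f g \<longleftrightarrow> sqint half_line f \<and> sqint half_line g \<and> (AE x in half_line. f x = g x)"

quotient_type l2 = "real \<Rightarrow> complex" / partial: l2_rel
proof (rule part_equivpI)
  show "\<exists>f. l2_rel f f"
    by (rule exI[of _ "\<lambda>_. 0"]) (simp add: l2_rel_def sqint_0)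
  show "symp l2_rel"
    by (auto simp: l2_rel_def symp_def)
  show "transp l2_rel"
    unfolding l2_rel_def by (rule transpI) (auto elim: AE_mp)
qed

instantiation l2 :: complex_inner
begin

lift_definition zero_l2 :: l2 is "\<lambda>_. 0"
  by (simp add: l2_rel_def sqint_0)

lift_definition plus_l2 :: "l2 \<Rightarrow> l2 \<Rightarrow> l2" is "\<lambda>f g x. f x + g x"
  by (auto simp: l2_rel_def intro!: sqint_add elim: AE_mp)

lift_definition scaleC_l2 :: "complex \<Rightarrow> l2 \<Rightarrow> l2" is "\<lambda>c f x. c * f x"
  by (auto simp: l2_rel_def intro!: sqint_scale elim: AE_mp)

lift_definition cinner_l2 :: "l2 \<Rightarrow> l2 \<Rightarrow> complex" is "ip half_line"
  by (auto simp: l2_rel_def intro!: ip_cong_AE)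

definition uminus_l2 :: "l2 \<Rightarrow> l2" where "uminus_l2 x = (- 1) *\<^sub>C x"
definition minus_l2 :: "l2 \<Rightarrow> l2 \<Rightarrow> l2" where "minus_l2 x y = x + (- y)"
definition scaleR_l2 :: "real \<Rightarrow> l2 \<Rightarrow> l2" where "scaleR_l2 r x = complex_of_real r *\<^sub>C x"
definition inner_l2 :: "l2 \<Rightarrow> l2 \<Rightarrow> real" where "inner_l2 x y = Re (cinner x y)"
definition norm_l2 :: "l2 \<Rightarrow> real" where "norm_l2 x = sqrt (inner x x)"
definition sgn_l2 :: "l2 \<Rightarrow> l2" where "sgn_l2 x = inverse (norm x) *\<^sub>R x"
definition dist_l2 :: "l2 \<Rightarrow> l2 \<Rightarrow> real" where "dist_l2 x y = norm (x - y)"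
definition uniformity_l2 :: "(l2 \<times> l2) filter" where
  "uniformity_l2 = (INF e\<in>{0<..}. principal {(x, y). dist x y < e})"
definition open_l2 :: "l2 set \<Rightarrow> bool" where
  "open_l2 U \<longleftrightarrow> (\<forall>x\<in>U. eventually (\<lambda>(x', y). x' = x \<longrightarrow> y \<in> U) uniformity)"

instance
proof
  fix x y z :: l2 and a b :: real and c d :: complex and U :: "l2 set"
  have add_commute: "x + y = y + x" for x y :: l2
    by transfer (auto simp: l2_rel_def add.commute intro!: sqint_add)
  have add_zero: "0 + x = x" for x :: l2
    by transfer (auto simp: l2_rel_def)
  have scaleC1: "1 *\<^sub>C x = x" for x :: l2
    by transfer (auto simp: l2_rel_def)
  have scaleC0: "0 *\<^sub>C x = 0" for x :: l2
    by transfer (auto simp: l2_rel_def sqint_0)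
  have sc_r: "c *\<^sub>C (x + y) = c *\<^sub>C x + c *\<^sub>C y" for c and x y :: l2
    by transfer (auto simp: l2_rel_def distrib_left intro!: sqint_add sqint_scale)
  have sc_l: "(c + d) *\<^sub>C x = c *\<^sub>C x + d *\<^sub>C x" for c d and x :: l2
    by transfer (auto simp: l2_rel_def distrib_right intro!: sqint_add sqint_scale)
  have sc_sc: "c *\<^sub>C d *\<^sub>C x = (c * d) *\<^sub>C x" for c d and x :: l2
    by transfer (auto simp: l2_rel_def mult.assoc intro!: sqint_scale)
  have ci_comm: "cinner x y = cnj (cinner y x)" for x y :: l2
    by transfer (rule ip_commute)
  have ci_add: "cinner (x + y) z = cinner x z + cinner y z" for x y z :: l2
    by transfer (auto simp: l2_rel_def ip_add)
  have ci_sc: "cinner (c *\<^sub>C x) y = c * cinner x y" for c and x y :: l2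
    by transfer (rule ip_scale)
  have ci_Re: "Re (cinner x x) \<ge> 0" for x :: l2
    by transfer (simp add: ip_self)
  have ci_0: "Re (cinner x x) = 0 \<longleftrightarrow> x = 0" for x :: l2
  proof transfer
    fix f assume "l2_rel f f"
    then have f: "sqint half_line f" by (simp add: l2_rel_def)
    have "Re (ip half_line f f) = 0 \<longleftrightarrow> ip half_line f f = 0" by (simp add: ip_self)
    then show "Re (ip half_line f f) = 0 \<longleftrightarrow> l2_rel f (\<lambda>_. 0)"
      using ip_self_eq_0[OF f] f by (simp add: l2_rel_def sqint_0)
  qed
  show "x + y + z = x + (y + z)"
    by transfer (auto simp: l2_rel_def add.assoc intro!: sqint_add)
  show "x + y = y + x" by (rule add_commute)
  show "0 + x = x" by (rule add_zero)
  show "- x + x = 0"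
    using sc_l[of "-1" 1 x] by (simp add: uminus_l2_def scaleC1 scaleC0)
  show "x - y = x + - y" by (rule minus_l2_def)
  show "a *\<^sub>R (x + y) = a *\<^sub>R x + a *\<^sub>R y" by (simp add: scaleR_l2_def sc_r)
  show "(a + b) *\<^sub>R x = a *\<^sub>R x + b *\<^sub>R x" by (simp add: scaleR_l2_def sc_l)
  show "a *\<^sub>R b *\<^sub>R x = (a * b) *\<^sub>R x" by (simp add: scaleR_l2_def sc_sc)
  show "1 *\<^sub>R x = x" by (simp add: scaleR_l2_def scaleC1)
  show "dist x y = norm (x - y)" by (rule dist_l2_def)
  show "sgn x = inverse (norm x) *\<^sub>R x" by (rule sgn_l2_def)
  show "uniformity = (INF e\<in>{0<..}. principal {(x :: l2, y). dist x y < e})"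
    by (rule uniformity_l2_def)
  show "open U \<longleftrightarrow> (\<forall>x\<in>U. eventually (\<lambda>(x', y). x' = x \<longrightarrow> y \<in> U) uniformity)"
    by (rule open_l2_def)
  show "inner x y = inner y x" by (subst inner_l2_def, subst ci_comm, simp add: inner_l2_def)
  show "inner (x + y) z = inner x z + inner y z" by (simp add: inner_l2_def ci_add)
  show "inner (a *\<^sub>R x) y = a * inner x y" by (simp add: inner_l2_def scaleR_l2_def ci_sc)
  show "0 \<le> inner x x" by (simp add: inner_l2_def ci_Re)
  show "inner x x = 0 \<longleftrightarrow> x = 0" by (simp add: inner_l2_def ci_0)
  show "norm x = sqrt (inner x x)" by (rule norm_l2_def)
  show "c *\<^sub>C (x + y) = c *\<^sub>C x + c *\<^sub>C y" by (rule sc_r)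
  show "(d + c) *\<^sub>C x = d *\<^sub>C x + c *\<^sub>C x" by (rule sc_l)
  show "d *\<^sub>C c *\<^sub>C x = (d * c) *\<^sub>C x" by (rule sc_sc)
  show "a *\<^sub>R x = complex_of_real a *\<^sub>C x" by (rule scaleR_l2_def)
  show "cinner x y = cnj (cinner y x)" by (rule ci_comm)
  show "cinner (x + y) z = cinner x z + cinner y z" by (rule ci_add)
  show "cinner (c *\<^sub>C x) y = c * cinner x y" by (rule ci_sc)
  show "inner x y = Re (cinner x y)" by (rule inner_l2_def)
qed

end

lemma sqint_half_line_iff:
  "sqint half_line f \<longleftrightarrow> (\<lambda>x. if 0 < x then f x else 0) \<in> borel_measurable lborel
     \<and> integrable lborel (\<lambda>x. (cmod (if 0 < x then f x else 0))\<^sup>2)"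
proof -
  have 1: "(\<lambda>x. indicator {0<..} x *\<^sub>R f x) = (\<lambda>x. if 0 < x then f x else 0)"
    and 2: "(\<lambda>x. indicator {0<..} x *\<^sub>R (cmod (f x))\<^sup>2)
      = (\<lambda>x. (cmod (if 0 < x then f x else 0))\<^sup>2)" for f :: "real \<Rightarrow> complex"
    by (auto simp: indicator_def fun_eq_iff)
  show ?thesis
    unfolding sqint_def half_line_def 
    by (subst borel_measurable_restrict_space_iff, simp)
       (subst integrable_restrict_space, simp, simp only: 1 2)
qed

lemma AE_half_line_iff: "(AE x in half_line. Q x) \<longleftrightarrow> (AE x in lborel. 0 < x \<longrightarrow> Q x)"
  unfolding half_line_def by (subst AE_restrict_space_iff) auto

text \<open>The shift semigroup; only its values at \<open>t \<ge> 0\<close> matter.\<close>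

lift_definition shift :: "real \<Rightarrow> l2 \<Rightarrow> l2" is "\<lambda>t f x. if t < x then f (x - t) else 0"
proof -
  have sq: "sqint half_line (\<lambda>x. if t < x then f (x - t) else 0)" 
    if f: "sqint half_line f" for t and f :: "real \<Rightarrow> complex"
  proof -
    define g where "g = (\<lambda>x. if 0 < x then f x else 0)"
    have g[measurable]: "g \<in> borel_measurable lborel" "g \<in> borel_measurable borel"
      and gi: "integrable lborel (\<lambda>x. (cmod (g x))\<^sup>2)"
      using f by (simp_all add: sqint_half_line_iff g_def)
    have eq: "(if 0 < x then if t < x then f (x - t) else 0 else 0) 
        = indicator {0<..} x *\<^sub>R g (- t + 1 * x)" for x
      by (auto simp: g_def indicator_def)
    have i: "integrable lborel (\<lambda>x. (cmod (g (- t + 1 * x)))\<^sup>2)"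
      by (rule lborel_integrable_real_affine[OF gi]) simp
    have "integrable lborel (\<lambda>x. (cmod (indicator {0<..} x *\<^sub>R g (- t + 1 * x)))\<^sup>2)"
      by (rule Bochner_Integration.integrable_bound[OF i])
         (auto simp: indicator_def)
    then show ?thesis
      unfolding sqint_half_line_iff eq by simp
  qed
  have ae: "AE x in half_line. (if t < x then f (x - t) else 0) = (if t < x then g (x - t) else 0)"
    if "l2_rel f g" for t and f g :: "real \<Rightarrow> complex"
  proof -
    define f' where "f' = (\<lambda>x. if 0 < x then f x else 0)"
    define g' where "g' = (\<lambda>x. if 0 < x then g x else 0)"
    have m[measurable]: "f' \<in> borel_measurable borel" "g' \<in> borel_measurable borel"
      using that by (simp_all add: l2_rel_def sqint_half_line_iff f'_def g'_def)
    have "AE x in lborel. f' x = g' x"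
      using that by (auto simp: l2_rel_def AE_half_line_iff f'_def g'_def)
    then have "AE x in lborel. f' (- t + 1 * x) = g' (- t + 1 * x)"
      by (intro AE_borel_affine) auto
    then show ?thesis
      unfolding AE_half_line_iff by eventually_elim (auto simp: f'_def g'_def)
  qed
  show "l2_rel (\<lambda>x. if t < x then f (x - t) else 0) (\<lambda>x. if t < x then g (x - t) else 0)"
    if "l2_rel f g" for t f g
    using that sq ae[OF that] by (simp add: l2_rel_def)
qed

lift_definition interval_ind :: "real \<Rightarrow> l2" is "\<lambda>s. indicator {0<..<s}"
proof -
  fix s :: real
  have 1: "(if 0 < x then indicator {0<..<s} x else 0) = (indicator {0<..<s} x :: complex)"
    and 2: "(cmod (indicator {0<..<s} x))\<^sup>2 = (indicator {0<..<s} x :: real)" for x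
    by (auto simp: indicator_def)
  have "integrable lborel (indicator {0<..<s} :: real \<Rightarrow> real)"
    by (cases "0 \<le> s") (simp_all add: integrable_indicator_iff)
  then show "l2_rel (indicator {0<..<s}) (indicator {0<..<s})"
    by (simp add: l2_rel_def sqint_half_line_iff 1 2)
qed

section \<open>The symmetric Fock space over \<open>L\<^sup>2(0,\<infinity>)\<close>\<close>

text \<open>The \<open>n\<close>-th symmetric tensor power of \<open>L\<^sup>2(0,\<infinity>)\<close> is the space of symmetric functions in
  \<open>L\<^sup>2((0,\<infinity>)\<^sup>n)\<close>; points of \<open>(0,\<infinity>)\<^sup>n\<close> are the functions in \<open>space (half_line_pow n)\<close>. The Fock
  space is the Hilbert space direct sum of these spaces over all \<open>n\<close> (for \<open>n = 0\<close> the measure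
  space is a single point of mass 1, which gives the vacuum summand).\<close>

definition half_line_pow :: "nat \<Rightarrow> (nat \<Rightarrow> real) measure" where
  "half_line_pow n = PiM {..<n} (\<lambda>_. half_line)"

definition fock_fun :: "(nat \<Rightarrow> (nat \<Rightarrow> real) \<Rightarrow> complex) \<Rightarrow> bool" where
  "fock_fun F \<longleftrightarrow> (\<forall>n. sqint (half_line_pow n) (F n))
     \<and> (\<forall>n p. p permutes {..<n} \<longrightarrow> (AE x in half_line_pow n. F n (x \<circ> p) = F n x))
     \<and> summable (\<lambda>n. \<integral>x. (cmod (F n x))\<^sup>2 \<partial>half_line_pow n)"

definition fock_rel ::
  "(nat \<Rightarrow> (nat \<Rightarrow> real) \<Rightarrow> complex) \<Rightarrow> (nat \<Rightarrow> (nat \<Rightarrow> real) \<Rightarrow> complex) \<Rightarrow> bool" where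
  "fock_rel F G \<longleftrightarrow> fock_fun F \<and> fock_fun G \<and> (\<forall>n. AE x in half_line_pow n. F n x = G n x)"

definition fock_ip ::
  "(nat \<Rightarrow> (nat \<Rightarrow> real) \<Rightarrow> complex) \<Rightarrow> (nat \<Rightarrow> (nat \<Rightarrow> real) \<Rightarrow> complex) \<Rightarrow> complex" where
  "fock_ip F G = (\<Sum>n. ip (half_line_pow n) (F n) (G n))"

lemma fock_fun_0: "fock_fun (\<lambda>_ _. 0)"
  by (simp add: fock_fun_def sqint_0)

lemma fock_fun_scale:
  assumes F: "fock_fun F" shows "fock_fun (\<lambda>n x. c * F n x)"
  unfolding fock_fun_def
proof (intro conjI allI impI)
  show "sqint (half_line_pow n) (\<lambda>x. c * F n x)" for n
    using F by (simp add: fock_fun_def sqint_scale)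
  show "AE x in half_line_pow n. c * F n (x \<circ> p) = c * F n x" if "p permutes {..<n}" for n p
  proof -
    have "AE x in half_line_pow n. F n (x \<circ> p) = F n x"
      using F that by (simp add: fock_fun_def)
    then show ?thesis by eventually_elim simp
  qed
  show "summable (\<lambda>n. \<integral>x. (cmod (c * F n x))\<^sup>2 \<partial>half_line_pow n)"
    using F by (simp add: fock_fun_def norm_mult power_mult_distrib summable_mult)
qed

lemma fock_fun_add:
  assumes F: "fock_fun F" and G: "fock_fun G" shows "fock_fun (\<lambda>n x. F n x + G n x)"
  unfolding fock_fun_def
proof (intro conjI allI impI)
  have sF: "sqint (half_line_pow n) (F n)" and sG: "sqint (half_line_pow n) (G n)" for n
    using F G by (auto simp: fock_fun_def)
  show s: "sqint (half_line_pow n) (\<lambda>x. F n x + G n x)" for n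
    by (intro sqint_add sF sG)
  show "AE x in half_line_pow n. F n (x \<circ> p) + G n (x \<circ> p) = F n x + G n x"
    if "p permutes {..<n}" for n p
  proof -
    have "AE x in half_line_pow n. F n (x \<circ> p) = F n x" "AE x in half_line_pow n. G n (x \<circ> p) = G n x"
      using F G that by (auto simp: fock_fun_def)
    then show ?thesis by eventually_elim simp
  qed
  let ?S = "\<lambda>H n. \<integral>x. (cmod (H n x))\<^sup>2 \<partial>half_line_pow n"
  have le: "?S (\<lambda>n x. F n x + G n x) n \<le> 2 * ?S F n + 2 * ?S G n" for n
  proof -
    have "?S (\<lambda>n x. F n x + G n x) n 
        \<le> (\<integral>x. 2 * (cmod (F n x))\<^sup>2 + 2 * (cmod (G n x))\<^sup>2 \<partial>half_line_pow n)"
      using s[of n] sF[of n] sG[of n] norm_add_sq_le by (intro integral_mono) (auto simp: sqint_def)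
    then show ?thesis using sF[of n] sG[of n] by (simp add: sqint_def)
  qed
  show "summable (?S (\<lambda>n x. F n x + G n x))"
  proof (rule summable_comparison_test'[where N = 0])
    show "summable (\<lambda>n. 2 * ?S F n + 2 * ?S G n)"
      using F G by (intro summable_add summable_mult) (auto simp: fock_fun_def)
    show "norm (?S (\<lambda>n x. F n x + G n x) n) \<le> 2 * ?S F n + 2 * ?S G n" for n
      using le[of n] by (simp add: abs_of_nonneg)
  qed
qed

lemma fock_ip_summable:
  assumes F: "fock_fun F" and G: "fock_fun G"
  shows "summable (\<lambda>n. ip (half_line_pow n) (F n) (G n))"
proof (rule summable_comparison_test'[where N = 0])
  show "summable (\<lambda>n. (\<integral>x. (cmod (F n x))\<^sup>2 \<partial>half_line_pow n) + (\<integral>x. (cmod (G n x))\<^sup>2 \<partial>half_line_pow n))"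
    using F G by (intro summable_add) (auto simp: fock_fun_def)
  show "norm (ip (half_line_pow n) (F n) (G n)) \<le>
      (\<integral>x. (cmod (F n x))\<^sup>2 \<partial>half_line_pow n) + (\<integral>x. (cmod (G n x))\<^sup>2 \<partial>half_line_pow n)" for n
    using F G by (intro norm_ip_le) (auto simp: fock_fun_def)
qed

lemma fock_ip_self:
  assumes F: "fock_fun F"
  shows "fock_ip F F = complex_of_real (\<Sum>n. \<integral>x. (cmod (F n x))\<^sup>2 \<partial>half_line_pow n)"
  using F unfolding fock_ip_def ip_self fock_fun_def by (subst suminf_of_real) auto

quotient_type fock = "nat \<Rightarrow> (nat \<Rightarrow> real) \<Rightarrow> complex" / partial: fock_rel
proof (rule part_equivpI)
  show "\<exists>F. fock_rel F F"
    by (rule exI[of _ "\<lambda>_ _. 0"]) (simp add: fock_rel_def fock_fun_0)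
  show "symp fock_rel"
    by (simp add: fock_rel_def symp_def eq_commute)
  show "transp fock_rel"
  proof (rule transpI)
    fix F G H assume *: "fock_rel F G" "fock_rel G H"
    have "AE x in half_line_pow n. F n x = H n x" for n
    proof -
      have "AE x in half_line_pow n. F n x = G n x" "AE x in half_line_pow n. G n x = H n x"
        using * by (auto simp: fock_rel_def)
      then show ?thesis by eventually_elim simp
    qed
    then show "fock_rel F H" using * by (simp add: fock_rel_def)
  qed
qed

instantiation fock :: complex_inner
begin

lift_definition zero_fock :: fock is "\<lambda>_ _. 0"
  by (simp add: fock_rel_def fock_fun_0)

lift_definition plus_fock :: "fock \<Rightarrow> fock \<Rightarrow> fock" is "\<lambda>F G n x. F n x + G n x"
  unfolding fock_rel_def
proof (intro conjI allI; (elim conjE)?)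
  fix F F' G G' :: "nat \<Rightarrow> (nat \<Rightarrow> real) \<Rightarrow> complex" and n
  assume "\<forall>n. AE x in half_line_pow n. F n x = F' n x" "\<forall>n. AE x in half_line_pow n. G n x = G' n x"
  then have "AE x in half_line_pow n. F n x = F' n x" "AE x in half_line_pow n. G n x = G' n x"
    by auto
  then show "AE x in half_line_pow n. F n x + G n x = F' n x + G' n x"
    by eventually_elim simp
qed (auto intro: fock_fun_add)

lift_definition scaleC_fock :: "complex \<Rightarrow> fock \<Rightarrow> fock" is "\<lambda>c F n x. c * F n x"
  unfolding fock_rel_def
proof (intro conjI allI; (elim conjE)?)
  fix c :: complex and F G :: "nat \<Rightarrow> (nat \<Rightarrow> real) \<Rightarrow> complex" and n
  assume "\<forall>n. AE x in half_line_pow n. F n x = G n x"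
  then have "AE x in half_line_pow n. F n x = G n x"
    by auto
  then show "AE x in half_line_pow n. c * F n x = c * G n x"
    by eventually_elim simp
qed (auto intro: fock_fun_scale)

lift_definition cinner_fock :: "fock \<Rightarrow> fock \<Rightarrow> complex" is fock_ip
  unfolding fock_rel_def fock_ip_def fock_fun_def
  by (intro arg_cong[where f = suminf] ext ip_cong_AE) auto

definition uminus_fock :: "fock \<Rightarrow> fock" where "uminus_fock x = (- 1) *\<^sub>C x"
definition minus_fock :: "fock \<Rightarrow> fock \<Rightarrow> fock" where "minus_fock x y = x + (- y)"
definition scaleR_fock :: "real \<Rightarrow> fock \<Rightarrow> fock" where "scaleR_fock r x = complex_of_real r *\<^sub>C x"
definition inner_fock :: "fock \<Rightarrow> fock \<Rightarrow> real" where "inner_fock x y = Re (cinner x y)"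
definition norm_fock :: "fock \<Rightarrow> real" where "norm_fock x = sqrt (inner x x)"
definition sgn_fock :: "fock \<Rightarrow> fock" where "sgn_fock x = inverse (norm x) *\<^sub>R x"
definition dist_fock :: "fock \<Rightarrow> fock \<Rightarrow> real" where "dist_fock x y = norm (x - y)"
definition uniformity_fock :: "(fock \<times> fock) filter" where
  "uniformity_fock = (INF e\<in>{0<..}. principal {(x, y). dist x y < e})"
definition open_fock :: "fock set \<Rightarrow> bool" where
  "open_fock U \<longleftrightarrow> (\<forall>x\<in>U. eventually (\<lambda>(x', y). x' = x \<longrightarrow> y \<in> U) uniformity)"

instance
proof
  fix x y z :: fock and a b :: real and c d :: complex and U :: "fock set"
  have add_commute: "x + y = y + x" for x y :: fock
    by transfer (auto simp: fock_rel_def add.commute intro!: fock_fun_add)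
  have add_zero: "0 + x = x" for x :: fock
    by transfer (auto simp: fock_rel_def)
  have scaleC1: "1 *\<^sub>C x = x" for x :: fock
    by transfer (auto simp: fock_rel_def)
  have scaleC0: "0 *\<^sub>C x = 0" for x :: fock
    by transfer (auto simp: fock_rel_def fock_fun_0)
  have sc_r: "c *\<^sub>C (x + y) = c *\<^sub>C x + c *\<^sub>C y" for c and x y :: fock
    by transfer (auto simp: fock_rel_def distrib_left intro!: fock_fun_add fock_fun_scale)
  have sc_l: "(c + d) *\<^sub>C x = c *\<^sub>C x + d *\<^sub>C x" for c d and x :: fock
    by transfer (auto simp: fock_rel_def distrib_right intro!: fock_fun_add fock_fun_scale)
  have sc_sc: "c *\<^sub>C d *\<^sub>C x = (c * d) *\<^sub>C x" for c d and x :: fock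
    by transfer (auto simp: fock_rel_def mult.assoc intro!: fock_fun_scale)
  have ci_comm: "cinner x y = cnj (cinner y x)" for x y :: fock
  proof transfer
    fix F G assume "fock_rel F F" "fock_rel G G"
    then have s: "summable (\<lambda>n. ip (half_line_pow n) (G n) (F n))"
      by (intro fock_ip_summable) (auto simp: fock_rel_def)
    have "(\<lambda>n. cnj (ip (half_line_pow n) (G n) (F n))) sums cnj (fock_ip G F)"
      unfolding fock_ip_def by (subst sums_cnj) (rule summable_sums[OF s])
    then have "(\<lambda>n. ip (half_line_pow n) (F n) (G n)) sums cnj (fock_ip G F)"
      by (subst ip_commute)
    then show "fock_ip F G = cnj (fock_ip G F)"
      unfolding fock_ip_def[of F G] by (rule sums_unique[symmetric])
  qed
  have ci_add: "cinner (x + y) z = cinner x z + cinner y z" for x y z :: fock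
  proof transfer
    fix F G H assume *: "fock_rel F F" "fock_rel G G" "fock_rel H H"
    have "ip (half_line_pow n) (\<lambda>x. F n x + G n x) (H n)
        = ip (half_line_pow n) (F n) (H n) + ip (half_line_pow n) (G n) (H n)" for n
      using * by (intro ip_add) (auto simp: fock_rel_def fock_fun_def)
    then show "fock_ip (\<lambda>n x. F n x + G n x) H = fock_ip F H + fock_ip G H"
      using * unfolding fock_ip_def
      by (simp add: suminf_add fock_ip_summable fock_rel_def)
  qed
  have ci_sc: "cinner (c *\<^sub>C x) y = c * cinner x y" for c and x y :: fock
  proof transfer
    fix c F G assume *: "fock_rel F F" "fock_rel G G"
    show "fock_ip (\<lambda>n x. c * F n x) G = c * fock_ip F G"
      using * unfolding fock_ip_def ip_scale
      by (intro suminf_mult fock_ip_summable) (auto simp: fock_rel_def)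
  qed
  have ci_Re: "Re (cinner x x) \<ge> 0" for x :: fock
    by transfer (auto simp: fock_ip_self fock_rel_def fock_fun_def intro!: suminf_nonneg)
  have ci_0: "Re (cinner x x) = 0 \<longleftrightarrow> x = 0" for x :: fock
  proof transfer
    fix F assume "fock_rel F F"
    then have F: "fock_fun F" by (simp add: fock_rel_def)
    have "Re (fock_ip F F) = 0 \<longleftrightarrow> (\<forall>n. (\<integral>x. (cmod (F n x))\<^sup>2 \<partial>half_line_pow n) = 0)"
      unfolding fock_ip_self[OF F] Re_complex_of_real 
      using F by (subst suminf_eq_zero_iff) (auto simp: fock_fun_def)
    also have "\<dots> \<longleftrightarrow> (\<forall>n. ip (half_line_pow n) (F n) (F n) = 0)"
      by (simp add: ip_self)
    also have "\<dots> \<longleftrightarrow> (\<forall>n. AE x in half_line_pow n. F n x = 0)"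
      using F by (intro all_cong1 ip_self_eq_0) (auto simp: fock_fun_def)
    finally show "Re (fock_ip F F) = 0 \<longleftrightarrow> fock_rel F (\<lambda>_ _. 0)"
      using F by (simp add: fock_rel_def fock_fun_0)
  qed
  show "x + y + z = x + (y + z)"
    by transfer (auto simp: fock_rel_def add.assoc intro!: fock_fun_add)
  show "x + y = y + x" by (rule add_commute)
  show "0 + x = x" by (rule add_zero)
  show "- x + x = 0"
    using sc_l[of "-1" 1 x] by (simp add: uminus_fock_def scaleC1 scaleC0)
  show "x - y = x + - y" by (rule minus_fock_def)
  show "a *\<^sub>R (x + y) = a *\<^sub>R x + a *\<^sub>R y" by (simp add: scaleR_fock_def sc_r)
  show "(a + b) *\<^sub>R x = a *\<^sub>R x + b *\<^sub>R x" by (simp add: scaleR_fock_def sc_l)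
  show "a *\<^sub>R b *\<^sub>R x = (a * b) *\<^sub>R x" by (simp add: scaleR_fock_def sc_sc)
  show "1 *\<^sub>R x = x" by (simp add: scaleR_fock_def scaleC1)
  show "dist x y = norm (x - y)" by (rule dist_fock_def)
  show "sgn x = inverse (norm x) *\<^sub>R x" by (rule sgn_fock_def)
  show "uniformity = (INF e\<in>{0<..}. principal {(x :: fock, y). dist x y < e})"
    by (rule uniformity_fock_def)
  show "open U \<longleftrightarrow> (\<forall>x\<in>U. eventually (\<lambda>(x', y). x' = x \<longrightarrow> y \<in> U) uniformity)"
    by (rule open_fock_def)
  show "inner x y = inner y x" by (subst inner_fock_def, subst ci_comm, simp add: inner_fock_def)
  show "inner (x + y) z = inner x z + inner y z" by (simp add: inner_fock_def ci_add)
  show "inner (a *\<^sub>R x) y = a * inner x y" by (simp add: inner_fock_def scaleR_fock_def ci_sc)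
  show "0 \<le> inner x x" by (simp add: inner_fock_def ci_Re)
  show "inner x x = 0 \<longleftrightarrow> x = 0" by (simp add: inner_fock_def ci_0)
  show "norm x = sqrt (inner x x)" by (rule norm_fock_def)
  show "c *\<^sub>C (x + y) = c *\<^sub>C x + c *\<^sub>C y" by (rule sc_r)
  show "(d + c) *\<^sub>C x = d *\<^sub>C x + c *\<^sub>C x" by (rule sc_l)
  show "d *\<^sub>C c *\<^sub>C x = (d * c) *\<^sub>C x" by (rule sc_sc)
  show "a *\<^sub>R x = complex_of_real a *\<^sub>C x" by (rule scaleR_fock_def)
  show "cinner x y = cnj (cinner y x)" by (rule ci_comm)
  show "cinner (x + y) z = cinner x z + cinner y z" by (rule ci_add)
  show "cinner (c *\<^sub>C x) y = c * cinner x y" by (rule ci_sc)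
  show "inner x y = Re (cinner x y)" by (rule inner_fock_def)
qed

end


interpretation half_line: product_sigma_finite "\<lambda>_ :: nat. half_line"
proof (rule product_sigma_finite.intro)
  show "sigma_finite_measure half_line"
    unfolding half_line_def
    by (rule sigma_finite_measure_restrict_space) (auto intro: lborel.sigma_finite_measure_axioms)
qed

lemma AE_half_line_pow_component:
  assumes i: "i < n" and Q: "AE x in half_line. Q x"
  shows "AE x in half_line_pow n. Q (x i)"
proof -
  from Q obtain N where N: "{x \<in> space half_line. \<not> Q x} \<subseteq> N" "N \<in> sets half_line"
    "emeasure half_line N = 0" by (rule AE_E)
  let ?A = "\<lambda>j. if j = i then N else space half_line"
  have "emeasure (half_line_pow n) (Pi\<^sub>E {..<n} ?A) = (\<Prod>j<n. emeasure half_line (?A j))"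
    unfolding half_line_pow_def using N by (intro half_line.emeasure_PiM) auto
  also have "\<dots> = 0" using i N by (intro prod_zero) auto
  finally have "Pi\<^sub>E {..<n} ?A \<in> null_sets (half_line_pow n)"
    using N by (auto simp: half_line_pow_def intro!: null_setsI sets_PiM_I_finite)
  moreover have "{x \<in> space (half_line_pow n). \<not> Q (x i)} \<subseteq> Pi\<^sub>E {..<n} ?A"
  proof (rule subsetI, rule PiE_I)
    fix x j assume x: "x \<in> {x \<in> space (half_line_pow n). \<not> Q (x i)}"
    then have *: "x \<in> ({..<n} \<rightarrow>\<^sub>E space half_line)" and "\<not> Q (x i)"
      by (simp_all add: half_line_pow_def space_PiM)
    then have "x i \<in> N" using N(1) PiE_mem[OF *, of i] i by auto
    then show "x j \<in> ?A j" if "j \<in> {..<n}"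
      using PiE_mem[OF * that] by simp
    show "x j = undefined" if "j \<notin> {..<n}"
      using * that by (rule PiE_arb)
  qed
  ultimately show ?thesis by (rule AE_I')
qed

lemma expvec_fock_fun:
  assumes f: "sqint half_line f"
  shows "fock_fun (\<lambda>n x. (\<Prod>i<n. f (x i)) / complex_of_real (sqrt (fact n)))" (is "fock_fun ?F")
proof -
  have fm: "f \<in> borel_measurable half_line" and fi: "integrable half_line (\<lambda>x. (cmod (f x))\<^sup>2)"
    using f by (auto simp: sqint_def)
  have sq: "(cmod (?F n x))\<^sup>2 = (\<Prod>i<n. (cmod (f (x i)))\<^sup>2) / fact n" for n and x :: "nat \<Rightarrow> real"
    by (simp add: norm_divide prod_norm[symmetric] power_divide prod_power_distrib)
  have m: "?F n \<in> borel_measurable (half_line_pow n)" for n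
  proof -
    have "(\<lambda>x. f (x i)) \<in> borel_measurable (half_line_pow n)" if "i < n" for i
      unfolding half_line_pow_def
      by (rule measurable_compose[OF measurable_component_singleton[where i = i] fm]) (use that in simp)
    then show ?thesis by (intro borel_measurable_divide borel_measurable_prod) auto
  qed
  have prod_integrable: "integrable (half_line_pow n) (\<lambda>x. \<Prod>i<n. (cmod (f (x i)))\<^sup>2)" for n
    unfolding half_line_pow_def by (intro half_line.product_integrable_prod) (auto intro: fi)
  have prod_integral: "(\<integral>x. (\<Prod>i<n. (cmod (f (x i)))\<^sup>2) \<partial>half_line_pow n) 
      = (\<integral>x. (cmod (f x))\<^sup>2 \<partial>half_line) ^ n" for n
    unfolding half_line_pow_def by (subst half_line.product_integral_prod) (auto intro: fi)
  show ?thesis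
    unfolding fock_fun_def
  proof (intro conjI allI impI)
    show "sqint (half_line_pow n) (?F n)" for n
      unfolding sqint_def sq using m prod_integrable by simp
    show "AE x in half_line_pow n. ?F n (x \<circ> p) = ?F n x" if "p permutes {..<n}" for n p
    proof (rule AE_I2)
      fix x :: "nat \<Rightarrow> real"
      show "?F n (x \<circ> p) = ?F n x"
        using prod.permute[OF that, of "\<lambda>i. f (x i)"] by (simp add: o_def)
    qed
    show "summable (\<lambda>n. \<integral>x. (cmod (?F n x))\<^sup>2 \<partial>half_line_pow n)"
      unfolding sq using summable_exp[of "\<integral>x. (cmod (f x))\<^sup>2 \<partial>half_line"]
      by (simp add: prod_integral field_simps)
  qed
qed

text \<open>The factor \<open>1/\<surd>(n!)\<close> gives \<open>\<langle>e(\<xi>)|e(\<eta>)\<rangle> = exp \<langle>\<xi>|\<eta>\<rangle>\<close>.\<close>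

lift_definition expvec :: "l2 \<Rightarrow> fock" is
  "\<lambda>f n x. (\<Prod>i<n. f (x i)) / complex_of_real (sqrt (fact n))"
proof -
  fix f g assume fg: "l2_rel f g"
  have "AE x in half_line_pow n. (\<Prod>i<n. f (x i)) / complex_of_real (sqrt (fact n))
      = (\<Prod>i<n. g (x i)) / complex_of_real (sqrt (fact n))" for n
  proof -
    have "AE x in half_line_pow n. \<forall>i\<in>{..<n}. f (x i) = g (x i)"
      using fg by (intro AE_finite_allI AE_half_line_pow_component) (auto simp: l2_rel_def)
    then show ?thesis by eventually_elim (auto intro!: prod.cong)
  qed
  then show "fock_rel (\<lambda>n x. (\<Prod>i<n. f (x i)) / complex_of_real (sqrt (fact n)))
      (\<lambda>n x. (\<Prod>i<n. g (x i)) / complex_of_real (sqrt (fact n)))"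
    using fg by (simp add: fock_rel_def l2_rel_def expvec_fock_fun)
qed

section \<open>Operators on Fock space\<close>

type_synonym op = "fock \<Rightarrow> fock"

definition bounded_ops :: "op set" where
  "bounded_ops = {T. bounded_linear T \<and> (\<forall>c v. T (c *\<^sub>C v) = c *\<^sub>C T v)}"

definition adj :: "op \<Rightarrow> op" where
  "adj T = (THE S. S \<in> bounded_ops \<and> (\<forall>v w. cinner (T v) w = cinner v (S w)))"

definition weyl :: "l2 \<Rightarrow> op" where
  "weyl \<xi> = (THE W. W \<in> bounded_ops \<and>
     (\<forall>\<eta>. W (expvec \<eta>) = exp (- (complex_of_real (norm \<xi>))\<^sup>2 / 2 - cinner \<eta> \<xi>) *\<^sub>C expvec (\<xi> + \<eta>)))"

text \<open>The \<open>\<sigma>\<close>-weakly continuous functionals, that is, the predual of the algebra of bounded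
  operators. A \<open>*\<close>-endomorphism is normal if it is \<open>\<sigma>\<close>-weakly continuous, that is, if composition
  with it maps the predual to itself.\<close>

definition normal_functional :: "(op \<Rightarrow> complex) \<Rightarrow> bool" where
  "normal_functional \<phi> \<longleftrightarrow> (\<exists>v w. summable (\<lambda>n. (norm (v n :: fock))\<^sup>2) \<and> summable (\<lambda>n. (norm (w n))\<^sup>2)
     \<and> (\<forall>A\<in>bounded_ops. (\<lambda>n. cinner (A (v n)) (w n)) sums \<phi> A))"

definition unital_normal_star_endo :: "(op \<Rightarrow> op) \<Rightarrow> bool" where
  "unital_normal_star_endo \<beta> \<longleftrightarrow>
     (\<forall>A\<in>bounded_ops. \<beta> A \<in> bounded_ops)
     \<and> (\<forall>A\<in>bounded_ops. \<forall>B\<in>bounded_ops. \<beta> (\<lambda>v. A v + B v) = (\<lambda>v. \<beta> A v + \<beta> B v))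
     \<and> (\<forall>c. \<forall>A\<in>bounded_ops. \<beta> (\<lambda>v. c *\<^sub>C A v) = (\<lambda>v. c *\<^sub>C \<beta> A v))
     \<and> (\<forall>A\<in>bounded_ops. \<forall>B\<in>bounded_ops. \<beta> (A \<circ> B) = \<beta> A \<circ> \<beta> B)
     \<and> (\<forall>A\<in>bounded_ops. \<beta> (adj A) = adj (\<beta> A))
     \<and> \<beta> id = id
     \<and> (\<forall>\<phi>. normal_functional \<phi> \<longrightarrow> normal_functional (\<lambda>A. \<phi> (\<beta> A)))"

section \<open>CCR flows and product systems\<close>

definition Omega_star :: "'v::euclidean_space set \<Rightarrow> 'v set" where
  "Omega_star P = {l. \<forall>x\<in>P - {0}. l \<bullet> x > 0}"

text \<open>\<open>ccr_flow P \<mu> \<alpha>\<close> says that \<open>\<alpha>\<close> is the CCR flow over \<open>P\<close> of the isometric representation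
  \<open>V\<^sub>x = S\<^bsub>\<langle>\<mu>|x\<rangle>\<^esub>\<close>. These conditions determine \<open>\<alpha> x A\<close> for \<open>x \<in> P\<close> and bounded \<open>A\<close>; the other
  values of \<open>\<alpha>\<close> are irrelevant.\<close>

definition ccr_flow :: "'v::euclidean_space set \<Rightarrow> 'v \<Rightarrow> ('v \<Rightarrow> op \<Rightarrow> op) \<Rightarrow> bool" where
  "ccr_flow P \<mu> \<alpha> \<longleftrightarrow>
     (\<forall>x\<in>P. unital_normal_star_endo (\<alpha> x))
     \<and> (\<forall>A\<in>bounded_ops. \<alpha> 0 A = A)
     \<and> (\<forall>x\<in>P. \<forall>y\<in>P. \<forall>A\<in>bounded_ops. \<alpha> (x + y) A = \<alpha> x (\<alpha> y A))
     \<and> (\<forall>A\<in>bounded_ops. \<forall>v w. continuous_on P (\<lambda>x. cinner (\<alpha> x A v) w))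
     \<and> (\<forall>x\<in>P. \<forall>\<xi>. \<alpha> x (weyl \<xi>) = weyl (shift (\<mu> \<bullet> x) \<xi>))"

text \<open>Product systems whose fibres are linear spaces of operators (with the pointwise vector space
  operations); \<open>msections\<close> are the measurable sections.\<close>

record 'v product_system =
  fibre :: "'v \<Rightarrow> op set"
  fibre_inner :: "'v \<Rightarrow> op \<Rightarrow> op \<Rightarrow> complex"
  mult :: "'v \<Rightarrow> 'v \<Rightarrow> op \<Rightarrow> op \<Rightarrow> op"
  msections :: "('v \<Rightarrow> op) set"

definition intertwiners :: "('v \<Rightarrow> op \<Rightarrow> op) \<Rightarrow> 'v \<Rightarrow> op set" where
  "intertwiners \<alpha> x = {T \<in> bounded_ops. \<forall>A\<in>bounded_ops. \<alpha> x A \<circ> T = T \<circ> A}"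

text \<open>The twist is \<open>W(\<chi>(a) h\<^sub>b)\<close> with \<open>\<chi>(a) = \<langle>lam|a\<rangle>\<close> and \<open>h\<^sub>b\<close> the indicator of \<open>(0, \<langle>\<mu>|b\<rangle>)\<close>.\<close>

definition twisted_system ::
  "'v::euclidean_space set \<Rightarrow> 'v \<Rightarrow> 'v \<Rightarrow> ('v \<Rightarrow> op \<Rightarrow> op) \<Rightarrow> 'v product_system" where
  "twisted_system P lam \<mu> \<alpha> = \<lparr>
     fibre = intertwiners \<alpha>,
     fibre_inner = (\<lambda>x S T. THE c. adj T \<circ> S = (\<lambda>v. c *\<^sub>C v)),
     mult = (\<lambda>a b S T. S \<circ> weyl (complex_of_real (lam \<bullet> a) *\<^sub>C interval_ind (\<mu> \<bullet> b)) \<circ> T),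
     msections = {T. (\<forall>x\<in>P. T x \<in> intertwiners \<alpha> x) \<and>
       (\<forall>v w. (\<lambda>x. cinner (T x v) w) \<in> borel_measurable (restrict_space borel P))}\<rparr>"

definition fibre_unitary :: "'v product_system \<Rightarrow> 'v product_system \<Rightarrow> 'v \<Rightarrow> (op \<Rightarrow> op) \<Rightarrow> bool" where
  "fibre_unitary E F x U \<longleftrightarrow>
     bij_betw U (fibre E x) (fibre F x)
     \<and> (\<forall>S\<in>fibre E x. \<forall>T\<in>fibre E x. U (\<lambda>v. S v + T v) = (\<lambda>v. U S v + U T v))
     \<and> (\<forall>c. \<forall>S\<in>fibre E x. U (\<lambda>v. c *\<^sub>C S v) = (\<lambda>v. c *\<^sub>C U S v))
     \<and> (\<forall>S\<in>fibre E x. \<forall>T\<in>fibre E x. fibre_inner F x (U S) (U T) = fibre_inner E x S T)"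

definition isomorphic_over ::
  "'v::euclidean_space set \<Rightarrow> 'v product_system \<Rightarrow> 'v product_system \<Rightarrow> bool" where
  "isomorphic_over P E F \<longleftrightarrow> (\<exists>\<theta>.
     (\<forall>x\<in>P. fibre_unitary E F x (\<theta> x))
     \<and> (\<forall>a\<in>P. \<forall>b\<in>P. \<forall>S\<in>fibre E a. \<forall>T\<in>fibre E b.
          \<theta> (a + b) (mult E a b S T) = mult F a b (\<theta> a S) (\<theta> b T))
     \<and> (\<forall>T\<in>msections E. (\<lambda>x. \<theta> x (T x)) \<in> msections F))"

end

theory Submission
  imports Defs
begin

text \<open>
  Why an isomorphism forces \<open>\<mu>\<^sub>1\<close> and \<open>\<mu>\<^sub>2\<close> to be proportional. Call \<open>\<langle>\<mu>|x\<rangle>\<close> the height of \<open>x\<close>.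
  As \<open>P\<close> spans, it suffices that points of \<open>P\<close> with equal \<open>\<mu>\<^sub>1\<close>-height have equal
  \<open>\<mu>\<^sub>2\<close>-height: then the kernel of \<open>\<mu>\<^sub>1\<close> lies in that of \<open>\<mu>\<^sub>2\<close>. This is read off from the
  linear and multiplicative structure of the fibres alone.

  The fibre over \<open>x\<close> consists of all bounded \<open>T\<close> with \<open>T W(\<xi>) = W(S\<^sub>t \<xi>) T\<close> for all \<open>\<xi>\<close>, where \<open>t\<close> is
  the height of \<open>x\<close> (\<open>ccr_flow_intertwiners\<close>); in particular it depends on \<open>x\<close> only through \<open>t\<close>.
  Hence, if \<open>a\<close> and \<open>a'\<close> have the same \<open>\<mu>\<^sub>1\<close>-height and \<open>S\<close> is in their common fibre, then \<open>S\<close>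
  times the fibre over \<open>a'\<close> and \<open>S\<close> times the fibre over \<open>a\<close> are the same set of operators inside
  the fibre over \<open>a + a'\<close>. The twist does not disturb this: the Weyl operator in the
  product is unitary and acts on the fibre to its right. Applying the isomorphism yields
  nonzero \<open>R\<close> and \<open>R'\<close> in the fibres over \<open>a\<close> and \<open>a'\<close> of the second system such that \<open>R\<close> times
  the fibre over \<open>a'\<close> is contained in \<open>R'\<close> times the fibre over \<open>a\<close>. In the picture where the fibre at
  height \<open>t\<close> is the Fock space of \<open>L\<^sup>2(0,t)\<close>, with \<open>s\<close> and \<open>s'\<close> the \<open>\<mu>\<^sub>2\<close>-heights of \<open>a\<close> and
  \<open>a'\<close>, this says \<open>\<psi> \<otimes> \<Gamma>(L\<^sup>2(s,s+s')) \<subseteq> \<psi>' \<otimes> \<Gamma>(L\<^sup>2(s',s+s'))\<close>, which is impossible for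
  \<open>s < s'\<close> (\<open>no_intertwiner_absorption\<close>). By symmetry \<open>s = s'\<close>.

  Two facts carry the argument. The Weyl operators act irreducibly (\<open>weyl_irreducible\<close>): for
  \<open>X\<close> in the commutant, \<open>\<langle>X e(z\<xi>)|e(0)\<rangle>\<close> is both holomorphic and antiholomorphic in \<open>z\<close>. And the
  intertwiners of a normal unital endomorphism \<open>\<beta>\<close> have total range
  (\<open>total_endo_intertwiners\<close>): they include the maps \<open>w \<mapsto> \<beta>(|w\<rangle>\<langle>v|)\<psi>\<close>, and a normal functional
  vanishing on finite rank operators vanishes at the identity. Both need that the concrete Fock
  space is complete and that exponential vectors are total in it, which the first half of the
  development provides, together with projections, adjoints and the existence of the Weyl
  operators.\<close>

section \<open>Complex Hilbert spaces\<close>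

lemma scaleC_one [simp]: "1 *\<^sub>C x = (x :: 'a::complex_inner)"
  using scaleR_scaleC[of 1 x] by simp

lemma scaleC_zero_left [simp]: "0 *\<^sub>C x = (0 :: 'a::complex_inner)"
  using scaleR_scaleC[of 0 x] by simp

lemma scaleC_zero_right [simp]: "c *\<^sub>C 0 = (0 :: 'a::complex_inner)"
  using scaleC_scaleC[of c 0 "0 :: 'a"] by simp

lemma scaleC_scaleR: "c *\<^sub>C r *\<^sub>R x = r *\<^sub>R c *\<^sub>C (x :: 'a::complex_inner)"
  by (simp add: scaleR_scaleC scaleC_scaleC mult.commute)

lemma cinner_add_right: "cinner x (y + z) = cinner x y + cinner x (z :: 'a::complex_inner)"
  by (metis cinner_add_left cinner_commute complex_cnj_add)

lemma cinner_scaleC_right: "cinner x (c *\<^sub>C y) = cnj c * cinner x (y :: 'a::complex_inner)"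
  by (metis cinner_commute cinner_scaleC_left complex_cnj_mult)

lemma cinner_scaleR_left: "cinner (r *\<^sub>R x) y = r * cinner x (y :: 'a::complex_inner)"
  by (simp add: scaleR_scaleC cinner_scaleC_left)

lemma cinner_scaleR_right: "cinner x (r *\<^sub>R y) = r * cinner x (y :: 'a::complex_inner)"
  by (simp add: scaleR_scaleC cinner_scaleC_right)

lemma cinner_self: "cinner x x = complex_of_real ((norm (x :: 'a::complex_inner))\<^sup>2)"
proof -
  have "Im (cinner x x) = 0" using cinner_commute[of x x] by (simp add: complex_eq_iff)
  then show ?thesis
    by (simp add: complex_eq_iff power2_norm_eq_inner inner_eq_Re_cinner)
qed

lemma norm_scaleC [simp]: "norm (c *\<^sub>C x) = cmod c * norm (x :: 'a::complex_inner)"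
proof -
  have "complex_of_real ((norm (c *\<^sub>C x))\<^sup>2) = complex_of_real ((cmod c * norm x)\<^sup>2)"
    by (simp add: cinner_self[symmetric] cinner_scaleC_left cinner_scaleC_right power_mult_distrib
        complex_norm_square mult.assoc del: of_real_power)
  then have "(norm (c *\<^sub>C x))\<^sup>2 = (cmod c * norm x)\<^sup>2"
    by (simp only: of_real_eq_iff)
  then show ?thesis by (simp add: power2_eq_iff_nonneg)
qed

lemma norm_cinner_le: "cmod (cinner x y) \<le> norm x * norm (y :: 'a::complex_inner)"
proof (cases "cinner x y = 0")
  case False
  define u where "u = cnj (cinner x y) / cmod (cinner x y)"
  have u: "cmod u = 1" using False by (simp add: u_def norm_divide)
  have "u * cinner x y = cmod (cinner x y)"
    using False by (simp add: u_def complex_norm_square[symmetric] mult.commute power2_eq_square)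
  then have "cmod (cinner x y) = inner (u *\<^sub>C x) y"
    by (simp add: inner_eq_Re_cinner cinner_scaleC_left)
  also have "\<dots> \<le> norm (u *\<^sub>C x) * norm y" by (rule norm_cauchy_schwarz)
  finally show ?thesis by (simp add: u)
qed simp

lemma bounded_bilinear_cinner: "bounded_bilinear (cinner :: 'a::complex_inner \<Rightarrow> 'a \<Rightarrow> complex)"
  by unfold_locales
     (auto simp: cinner_add_left cinner_add_right cinner_scaleR_left cinner_scaleR_right
        scaleR_conv_of_real intro!: exI[of _ 1] norm_cinner_le)

interpretation cinner: bounded_bilinear "cinner :: 'a::complex_inner \<Rightarrow> 'a \<Rightarrow> complex"
  by (rule bounded_bilinear_cinner)

lemma bounded_linear_scaleC: "bounded_linear (\<lambda>x :: 'a::complex_inner. c *\<^sub>C x)"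
  by (rule bounded_linear_intro[of _ "cmod c"])
     (auto simp: scaleC_add_right scaleC_scaleR mult.commute)

lemma scaleC_minus_right: "c *\<^sub>C (x - y) = c *\<^sub>C x - c *\<^sub>C (y :: 'a::complex_inner)"
  by (rule linear_diff[OF bounded_linear.linear[OF bounded_linear_scaleC]])

lemma cinner_extensionality:
  assumes "\<And>z. cinner x z = cinner y z" shows "x = (y :: 'a::complex_inner)"
proof -
  have "cinner (x - y) (x - y) = 0" using assms by (simp add: cinner.diff_left)
  then show ?thesis by (simp add: cinner_self)
qed

lemma cinner_extensionality_right:
  assumes "\<And>z. cinner z x = cinner z y" shows "x = (y :: 'a::complex_inner)"
proof -
  have "cinner (x - y) (x - y) = 0" using assms by (simp add: cinner.diff_right)
  then show ?thesis by (simp add: cinner_self)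
qed

lemma inner_scaleC_eq_0_imp:
  assumes "\<And>c. inner x (c *\<^sub>C y) = 0" shows "cinner x (y :: 'a::complex_inner) = 0"
  using assms[of 1] assms[of \<i>]
  by (auto simp: inner_eq_Re_cinner cinner_scaleC_right complex_eq_iff)

lemma subspace_closure:
  fixes S :: "'a::real_normed_vector set"
  assumes S: "subspace S" shows "subspace (closure S)"
proof (rule subspaceI)
  show "0 \<in> closure S" using subspace_0[OF S] closure_subset by blast
next
  fix x y assume "x \<in> closure S" "y \<in> closure S"
  then obtain s t where "\<And>n. s n \<in> S" "s \<longlonglongrightarrow> x" "\<And>n. t n \<in> S" "t \<longlonglongrightarrow> y"
    unfolding closure_sequential by blast
  then have "\<forall>n. s n + t n \<in> S" "(\<lambda>n. s n + t n) \<longlonglongrightarrow> x + y"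
    using S by (auto intro: subspace_add tendsto_add)
  then show "x + y \<in> closure S"
    unfolding closure_sequential by (intro exI[of _ "\<lambda>n. s n + t n"] conjI)
next
  fix r x assume "x \<in> closure S"
  then obtain s where "\<And>n. s n \<in> S" "s \<longlonglongrightarrow> x"
    unfolding closure_sequential by blast
  then have "\<forall>n. r *\<^sub>R s n \<in> S" "(\<lambda>n. r *\<^sub>R s n) \<longlonglongrightarrow> r *\<^sub>R x"
    using S by (auto intro: subspace_scale tendsto_intros)
  then show "r *\<^sub>R x \<in> closure S"
    unfolding closure_sequential by (intro exI[of _ "\<lambda>n. r *\<^sub>R s n"] conjI)
qed

text \<open>Closed bounded sets need not be compact in infinite dimension, but the parallelogram law makes
  every minimizing sequence Cauchy.\<close>

lemma nearest_point_complete: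
  fixes M :: "'a::{real_inner, complete_space} set"
  assumes M: "closed M" "subspace M"
  shows "\<exists>p\<in>M. \<forall>m\<in>M. norm (x - p) \<le> norm (x - m)"
proof -
  define d where "d = (INF m\<in>M. (norm (x - m))\<^sup>2)"
  have ne: "M \<noteq> {}" using subspace_0[OF M(2)] by auto
  have bd: "bdd_below ((\<lambda>m. (norm (x - m))\<^sup>2) ` M)" by (rule bdd_belowI[of _ 0]) auto
  have d_le: "d \<le> (norm (x - m))\<^sup>2" if "m \<in> M" for m
    unfolding d_def using bd that by (rule cINF_lower)
  have "\<exists>m\<in>M. (norm (x - m))\<^sup>2 < d + 1 / Suc n" for n
    using cInf_lessD[of "(\<lambda>m. (norm (x - m))\<^sup>2) ` M" "d + 1 / Suc n"] ne by (auto simp: d_def)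
  then obtain m where m: "\<And>n. m n \<in> M" "\<And>n. (norm (x - m n))\<^sup>2 < d + 1 / Suc n" by metis
  have est: "(norm (m n - m k))\<^sup>2 \<le> 2 / Suc n + 2 / Suc k" for n k
  proof -
    have mid: "(1 / 2) *\<^sub>R (m n + m k) \<in> M"
      using M(2) m(1) by (simp add: subspace_add subspace_scale)
    have eq: "(norm (m n - m k))\<^sup>2 = 2 * (norm (x - m n))\<^sup>2 + 2 * (norm (x - m k))\<^sup>2
      - 4 * (norm (x - (1 / 2) *\<^sub>R (m n + m k)))\<^sup>2"
      unfolding power2_norm_eq_inner by (simp add: inner_simps inner_commute field_simps)
    then show ?thesis using d_le[OF mid] m(2)[of n] m(2)[of k] by linarith
  qed
  have "Cauchy m"
  proof (rule CauchyI)
    fix e :: real assume e: "e > 0"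
    then obtain N where N: "4 / e\<^sup>2 < real N" using reals_Archimedean2 by blast
    have N0: "real N > 0" using N e by (smt (verit) divide_pos_pos zero_less_power)
    have "norm (m n - m k) < e" if "n \<ge> N" "k \<ge> N" for n k
    proof -
      have "2 / Suc n \<le> 2 / N" "2 / Suc k \<le> 2 / N" using that N0 by (auto intro!: divide_left_mono mult_pos_pos)
      then have "(norm (m n - m k))\<^sup>2 \<le> 4 / N" using est[of n k] by simp
      also have "\<dots> < e\<^sup>2" using N N0 e by (simp add: field_simps)
      finally show ?thesis using e by (simp add: power_less_imp_less_base)
    qed
    then show "\<exists>N. \<forall>n\<ge>N. \<forall>k\<ge>N. norm (m n - m k) < e" by blast
  qed
  then obtain p where p: "m \<longlonglongrightarrow> p" using Cauchy_convergent_iff convergent_def by blast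
  have pM: "p \<in> M" using closed_sequentially[OF M(1)] m(1) p by blast
  have "(\<lambda>n. (norm (x - m n))\<^sup>2) \<longlonglongrightarrow> (norm (x - p))\<^sup>2" by (intro tendsto_intros p)
  moreover have "(\<lambda>n. d + 1 / Suc n) \<longlonglongrightarrow> d"
    using tendsto_add[OF tendsto_const LIMSEQ_inverse_real_of_nat] by (simp add: inverse_eq_divide)
  ultimately have "(norm (x - p))\<^sup>2 \<le> d"
    by (rule LIMSEQ_le) (use m(2) less_imp_le in blast)
  then have "norm (x - p) \<le> norm (x - m)" if "m \<in> M" for m
    using d_le[OF that] by (meson norm_ge_zero order_trans power2_le_imp_le)
  then show ?thesis using pM by blast
qed

lemma orthogonal_projection:
  fixes M :: "'a::{real_inner, complete_space} set"
  assumes M: "closed M" "subspace M"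
  shows "\<exists>p\<in>M. \<forall>m\<in>M. inner (x - p) m = 0"
proof -
  obtain p where p: "p \<in> M" "\<And>m. m \<in> M \<Longrightarrow> norm (x - p) \<le> norm (x - m)"
    using nearest_point_complete[OF M] by blast
  have "inner (x - p) m = 0" if m: "m \<in> M" for m
  proof (cases "m = 0")
    case False
    define t where "t = inner (x - p) m / inner m m"
    have mm: "inner m m > 0" using False by simp
    have "p + t *\<^sub>R m \<in> M" using M(2) p(1) m by (simp add: subspace_add subspace_scale)
    then have "(norm (x - p))\<^sup>2 \<le> (norm (x - (p + t *\<^sub>R m)))\<^sup>2"
      using p(2) by (simp add: power_mono)
    also have "\<dots> = (norm (x - p))\<^sup>2 - 2 * t * inner (x - p) m + t\<^sup>2 * inner m m"
      unfolding power2_norm_eq_inner by (simp add: inner_simps inner_commute power2_eq_square algebra_simps)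
    also have "\<dots> = (norm (x - p))\<^sup>2 - (inner (x - p) m)\<^sup>2 / inner m m"
      using mm by (simp add: t_def field_simps power2_eq_square)
    finally have "(inner (x - p) m)\<^sup>2 / inner m m \<le> 0" by simp
    then have "(inner (x - p) m)\<^sup>2 \<le> 0" using mm by (simp add: divide_le_0_iff)
    then show ?thesis by simp
  qed simp
  then show ?thesis using p(1) by blast
qed

lemma riesz_real:
  fixes f :: "'a::{real_inner, complete_space} \<Rightarrow> real"
  assumes f: "bounded_linear f"
  shows "\<exists>w. \<forall>v. f v = inner v w"
proof (cases "\<forall>v. f v = 0")
  case False
  then obtain x where x: "f x \<noteq> 0" by blast
  interpret f: bounded_linear f by (rule f)
  have cl: "closed {v. f v = 0}"
    by (intro closed_Collect_eq continuous_intros f.continuous_on)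
  have sb: "subspace {v. f v = 0}" by (auto simp: subspace_def f.add f.scaleR f.zero)
  obtain p where p: "f p = 0" "\<And>m. f m = 0 \<Longrightarrow> inner (x - p) m = 0"
    using orthogonal_projection[OF cl sb, of x] by auto
  define u where "u = x - p"
  have fu: "f u = f x" by (simp add: u_def f.diff p)
  then have u0: "inner u u > 0" using x f.zero by auto
  have "f v = inner v ((f u / inner u u) *\<^sub>R u)" for v
  proof -
    have "f (v - (f v / f u) *\<^sub>R u) = 0" using x fu by (simp add: f.diff f.scaleR)
    then have "inner u (v - (f v / f u) *\<^sub>R u) = 0" using p(2) by (simp add: u_def)
    then have "inner u v = f v / f u * inner u u" by (simp add: inner_simps)
    then show ?thesis using u0 x fu by (simp add: inner_commute)
  qed
  then show ?thesis by blast
qed (auto intro: exI[of _ 0])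

text \<open>The vector representing the real part of \<open>f\<close> represents \<open>f\<close>, since
  \<open>Im z = - Re (\<i> z)\<close>.\<close>

theorem riesz_representation:
  fixes f :: "'a::{complex_inner, complete_space} \<Rightarrow> complex"
  assumes f: "bounded_linear f" and fC: "\<And>c v. f (c *\<^sub>C v) = c * f v"
  shows "\<exists>w. \<forall>v. f v = cinner v w"
proof -
  have "bounded_linear (\<lambda>v. Re (f v))" by (rule bounded_linear_compose[OF bounded_linear_Re f])
  then obtain w where w: "\<And>v. Re (f v) = inner v w" using riesz_real by blast
  have "f v = cinner v w" for v
    using w[of v] w[of "\<i> *\<^sub>C v"]
    by (simp add: fC inner_eq_Re_cinner cinner_scaleC_left complex_eq_iff)
  then show ?thesis by blast
qed

definition total_vectors :: "'a::complex_inner set \<Rightarrow> bool" where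
  "total_vectors B \<longleftrightarrow> (\<forall>x. (\<forall>b\<in>B. cinner x b = 0) \<longrightarrow> x = 0)"

text \<open>The real span of the complex multiples is the complex span, so that the library's real
  linear algebra applies.\<close>

definition complex_multiples :: "'a::complex_inner set \<Rightarrow> 'a set" where
  "complex_multiples B = {c *\<^sub>C b | c b. b \<in> B}"

text \<open>A vector minus its projection to the closed span is orthogonal to \<open>B\<close>.\<close>

lemma total_closure_span:
  fixes B :: "'a::{complex_inner, complete_space} set"
  assumes "total_vectors B"
  shows "closure (span (complex_multiples B)) = UNIV"
proof (rule UNIV_eq_I[symmetric])
  fix x :: 'a
  let ?M = "closure (span (complex_multiples B))"
  obtain p where p: "p \<in> ?M" "\<And>m. m \<in> ?M \<Longrightarrow> inner (x - p) m = 0"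
    using orthogonal_projection[OF closed_closure subspace_closure[OF subspace_span], of "complex_multiples B" x]
    by blast
  have "complex_multiples B \<subseteq> ?M"
    using closure_subset span_superset by (rule order_trans[rotated])
  then have "c *\<^sub>C b \<in> ?M" if "b \<in> B" for c b
    using that by (auto simp: complex_multiples_def)
  then have "cinner (x - p) b = 0" if "b \<in> B" for b
    using p(2) that by (intro inner_scaleC_eq_0_imp) auto
  then have "x - p = 0" using assms unfolding total_vectors_def by blast
  then show "x \<in> ?M" using p(1) by simp
qed

lemma bounded_linear_eq_on_total:
  fixes B :: "'a::{complex_inner, complete_space} set" and f g :: "'a \<Rightarrow> 'b::complex_inner"
  assumes B: "total_vectors B" and f: "bounded_linear f" and g: "bounded_linear g"
    and fC: "\<And>c v. f (c *\<^sub>C v) = c *\<^sub>C f v" and gC: "\<And>c v. g (c *\<^sub>C v) = c *\<^sub>C g v"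
    and eq: "\<And>b. b \<in> B \<Longrightarrow> f b = g b"
  shows "f = g"
proof
  fix x
  have "f y = g y" if "y \<in> span (complex_multiples B)" for y
  proof (rule linear_eq_on_span[OF bounded_linear.linear[OF f] bounded_linear.linear[OF g] _ that])
    show "f z = g z" if "z \<in> complex_multiples B" for z
      using that by (auto simp: complex_multiples_def fC gC eq)
  qed
  moreover have "closed {y. f y = g y}"
    by (intro closed_Collect_eq linear_continuous_on f g)
  ultimately have "closure (span (complex_multiples B)) \<subseteq> {y. f y = g y}"
    by (intro closure_minimal) auto
  then show "f x = g x" using total_closure_span[OF B] by auto
qed

text \<open>Vectors with equal Gram matrices are related by an isometry. It is obtained as the closure
  of the linear relation spanned by the pairs \<open>(c u\<^sub>i, c v\<^sub>i)\<close>: on that relation both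
  components have the same norm, so the closure is single valued, and completeness makes its domain
  closed, hence everything.\<close>

lemma isometric_extension:
  fixes u v :: "'i \<Rightarrow> 'a::{complex_inner, complete_space}"
  assumes total: "total_vectors (range u)"
    and uv: "\<And>i j. cinner (u i) (u j) = cinner (v i) (v j)"
  shows "\<exists>W. bounded_linear W \<and> (\<forall>c x. W (c *\<^sub>C x) = c *\<^sub>C W x)
    \<and> (\<forall>x. norm (W x) = norm x) \<and> (\<forall>i. W (u i) = v i)"
proof -
  define B where "B = {(c *\<^sub>C u i, c *\<^sub>C v i) | c i. True}"
  define G where "G = span B"
  define H where "H = closure G"
  have subG: "subspace G" and subH: "subspace H"
    unfolding G_def H_def by (auto intro: subspace_closure)
  have BG: "B \<subseteq> G" unfolding G_def by (rule span_superset)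
  have GH: "G \<subseteq> H" unfolding H_def by (rule closure_subset)
  have inner_G: "inner (fst p) (fst q) = inner (snd p) (snd q)" if p: "p \<in> G" and q: "q \<in> G" for p q
  proof -
    have 1: "inner (fst p) (fst b) = inner (snd p) (snd b)" if b: "b \<in> B" for b
      using p unfolding G_def
    proof (rule span_induct)
      show "subspace {p. inner (fst p) (fst b) = inner (snd p) (snd b)}"
        by (auto simp: subspace_def inner_simps)
      show "inner (fst x) (fst b) = inner (snd x) (snd b)" if x: "x \<in> B" for x
        proof -
        obtain c d i j where "x = (c *\<^sub>C u i, c *\<^sub>C v i)" "b = (d *\<^sub>C u j, d *\<^sub>C v j)"
          using x b unfolding B_def by blast
        then show ?thesis
          by (simp add: inner_eq_Re_cinner cinner_scaleC_left cinner_scaleC_right uv)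
      qed
    qed
    show ?thesis
      using q unfolding G_def
    proof (rule span_induct)
      show "subspace {q. inner (fst p) (fst q) = inner (snd p) (snd q)}"
        by (auto simp: subspace_def inner_simps)
    qed (rule 1)
  qed
  have norm_H: "norm (fst p) = norm (snd p)" if "p \<in> H" for p
  proof -
    have "closed {p :: 'a \<times> 'a. norm (fst p) = norm (snd p)}"
      by (intro closed_Collect_eq continuous_intros)
    moreover have "G \<subseteq> {p. norm (fst p) = norm (snd p)}"
      using inner_G by (auto simp: norm_eq_sqrt_inner)
    ultimately have "H \<subseteq> {p. norm (fst p) = norm (snd p)}"
      unfolding H_def by (rule closure_minimal[rotated])
    then show ?thesis using that by auto
  qed
  have unique: "y = y'" if "(x, y) \<in> H" "(x, y') \<in> H" for x y y'
    using norm_H[OF subspace_diff[OF subH that]] by simp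
  have exists: "\<exists>y. (x, y) \<in> H" for x
  proof -
    have "fst ` G = span (fst ` B)"
      unfolding G_def by (rule linear_span_image[symmetric]) (auto intro: linearI)
    also have "fst ` B = complex_multiples (range u)"
      unfolding B_def complex_multiples_def image_Collect by auto
    finally have "x \<in> closure (fst ` G)" using total_closure_span[OF total] by simp
    then obtain s where s: "\<And>n. s n \<in> fst ` G" "s \<longlonglongrightarrow> x"
      unfolding closure_sequential by blast
    then have "\<forall>n. \<exists>y. (s n, y) \<in> G" by force
    then obtain t where t: "\<And>n. (s n, t n) \<in> G" by metis
    have "norm (t n - t m) = norm (s n - s m)" for n m
      using norm_H[of "(s n - s m, t n - t m)"] subspace_diff[OF subG t[of n] t[of m]] GH by auto
    moreover have "Cauchy s" using s(2) LIMSEQ_imp_Cauchy by blast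
    ultimately have "Cauchy t" unfolding Cauchy_def dist_norm by simp
    then obtain y where "t \<longlonglongrightarrow> y" using Cauchy_convergent_iff convergent_def by blast
    then have "(\<lambda>n. (s n, t n)) \<longlonglongrightarrow> (x, y)" by (intro tendsto_Pair s(2))
    then have "(x, y) \<in> H" unfolding H_def closure_sequential
      using t by (intro exI[of _ "\<lambda>n. (s n, t n)"] conjI allI)
    then show ?thesis ..
  qed
  have scale_H: "(c *\<^sub>C x, c *\<^sub>C y) \<in> H" if "(x, y) \<in> H" for c x y
  proof -
    let ?h = "\<lambda>p :: 'a \<times> 'a. (c *\<^sub>C fst p, c *\<^sub>C snd p)"
    have h: "bounded_linear ?h"
      by (intro bounded_linear_Pair bounded_linear_compose[OF bounded_linear_scaleC] 
          bounded_linear_fst bounded_linear_snd)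
    have "?h b \<in> B" if b: "b \<in> B" for b
    proof -
      obtain d i where "b = (d *\<^sub>C u i, d *\<^sub>C v i)" using b unfolding B_def by blast
      then have "?h b = ((c * d) *\<^sub>C u i, (c * d) *\<^sub>C v i)" by (simp add: scaleC_scaleC)
      then show ?thesis unfolding B_def by blast
    qed
    then have "?h ` B \<subseteq> B" by blast
    then have "?h ` G \<subseteq> G"
      unfolding G_def linear_span_image[OF bounded_linear.linear[OF h], symmetric] by (rule span_mono)
    moreover have "?h ` H \<subseteq> closure (?h ` G)" unfolding H_def
      by (rule closure_bounded_linear_image_subset[OF h])
    ultimately have "?h ` H \<subseteq> H" unfolding H_def using closure_mono by blast
    then show ?thesis using that by force
  qed
  define W where "W x = (THE y. (x, y) \<in> H)" for x
  have W: "(x, W x) \<in> H" for x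
    unfolding W_def using exists unique by (metis theI)
  have W_eq: "W x = y" if "(x, y) \<in> H" for x y using unique[OF W that] .
  have norm_W: "norm (W x) = norm x" for x using norm_H[OF W] by simp
  have "bounded_linear W"
  proof (rule bounded_linear_intro[of _ 1])
    show "W (x + y) = W x + W y" for x y
      using subspace_add[OF subH W[of x] W[of y]] by (intro W_eq) simp
    show "W (r *\<^sub>R x) = r *\<^sub>R W x" for r x
      using subspace_scale[OF subH W[of x], of r] by (intro W_eq) simp
  qed (simp add: norm_W)
  moreover have "W (c *\<^sub>C x) = c *\<^sub>C W x" for c x
    by (rule W_eq) (rule scale_H[OF W])
  moreover have "W (u i) = v i" for i
  proof (rule W_eq)
    have "(1 *\<^sub>C u i, 1 *\<^sub>C v i) \<in> B" unfolding B_def by blast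
    then show "(u i, v i) \<in> H" using BG GH by auto
  qed
  ultimately show ?thesis using norm_W by blast
qed

section \<open>Completeness of Fock space\<close>

text \<open>The squared norm as an extended number, available before membership in Fock space is known,
  so that Fatou's lemma applies in the sum and the integrals at once.\<close>

definition fock_energy :: "(nat \<Rightarrow> (nat \<Rightarrow> real) \<Rightarrow> complex) \<Rightarrow> ennreal" where
  "fock_energy F = (\<Sum>n. \<integral>\<^sup>+ x. ennreal ((cmod (F n x))\<^sup>2) \<partial>half_line_pow n)"

lemma abs_rep_fock: "abs_fock (rep_fock u) = u"
  by (rule Quotient_abs_rep[OF Quotient_fock])

lemma fock_fun_rep: "fock_fun (rep_fock u)"
  using Quotient_rep_reflp[OF Quotient_fock, of u] by (simp add: fock_rel_def)

lemma fock_rel_refl: "fock_fun F \<Longrightarrow> fock_rel F F"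
  by (simp add: fock_rel_def)

lemma abs_fock_diff:
  assumes "fock_fun F" "fock_fun G"
  shows "fock_fun (\<lambda>n x. F n x - G n x)"
    and "abs_fock F - abs_fock G = abs_fock (\<lambda>n x. F n x - G n x)"
proof -
  have 1: "fock_fun (\<lambda>n x. - 1 * G n x)" using assms(2) by (rule fock_fun_scale)
  show "fock_fun (\<lambda>n x. F n x - G n x)" using fock_fun_add[OF assms(1) 1] by simp
  show "abs_fock F - abs_fock G = abs_fock (\<lambda>n x. F n x - G n x)"
    unfolding minus_fock_def uminus_fock_def
    using assms 1 by (simp add: scaleC_fock.abs_eq plus_fock.abs_eq fock_rel_refl)
qed

lemma fock_energy_norm:
  assumes F: "fock_fun F"
  shows "fock_energy F = ennreal ((norm (abs_fock F))\<^sup>2)"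
proof -
  have s: "sqint (half_line_pow n) (F n)" for n using F by (simp add: fock_fun_def)
  have "(norm (abs_fock F))\<^sup>2 = Re (fock_ip F F)"
    by (simp add: power2_norm_eq_inner inner_eq_Re_cinner cinner_fock.abs_eq fock_rel_refl F)
  also have "\<dots> = (\<Sum>n. \<integral>x. (cmod (F n x))\<^sup>2 \<partial>half_line_pow n)"
    by (simp add: fock_ip_self F)
  also have "ennreal \<dots> = (\<Sum>n. ennreal (\<integral>x. (cmod (F n x))\<^sup>2 \<partial>half_line_pow n))"
    using F by (intro suminf_ennreal2[symmetric]) (auto simp: fock_fun_def)
  also have "\<dots> = fock_energy F"
    unfolding fock_energy_def using s
    by (intro arg_cong[where f = suminf] ext nn_integral_eq_integral[symmetric])
       (auto simp: sqint_def)
  finally show ?thesis ..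
qed

lemma fock_funI:
  assumes m: "\<And>n. F n \<in> borel_measurable (half_line_pow n)"
    and sym: "\<And>n p. p permutes {..<n} \<Longrightarrow> AE x in half_line_pow n. F n (x \<circ> p) = F n x"
    and fin: "fock_energy F < \<infinity>"
  shows "fock_fun F"
proof -
  have m': "(\<lambda>x. ennreal ((cmod (F n x))\<^sup>2)) \<in> borel_measurable (half_line_pow n)" for n
    using m[of n] by measurable
  have "(\<integral>\<^sup>+ x. ennreal ((cmod (F n x))\<^sup>2) \<partial>half_line_pow n) < \<infinity>" for n
    using ennreal_suminf_lessD[OF fin[unfolded fock_energy_def]] .
  then have i: "integrable (half_line_pow n) (\<lambda>x. (cmod (F n x))\<^sup>2)" for n
    using m[of n] by (intro integrableI_bounded) auto
  have "(\<Sum>n. ennreal (\<integral>x. (cmod (F n x))\<^sup>2 \<partial>half_line_pow n)) = fock_energy F"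
    unfolding fock_energy_def using i
    by (intro arg_cong[where f = suminf] ext nn_integral_eq_integral[symmetric]) auto
  then have "summable (\<lambda>n. \<integral>x. (cmod (F n x))\<^sup>2 \<partial>half_line_pow n)"
    using fin by (intro summable_suminf_not_top) auto
  then show ?thesis using m sym i by (simp add: fock_fun_def sqint_def)
qed

lemma fock_energy_Fatou:
  assumes m: "\<And>k n. F k n \<in> borel_measurable (half_line_pow n)"
    and G: "\<And>n. AE x in half_line_pow n. (\<lambda>k. F k n x) \<longlonglongrightarrow> G n x"
    and le: "\<And>k. k \<ge> K \<Longrightarrow> fock_energy (F k) \<le> C"
  shows "fock_energy G \<le> C"
proof -
  have "(\<integral>\<^sup>+ x. ennreal ((cmod (G n x))\<^sup>2) \<partial>half_line_pow n)
      \<le> liminf (\<lambda>k. \<integral>\<^sup>+ x. ennreal ((cmod (F k n x))\<^sup>2) \<partial>half_line_pow n)" for n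
  proof -
    have "AE x in half_line_pow n.
        ennreal ((cmod (G n x))\<^sup>2) = liminf (\<lambda>k. ennreal ((cmod (F k n x))\<^sup>2))"
      using G[of n]
    proof eventually_elim
      case (elim x)
      have "(\<lambda>k. ennreal ((cmod (F k n x))\<^sup>2)) \<longlonglongrightarrow> ennreal ((cmod (G n x))\<^sup>2)"
        by (intro tendsto_ennrealI tendsto_intros elim)
      then show ?case by (rule lim_imp_Liminf[OF trivial_limit_sequentially, symmetric])
    qed
    then have "(\<integral>\<^sup>+ x. ennreal ((cmod (G n x))\<^sup>2) \<partial>half_line_pow n)
        = (\<integral>\<^sup>+ x. liminf (\<lambda>k. ennreal ((cmod (F k n x))\<^sup>2)) \<partial>half_line_pow n)"
      by (rule nn_integral_cong_AE)
    also have "\<dots> \<le> liminf (\<lambda>k. \<integral>\<^sup>+ x. ennreal ((cmod (F k n x))\<^sup>2) \<partial>half_line_pow n)"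
    proof (rule nn_integral_liminf)
      show "(\<lambda>x. ennreal ((cmod (F k n x))\<^sup>2)) \<in> borel_measurable (half_line_pow n)" for k
        using m[of k n] by measurable
    qed
    finally show ?thesis .
  qed
  then have "fock_energy G 
      \<le> (\<Sum>n. liminf (\<lambda>k. \<integral>\<^sup>+ x. ennreal ((cmod (F k n x))\<^sup>2) \<partial>half_line_pow n))"
    unfolding fock_energy_def by (intro suminf_le) auto
  also have "\<dots> \<le> liminf (\<lambda>k. fock_energy (F k))"
    unfolding fock_energy_def nn_integral_count_space_nat[symmetric]
    by (rule nn_integral_liminf) auto
  also have "\<dots> \<le> liminf (\<lambda>k. C)"
    by (rule Liminf_mono) (use le in \<open>auto simp: eventually_sequentially\<close>)
  also have "\<dots> = C" by (simp add: Liminf_const)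
  finally show ?thesis .
qed

text \<open>With increments \<open>d\<^sub>k\<close> of squared norm at most \<open>8\<^sup>-\<^sup>k\<close>, the function \<open>\<Sum>\<^sub>k 4\<^sup>k |d\<^sub>k|\<^sup>2\<close> is
  integrable, hence finite almost everywhere, and there \<open>|d\<^sub>k|\<close> is bounded by a multiple of
  \<open>2\<^sup>-\<^sup>k\<close>.\<close>

lemma AE_convergent_if_rapid:
  fixes f :: "nat \<Rightarrow> 'a \<Rightarrow> complex"
  assumes m: "\<And>k. f k \<in> borel_measurable M"
    and le: "\<And>k. (\<integral>\<^sup>+ x. ennreal ((cmod (f (Suc k) x - f k x))\<^sup>2) \<partial>M) \<le> ennreal ((1 / 8) ^ k)"
  shows "AE x in M. convergent (\<lambda>k. f k x)"
proof -
  define g where "g k x = ennreal (4 ^ k * (cmod (f (Suc k) x - f k x))\<^sup>2)" for k x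
  have gm[measurable]: "g k \<in> borel_measurable M" for k
    unfolding g_def using m[of k] m[of "Suc k"] by measurable
  have gk: "(\<integral>\<^sup>+ x. g k x \<partial>M) \<le> ennreal ((1 / 2) ^ k)" for k
  proof -
    have "(\<integral>\<^sup>+ x. g k x \<partial>M) = ennreal (4 ^ k) * (\<integral>\<^sup>+ x. ennreal ((cmod (f (Suc k) x - f k x))\<^sup>2) \<partial>M)"
      unfolding g_def using m[of k] m[of "Suc k"]
      by (subst nn_integral_cmult[symmetric]) (auto simp: ennreal_mult)
    also have "\<dots> \<le> ennreal (4 ^ k) * ennreal ((1 / 8) ^ k)" by (intro mult_left_mono le) simp
    also have "\<dots> = ennreal ((1 / 2) ^ k)"
      by (simp add: ennreal_mult[symmetric] power_mult_distrib[symmetric])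
    finally show ?thesis .
  qed
  have "(\<integral>\<^sup>+ x. (\<Sum>k. g k x) \<partial>M) = (\<Sum>k. \<integral>\<^sup>+ x. g k x \<partial>M)" by (rule nn_integral_suminf) simp
  also have "\<dots> \<le> (\<Sum>k. ennreal ((1 / 2) ^ k))" by (intro suminf_le gk) auto
  also have "\<dots> = ennreal (\<Sum>k. (1 / 2) ^ k)" by (rule suminf_ennreal2) auto
  also have "\<dots> < \<infinity>" by simp
  finally have "AE x in M. (\<Sum>k. g k x) \<noteq> \<infinity>"
    by (intro nn_integral_noteq_infinite) auto
  then show ?thesis
  proof eventually_elim
    case (elim x)
    define d where "d k = f (Suc k) x - f k x" for k
    have "summable (\<lambda>k. 4 ^ k * (cmod (d k))\<^sup>2)"
      using elim unfolding g_def d_def by (intro summable_suminf_not_top) auto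
    then have "Bseq (\<lambda>k. 4 ^ k * (cmod (d k))\<^sup>2)"
      by (intro convergent_imp_Bseq) (auto simp: convergent_def dest!: summable_LIMSEQ_zero)
    then obtain C where C: "C > 0" "\<And>k. 4 ^ k * (cmod (d k))\<^sup>2 \<le> C"
      unfolding Bseq_def by (auto simp: abs_of_nonneg)
    have "summable d"
    proof (rule summable_comparison_test'[where N = 0])
      show "summable (\<lambda>k. sqrt C * (1 / 2) ^ k)" by (intro summable_mult summable_geometric) auto
      show "norm (d k) \<le> sqrt C * (1 / 2) ^ k" for k
      proof -
        have "(2 ^ k * cmod (d k))\<^sup>2 \<le> C"
          using C(2)[of k] by (simp add: power_mult_distrib power_mult[symmetric] mult.commute[of _ 2])
             (simp add: power_mult)
        then have "2 ^ k * cmod (d k) \<le> sqrt C" by (rule real_le_rsqrt)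
        then show ?thesis by (simp add: field_simps power_divide)
      qed
    qed
    then have "(\<lambda>n. f 0 x + (\<Sum>k<n. d k)) \<longlonglongrightarrow> f 0 x + suminf d"
      by (intro tendsto_intros summable_LIMSEQ)
    moreover have "f 0 x + (\<Sum>k<n. d k) = f n x" for n
      unfolding d_def by (subst sum_lessThan_telescope) simp
    ultimately show ?case by (auto simp: convergent_def)
  qed
qed

text \<open>The pointwise almost everywhere limit of representatives is the limit in norm, by Fatou's
  lemma for the differences.\<close>

lemma fock_rapid_Cauchy_converges:
  fixes Y :: "nat \<Rightarrow> fock"
  assumes Y: "\<And>k m n. m \<ge> k \<Longrightarrow> n \<ge> k \<Longrightarrow> (norm (Y m - Y n))\<^sup>2 \<le> (1 / 8) ^ k"
  shows "\<exists>L. \<forall>k. (norm (Y k - L))\<^sup>2 \<le> (1 / 8) ^ k"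
proof -
  define F where "F k = rep_fock (Y k)" for k
  have F: "fock_fun (F k)" "abs_fock (F k) = Y k" for k
    by (simp_all add: F_def fock_fun_rep abs_rep_fock)
  have Fm: "F k n \<in> borel_measurable (half_line_pow n)" for k n
    using F(1)[of k] by (auto simp: fock_fun_def sqint_def)
  have E: "fock_energy (\<lambda>n x. F m n x - F l n x) \<le> ennreal ((1 / 8) ^ k)" if "m \<ge> k" "l \<ge> k" for k m l
    using Y[OF that] abs_fock_diff[OF F(1)[of m] F(1)[of l]] by (simp add: fock_energy_norm F(2))
  define G where "G n x = lim (\<lambda>k. F k n x)" for n x
  have Gm: "G n \<in> borel_measurable (half_line_pow n)" for n
    unfolding G_def by (rule borel_measurable_lim_metric) (rule Fm)
  have conv: "AE x in half_line_pow n. (\<lambda>k. F k n x) \<longlonglongrightarrow> G n x" for n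
  proof -
    have "AE x in half_line_pow n. convergent (\<lambda>k. F k n x)"
    proof (rule AE_convergent_if_rapid[OF Fm])
      fix k
      have "(\<integral>\<^sup>+ x. ennreal ((cmod (F (Suc k) n x - F k n x))\<^sup>2) \<partial>half_line_pow n)
          \<le> fock_energy (\<lambda>n x. F (Suc k) n x - F k n x)"
        unfolding fock_energy_def
        using sum_le_suminf[of "\<lambda>n. \<integral>\<^sup>+ x. ennreal ((cmod (F (Suc k) n x - F k n x))\<^sup>2) \<partial>half_line_pow n" "{n}"]
        by simp
      also have "\<dots> \<le> ennreal ((1 / 8) ^ k)" by (rule E) auto
      finally show "(\<integral>\<^sup>+ x. ennreal ((cmod (F (Suc k) n x - F k n x))\<^sup>2) \<partial>half_line_pow n)
          \<le> ennreal ((1 / 8) ^ k)" .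
    qed
    then show ?thesis
      unfolding G_def by eventually_elim (simp add: convergent_LIMSEQ_iff)
  qed
  have Gsym: "AE x in half_line_pow n. G n (x \<circ> p) = G n x" if "p permutes {..<n}" for n p
  proof -
    have "AE x in half_line_pow n. \<forall>k. F k n (x \<circ> p) = F k n x"
      unfolding AE_all_countable using F(1) that by (simp add: fock_fun_def)
    then show ?thesis unfolding G_def by eventually_elim simp
  qed
  have energy: "fock_energy (\<lambda>n x. F k n x - G n x) \<le> ennreal ((1 / 8) ^ k)" for k
  proof (rule fock_energy_Fatou[where K = k and F = "\<lambda>m n x. F k n x - F m n x"])
    show "(\<lambda>x. F k n x - F m n x) \<in> borel_measurable (half_line_pow n)" for m n
      using Fm[of k n] Fm[of m n] by measurable
    show "AE x in half_line_pow n. (\<lambda>m. F k n x - F m n x) \<longlonglongrightarrow> F k n x - G n x" for n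
      using conv[of n] by eventually_elim (intro tendsto_intros)
  qed (rule E, auto)
  have diff: "fock_fun (\<lambda>n x. F k n x - G n x)" for k
  proof (rule fock_funI)
    show "(\<lambda>x. F k n x - G n x) \<in> borel_measurable (half_line_pow n)" for n
      using Fm[of k n] Gm[of n] by measurable
    show "AE x in half_line_pow n. F k n (x \<circ> p) - G n (x \<circ> p) = F k n x - G n x"
      if "p permutes {..<n}" for n p
    proof -
      have "AE x in half_line_pow n. F k n (x \<circ> p) = F k n x"
        using F(1) that by (simp add: fock_fun_def)
      then show ?thesis using Gsym[OF that] by eventually_elim simp
    qed
    show "fock_energy (\<lambda>n x. F k n x - G n x) < \<infinity>"
      using energy[of k] by (rule le_less_trans) simp
  qed
  have "fock_fun (\<lambda>n x. F 0 n x - (F 0 n x - G n x))"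
    by (rule abs_fock_diff(1)[OF F(1) diff])
  then have G: "fock_fun G" by simp
  have "(norm (Y k - abs_fock G))\<^sup>2 \<le> (1 / 8) ^ k" for k
    using energy[of k] abs_fock_diff[OF F(1)[of k] G] by (simp add: fock_energy_norm F(2))
  then show ?thesis by blast
qed

instance fock :: complete_space
proof
  fix X :: "nat \<Rightarrow> fock" assume X: "Cauchy X"
  have "\<exists>N. \<forall>m\<ge>N. \<forall>n\<ge>N. norm (X m - X n) < (1 / 8) ^ k" for k
    using CauchyD[OF X, of "(1 / 8) ^ k"] by simp
  then obtain N where N: "\<And>k m n. m \<ge> N k \<Longrightarrow> n \<ge> N k \<Longrightarrow> norm (X m - X n) < (1 / 8) ^ k"
    by metis
  \<comment> \<open>Summing makes \<open>r\<close> monotone while \<open>r k \<ge> N k\<close>.\<close>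
  define r where "r k = (\<Sum>i\<le>k. N i)" for k
  have r: "N k \<le> r l" if "k \<le> l" for k l
    unfolding r_def using that by (intro member_le_sum) auto
  have sq: "x\<^sup>2 \<le> (1 / 8) ^ k" if "0 \<le> x" "x < (1 / 8) ^ k" for x :: real and k
  proof -
    have "x * x \<le> (1 / 8) ^ k * 1"
      using that by (intro mult_mono) (auto simp: power_le_one intro: order_trans[OF less_imp_le])
    then show ?thesis by (simp add: power2_eq_square)
  qed
  obtain L where L: "\<And>k. (norm (X (r k) - L))\<^sup>2 \<le> (1 / 8) ^ k"
    using fock_rapid_Cauchy_converges[of "\<lambda>k. X (r k)"] sq N r by (metis norm_ge_zero)
  have "X \<longlonglongrightarrow> L"
  proof (rule LIMSEQ_I)
    fix e :: real assume e: "e > 0"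
    have "0 < min (e / 2) ((e / 2)\<^sup>2)" using e by simp
    then obtain k where k: "(1 / 8) ^ k < min (e / 2) ((e / 2)\<^sup>2)"
      using real_arch_pow_inv[of "min (e / 2) ((e / 2)\<^sup>2)" "1 / 8"] by auto
    have "(norm (X (r k) - L))\<^sup>2 < (e / 2)\<^sup>2" using L[of k] k by linarith
    then have "norm (X (r k) - L) < e / 2" 
      by (rule power_less_imp_less_base) (use e in simp)
    then have "norm (X n - L) < e" if "n \<ge> N k" for n
      using N[of k n "r k"] that r[of k k] k norm_triangle_ineq[of "X n - X (r k)" "X (r k) - L"]
      by auto
    then show "\<exists>no. \<forall>n\<ge>no. norm (X n - L) < e" by blast
  qed
  then show "convergent X" by (auto simp: convergent_def)
qed

section \<open>Symmetric functions and tensor powers\<close>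

lemma sqint_tensor:
  assumes f: "\<And>i. i < n \<Longrightarrow> sqint half_line (f i)"
  shows "sqint (half_line_pow n) (\<lambda>x. \<Prod>i<n. f i (x i))"
proof -
  have "(\<lambda>x. f i (x i)) \<in> borel_measurable (half_line_pow n)" if "i < n" for i
    unfolding half_line_pow_def
    by (rule measurable_compose[OF measurable_component_singleton[where i = i]])
       (use that f in \<open>auto simp: sqint_def\<close>)
  then have "(\<lambda>x. \<Prod>i<n. f i (x i)) \<in> borel_measurable (half_line_pow n)"
    by (intro borel_measurable_prod) auto
  moreover have "integrable (half_line_pow n) (\<lambda>x. \<Prod>i<n. (cmod (f i (x i)))\<^sup>2)"
    unfolding half_line_pow_def using f
    by (intro half_line.product_integrable_prod) (auto simp: sqint_def)
  ultimately show ?thesis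
    by (simp add: sqint_def prod_norm[symmetric] prod_power_distrib)
qed

lemma measurable_permute_coordinates:
  assumes p: "p permutes {..<n}"
  shows "(\<lambda>x. x \<circ> p) \<in> measurable (half_line_pow n) (half_line_pow n)"
proof -
  have "(\<lambda>x i. x (p i)) \<in> measurable (Pi\<^sub>M {..<n} (\<lambda>_. half_line)) (Pi\<^sub>M {..<n} (\<lambda>_. half_line))"
  proof (rule measurable_PiM_single')
    show "(\<lambda>x. x (p i)) \<in> measurable (Pi\<^sub>M {..<n} (\<lambda>_. half_line)) half_line" if "i \<in> {..<n}" for i
      using permutes_in_image[OF p] that by (intro measurable_component_singleton) auto
    show "(\<lambda>x i. x (p i)) \<in> space (Pi\<^sub>M {..<n} (\<lambda>_. half_line)) \<rightarrow> {..<n} \<rightarrow>\<^sub>E space half_line"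
    proof (intro funcsetI PiE_I)
      fix x i assume x: "x \<in> space (Pi\<^sub>M {..<n} (\<lambda>_. half_line))"
      then have x': "x \<in> {..<n} \<rightarrow>\<^sub>E space half_line" by (simp add: space_PiM)
      show "x (p i) \<in> space half_line" if "i \<in> {..<n}"
        using permutes_in_image[OF p] that by (intro PiE_mem[OF x']) auto
      show "x (p i) = undefined" if "i \<notin> {..<n}"
        using permutes_in_image[OF p] that by (intro PiE_arb[OF x']) auto
    qed
  qed
  then show ?thesis by (simp add: half_line_pow_def o_def)
qed

lemma distr_permute_coordinates:
  assumes p: "p permutes {..<n}"
  shows "distr (half_line_pow n) (half_line_pow n) (\<lambda>x. x \<circ> p) = half_line_pow n" (is "?D = _")
  unfolding half_line_pow_def[of n]
proof (rule half_line.PiM_eqI)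
  have p': "inv p permutes {..<n}" using p by (rule permutes_inv)
  show "finite {..<n}" by simp
  show "sets (distr (Pi\<^sub>M {..<n} (\<lambda>_. half_line)) (Pi\<^sub>M {..<n} (\<lambda>_. half_line)) (\<lambda>x. x \<circ> p)) 
      = sets (Pi\<^sub>M {..<n} (\<lambda>_. half_line))" by simp
  fix A :: "nat \<Rightarrow> real set" assume A: "\<And>i. i \<in> {..<n} \<Longrightarrow> A i \<in> sets half_line"
  have Ain: "A (inv p i) \<in> sets half_line" if "i \<in> {..<n}" for i
    using A permutes_in_image[OF p'] that by blast
  have "(\<lambda>x. x \<circ> p) -` Pi\<^sub>E {..<n} A \<inter> space (Pi\<^sub>M {..<n} (\<lambda>_. half_line))
      = Pi\<^sub>E {..<n} (\<lambda>i. A (inv p i))" (is "?L = ?R")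
  proof (intro set_eqI iffI)
    fix x assume x: "x \<in> ?L"
    then have x1: "x \<circ> p \<in> Pi\<^sub>E {..<n} A" and x2: "x \<in> {..<n} \<rightarrow>\<^sub>E space half_line"
      by (auto simp: space_PiM)
    show "x \<in> ?R"
    proof (rule PiE_I)
      show "x i \<in> A (inv p i)" if "i \<in> {..<n}" for i
        using PiE_mem[OF x1, of "inv p i"] permutes_in_image[OF p'] that permutes_inverses[OF p] by simp
      show "x i = undefined" if "i \<notin> {..<n}" for i using PiE_arb[OF x2 that] .
    qed
  next
    fix x assume x: "x \<in> ?R"
    have "x \<circ> p \<in> Pi\<^sub>E {..<n} A"
    proof (rule PiE_I)
      show "(x \<circ> p) i \<in> A i" if "i \<in> {..<n}" for i
        using PiE_mem[OF x, of "p i"] permutes_in_image[OF p] that permutes_inverses[OF p] by simp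
      show "(x \<circ> p) i = undefined" if "i \<notin> {..<n}" for i
        using PiE_arb[OF x, of "p i"] permutes_in_image[OF p] that by simp
    qed
    moreover have "x \<in> {..<n} \<rightarrow>\<^sub>E space half_line"
    proof (rule PiE_I)
      show "x i \<in> space half_line" if "i \<in> {..<n}" for i
        using PiE_mem[OF x that] sets.sets_into_space[OF Ain[OF that]] by blast
      show "x i = undefined" if "i \<notin> {..<n}" for i using PiE_arb[OF x that] .
    qed
    ultimately show "x \<in> ?L" by (simp add: space_PiM)
  qed
  then have "emeasure (distr (Pi\<^sub>M {..<n} (\<lambda>_. half_line)) (Pi\<^sub>M {..<n} (\<lambda>_. half_line)) (\<lambda>x. x \<circ> p)) (Pi\<^sub>E {..<n} A)
      = emeasure (Pi\<^sub>M {..<n} (\<lambda>_. half_line)) (Pi\<^sub>E {..<n} (\<lambda>i. A (inv p i)))"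
    using measurable_permute_coordinates[OF p] A
    by (subst emeasure_distr) (auto simp: half_line_pow_def)
  also have "\<dots> = (\<Prod>i<n. emeasure half_line (A (inv p i)))"
    using Ain by (intro half_line.emeasure_PiM) auto
  also have "\<dots> = (\<Prod>i<n. emeasure half_line (A i))"
    using prod.permute[OF p', of "\<lambda>i. emeasure half_line (A i)"] by (simp add: o_def)
  finally show "emeasure (distr (Pi\<^sub>M {..<n} (\<lambda>_. half_line)) (Pi\<^sub>M {..<n} (\<lambda>_. half_line)) (\<lambda>x. x \<circ> p)) (Pi\<^sub>E {..<n} A)
      = (\<Prod>i<n. emeasure half_line (A i))" .
qed

text \<open>Polarization: expand each product over the functions \<open>g\<close> choosing a summand from every factor.
  The alternating sum over \<open>S\<close> containing the range of \<open>g\<close> vanishes unless that range is everything,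
  so only the permutations survive. They are kept as extensional functions because
  that is the form in which a product of sums expands.\<close>

lemma polarization_identity:
  fixes a :: "nat \<Rightarrow> nat \<Rightarrow> 'a::comm_ring_1"
  shows "(\<Sum>S\<in>Pow {..<n}. (- 1) ^ card S * (\<Prod>i<n. \<Sum>j\<in>S. a i j))
    = (- 1) ^ n * (\<Sum>g | g \<in> ({..<n} \<rightarrow>\<^sub>E {..<n}) \<and> {..<n} \<subseteq> g ` {..<n}. \<Prod>i<n. a i (g i))"
proof -
  let ?A = "{..<n}"
  let ?E = "?A \<rightarrow>\<^sub>E ?A"
  have finE: "finite ?E" by (intro finite_PiE) auto
  have count: "(\<Sum>S\<in>Pow ?A. (- 1) ^ card S * (if g ` ?A \<subseteq> S then 1 else 0)) 
      = (if ?A \<subseteq> g ` ?A then (- 1) ^ n else (0 :: 'a))" if "g \<in> ?E" for g :: "nat \<Rightarrow> nat"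
  proof -
    have gA: "g ` ?A \<subseteq> ?A" using that by auto
    \<comment> \<open>The summand \<open>[g ` A \<subseteq> S]\<close> is \<open>\<Prod>\<^sub>x\<^sub>\<in>\<^sub>A\<^sub>-\<^sub>S [x \<notin> g ` A]\<close>, so the sum is an expanded product of
      differences.\<close>
    have "(\<Prod>x\<in>?A. (if x \<in> g ` ?A then 0 else 1) - 1)
      = (\<Sum>S\<in>Pow ?A. (- 1) ^ card S * (\<Prod>x\<in>S. 1) * (\<Prod>x\<in>?A-S. if x \<in> g ` ?A then 0 else (1 :: 'a)))"
      by (rule prod_diff_conv_sum) simp
    also have "\<dots> = (\<Sum>S\<in>Pow ?A. (- 1) ^ card S * (if g ` ?A \<subseteq> S then 1 else 0))"
    proof (intro sum.cong refl)
      fix S assume S: "S \<in> Pow ?A"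
      show "(- 1) ^ card S * (\<Prod>x\<in>S. 1) * (\<Prod>x\<in>?A-S. if x \<in> g ` ?A then 0 else (1 :: 'a))
        = (- 1) ^ card S * (if g ` ?A \<subseteq> S then 1 else 0)"
      proof (cases "g ` ?A \<subseteq> S")
        case True
        then have "(\<Prod>x\<in>?A-S. if x \<in> g ` ?A then 0 else (1 :: 'a)) = 1" by (intro prod.neutral) auto
        then show ?thesis using True by simp
      next
        case False
        then obtain x where "x \<in> g ` ?A" "x \<in> ?A - S" using gA by blast
        then have "(\<Prod>x\<in>?A-S. if x \<in> g ` ?A then 0 else (1 :: 'a)) = 0"
          by (intro prod_zero bexI[of _ x]) auto
        then show ?thesis using False by simp
      qed
    qed
    also have "(\<Prod>x\<in>?A. (if x \<in> g ` ?A then 0 else 1) - 1) = (if ?A \<subseteq> g ` ?A then (- 1) ^ n else (0 :: 'a))"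
    proof (cases "?A \<subseteq> g ` ?A")
      case True
      have "(\<Prod>x\<in>?A. (if x \<in> g ` ?A then 0 else 1) - 1) = (\<Prod>x\<in>?A. (- 1 :: 'a))"
        using True by (intro prod.cong refl) auto
      then show ?thesis using True by simp
    next
      case False
      then obtain x where "x \<in> ?A" "x \<notin> g ` ?A" by blast
      then have "(\<Prod>x\<in>?A. (if x \<in> g ` ?A then 0 else 1) - 1) = (0 :: 'a)"
        by (intro prod_zero bexI[of _ x]) auto
      then show ?thesis using False by simp
    qed
    finally show ?thesis by simp
  qed
  have "(\<Sum>S\<in>Pow ?A. (- 1) ^ card S * (\<Prod>i<n. \<Sum>j\<in>S. a i j))
      = (\<Sum>S\<in>Pow ?A. \<Sum>g\<in>?E. (- 1) ^ card S * (if g ` ?A \<subseteq> S then 1 else 0) * (\<Prod>i<n. a i (g i)))"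
  proof (intro sum.cong refl)
    fix S assume S: "S \<in> Pow ?A"
    then have fin: "finite S" using finite_subset by auto
    have "(\<Prod>i<n. \<Sum>j\<in>S. a i j) = (\<Sum>g\<in>?A \<rightarrow>\<^sub>E S. \<Prod>i<n. a i (g i))"
      using fin by (intro prod_sum_PiE) auto
    also have "\<dots> = (\<Sum>g\<in>?E. (if g ` ?A \<subseteq> S then 1 else 0) * (\<Prod>i<n. a i (g i)))"
    proof (rule sum.mono_neutral_cong_left[OF finE])
      show "?A \<rightarrow>\<^sub>E S \<subseteq> ?E" using S by (intro PiE_mono) auto
      show "\<forall>g\<in>?E - (?A \<rightarrow>\<^sub>E S). (if g ` ?A \<subseteq> S then 1 else 0) * (\<Prod>i<n. a i (g i)) = 0"
        by (auto simp: PiE_iff)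
    qed auto
    finally show "(- 1) ^ card S * (\<Prod>i<n. \<Sum>j\<in>S. a i j)
      = (\<Sum>g\<in>?E. (- 1) ^ card S * (if g ` ?A \<subseteq> S then 1 else 0) * (\<Prod>i<n. a i (g i)))"
      by (simp add: sum_distrib_left mult.assoc)
  qed
  also have "\<dots> = (\<Sum>g\<in>?E. (if ?A \<subseteq> g ` ?A then (- 1) ^ n else 0) * (\<Prod>i<n. a i (g i)))"
    by (subst sum.swap, intro sum.cong refl) (simp only: sum_distrib_right[symmetric] count)
  also have "\<dots> = (\<Sum>g | g \<in> ?E \<and> ?A \<subseteq> g ` ?A. (- 1) ^ n * (\<Prod>i<n. a i (g i)))"
    by (rule sum.mono_neutral_cong_right[OF finE]) auto
  finally show ?thesis by (simp add: sum_distrib_left)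
qed

lemma half_line_basics:
  "space half_line = {0<..}" "{0<..<r} \<in> sets half_line" "emeasure half_line {0<..<r} < \<infinity>"
proof -
  show "space half_line = {0<..}" "{0<..<r} \<in> sets half_line"
    unfolding half_line_def by (auto simp: space_restrict_space sets_restrict_space_iff)
  have "emeasure half_line {0<..<r} = emeasure lborel {0<..<r}"
    unfolding half_line_def by (intro emeasure_restrict_space) auto
  also have "\<dots> < \<infinity>" by (cases "0 \<le> r") auto
  finally show "emeasure half_line {0<..<r} < \<infinity>" .
qed

lemma sqint_indicator:
  assumes "A \<in> sets half_line" "emeasure half_line A < \<infinity>"
  shows "sqint half_line (indicator A)"
proof -
  have "(\<lambda>x. (cmod (indicator A x))\<^sup>2) = (indicator A :: real \<Rightarrow> real)"
    by (auto simp: indicator_def)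
  then show ?thesis using assms by (auto simp: sqint_def)
qed

lemma sqint_sum:
  assumes "\<And>j. j \<in> S \<Longrightarrow> sqint M (f j)"
  shows "sqint M (\<lambda>x. \<Sum>j\<in>S. f j x)"
  using assms by (induction S rule: infinite_finite_induct) (auto intro: sqint_0 sqint_add)

lemma sqint_mult_integrable:
  assumes "sqint M f" "sqint M g" shows "integrable M (\<lambda>x. f x * g x)"
proof -
  have "sqint M (\<lambda>x. cnj (g x))" using assms(2) by (auto simp: sqint_def)
  from ip_integrable[OF assms(1) this] show ?thesis by simp
qed

text \<open>Testing a symmetric \<open>H\<close> against tensor powers of the sums \<open>\<Sum>\<^sub>j\<^sub>\<in>\<^sub>S 1\<^sub>A\<^sub>_\<^sub>j\<close> and polarizing gives
  the sum over all permutations of its integrals against the permuted boxes. By symmetry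
  of \<open>H\<close> these are all equal, so each of them is zero.\<close>

lemma integral_zero_on_boxes:
  assumes H: "sqint (half_line_pow n) H"
    and sym: "\<And>p. p permutes {..<n} \<Longrightarrow> AE x in half_line_pow n. H (x \<circ> p) = H x"
    and orth: "\<And>f. sqint half_line f \<Longrightarrow> (\<integral>x. H x * (\<Prod>i<n. f (x i)) \<partial>half_line_pow n) = 0"
    and A: "\<And>i. i < n \<Longrightarrow> A i \<in> sets half_line" "\<And>i. i < n \<Longrightarrow> emeasure half_line (A i) < \<infinity>"
  shows "(\<integral>x. H x * (\<Prod>i<n. indicator (A i) (x i)) \<partial>half_line_pow n) = 0"
proof -
  let ?M = "half_line_pow n" and ?A = "{..<n}"
  let ?G = "{g. g \<in> (?A \<rightarrow>\<^sub>E ?A) \<and> ?A \<subseteq> g ` ?A}"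
  let ?I = "\<integral>x. H x * (\<Prod>i<n. indicator (A i) (x i)) \<partial>?M"
  have indA: "sqint half_line (indicator (A i))" if "i < n" for i
    using A that by (intro sqint_indicator) auto
  have intS: "integrable ?M (\<lambda>x. H x * (\<Prod>i<n. \<Sum>j\<in>S. indicator (A j) (x i)))" if "S \<in> Pow ?A" for S
    using that indA by (intro sqint_mult_integrable H sqint_tensor sqint_sum) auto
  have intg: "integrable ?M (\<lambda>x. H x * (\<Prod>i<n. indicator (A (g i)) (x i)))" if "g \<in> ?G" for g
    using that indA by (intro sqint_mult_integrable H sqint_tensor indA) auto
  have Ig: "(\<integral>x. H x * (\<Prod>i<n. indicator (A (g i)) (x i)) \<partial>?M) = ?I" if g: "g \<in> ?G" for g
  proof -
    define p where "p i = (if i < n then g i else i)" for i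
    have img: "g ` ?A = ?A" using g by auto
    have "inj_on g ?A" using img by (intro eq_card_imp_inj_on) auto
    then have "bij_betw g ?A ?A" using img by (simp add: bij_betw_def)
    then have "bij_betw p ?A ?A" by (subst bij_betw_cong[of _ _ g]) (auto simp: p_def)
    then have p: "p permutes ?A" by (rule bij_imp_permutes) (auto simp: p_def)
    have m: "(\<lambda>x. H x * (\<Prod>i<n. indicator (A (g i)) (x i))) \<in> borel_measurable ?M"
      using intg[OF g] by (rule borel_measurable_integrable)
    have "(\<integral>x. H x * (\<Prod>i<n. indicator (A (g i)) (x i)) \<partial>?M)
        = (\<integral>x. H x * (\<Prod>i<n. indicator (A (g i)) (x i)) \<partial>distr ?M ?M (\<lambda>x. x \<circ> p))"
      by (simp add: distr_permute_coordinates[OF p])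
    also have "\<dots> = (\<integral>x. H (x \<circ> p) * (\<Prod>i<n. indicator (A (g i)) ((x \<circ> p) i)) \<partial>?M)"
      by (rule integral_distr[OF measurable_permute_coordinates[OF p] m])
    also have "\<dots> = (\<integral>x. H (x \<circ> p) * (\<Prod>i<n. indicator (A i) (x i)) \<partial>?M)"
    proof -
      have "(\<Prod>i<n. indicator (A (g i)) ((x \<circ> p) i)) = (\<Prod>i<n. indicator (A i) (x i) :: complex)" for x
        using prod.permute[OF p, of "\<lambda>i. indicator (A i) (x i) :: complex"]
        by (simp add: o_def p_def)
      then show ?thesis by simp
    qed
    also have "\<dots> = ?I"
    proof (rule integral_cong_AE)
      have t: "(\<lambda>x. \<Prod>i<n. indicator (A i) (x i) :: complex) \<in> borel_measurable ?M"
        and h: "H \<in> borel_measurable ?M"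
        using sqint_tensor[OF indA] H by (auto simp: sqint_def)
      show "(\<lambda>x. H x * (\<Prod>i<n. indicator (A i) (x i))) \<in> borel_measurable ?M"
        using t h by (rule borel_measurable_times[rotated])
      show "(\<lambda>x. H (x \<circ> p) * (\<Prod>i<n. indicator (A i) (x i))) \<in> borel_measurable ?M"
        using t measurable_compose[OF measurable_permute_coordinates[OF p] h]
        by (rule borel_measurable_times[rotated])
      show "AE x in ?M. H (x \<circ> p) * (\<Prod>i<n. indicator (A i) (x i)) = H x * (\<Prod>i<n. indicator (A i) (x i))"
        using sym[OF p] by eventually_elim simp
    qed
    finally show ?thesis .
  qed
  have "0 = (\<Sum>S\<in>Pow ?A. (- 1) ^ card S * (\<integral>x. H x * (\<Prod>i<n. \<Sum>j\<in>S. indicator (A j) (x i)) \<partial>?M))"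
  proof (intro sum.neutral[symmetric] ballI)
    fix S assume "S \<in> Pow ?A"
    then have "sqint half_line (\<lambda>x. \<Sum>j\<in>S. indicator (A j) x)"
      using indA by (intro sqint_sum) auto
    from orth[OF this]
    show "(- 1) ^ card S * (\<integral>x. H x * (\<Prod>i<n. \<Sum>j\<in>S. indicator (A j) (x i)) \<partial>?M) = 0" by simp
  qed
  also have "\<dots> = (\<integral>x. (\<Sum>S\<in>Pow ?A. (- 1) ^ card S * (H x * (\<Prod>i<n. \<Sum>j\<in>S. indicator (A j) (x i)))) \<partial>?M)"
    using intS by (subst Bochner_Integration.integral_sum) auto
  also have "\<dots> = (\<integral>x. (\<Sum>g\<in>?G. (- 1) ^ n * (H x * (\<Prod>i<n. indicator (A (g i)) (x i)))) \<partial>?M)"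
  proof -
    have "(\<Sum>S\<in>Pow ?A. (- 1) ^ card S * (H x * (\<Prod>i<n. \<Sum>j\<in>S. indicator (A j) (x i))))
      = H x * (\<Sum>S\<in>Pow ?A. (- 1) ^ card S * (\<Prod>i<n. \<Sum>j\<in>S. indicator (A j) (x i)))" for x
      by (simp add: sum_distrib_left mult.left_commute)
    then show ?thesis
      by (simp add: polarization_identity sum_distrib_left mult.left_commute)
  qed
  also have "\<dots> = (\<Sum>g\<in>?G. (- 1) ^ n * (\<integral>x. H x * (\<Prod>i<n. indicator (A (g i)) (x i)) \<partial>?M))"
    using intg by (subst Bochner_Integration.integral_sum) auto
  also have "\<dots> = of_nat (card ?G) * ((- 1) ^ n * ?I)"
    by (subst sum.cong[OF refl arg_cong[OF Ig]]) simp_all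
  finally have "of_nat (card ?G) * ((- 1) ^ n * ?I) = 0" by simp
  moreover have "card ?G \<noteq> 0"
  proof -
    have "finite ?G" by (rule finite_subset[of _ "?A \<rightarrow>\<^sub>E ?A"]) (auto intro: finite_PiE)
    moreover have "restrict id ?A \<in> ?G" by auto
    ultimately show ?thesis by (metis card_0_eq empty_iff)
  qed
  ultimately show ?thesis by simp
qed

text \<open>Boxes form a generator stable under intersection, so the integral of \<open>H\<close> over every measurable part of
  a bounded cube vanishes.\<close>

lemma AE_zero_if_zero_on_boxes:
  assumes H: "sqint (half_line_pow n) H"
    and box: "\<And>A. (\<And>i. i < n \<Longrightarrow> A i \<in> sets half_line) \<Longrightarrow> (\<And>i. i < n \<Longrightarrow> emeasure half_line (A i) < \<infinity>)
      \<Longrightarrow> (\<integral>x. H x * (\<Prod>i<n. indicator (A i) (x i)) \<partial>half_line_pow n) = 0"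
  shows "AE x in half_line_pow n. H x = 0"
proof -
  let ?M = "half_line_pow n" and ?\<Omega> = "{..<n} \<rightarrow>\<^sub>E space half_line"
  have spM: "space ?M = ?\<Omega>" by (simp add: half_line_pow_def space_PiM)
  interpret M: sigma_finite_measure ?M
    unfolding half_line_pow_def by (rule half_line.sigma_finite) simp
  \<comment> \<open>Cutting off to a cube makes the square integrable \<open>H\<close> integrable.\<close>
  have "AE x in ?M. H x * (\<Prod>i<n. indicator {0<..<real k} (x i)) = 0" for k
  proof (rule M.density_zero)
    let ?f = "\<lambda>x. H x * (\<Prod>i<n. indicator {0<..<real k} (x i))"
    show int: "integrable ?M ?f"
      by (intro sqint_mult_integrable H sqint_tensor sqint_indicator half_line_basics)
    have prod_alg: "prod_algebra {..<n} (\<lambda>_. half_line) 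
        = {Pi\<^sub>E {..<n} X | X. X \<in> {..<n} \<rightarrow> sets half_line}"
      by (subst prod_algebra_eq_finite) auto
    have zero_on_box: "(LINT x:B|?M. ?f x) = 0" if B: "B \<in> prod_algebra {..<n} (\<lambda>_. half_line)" for B
    proof -
      obtain X where X: "B = Pi\<^sub>E {..<n} X" "\<And>i. i < n \<Longrightarrow> X i \<in> sets half_line"
        using B unfolding prod_alg by auto
      have "(LINT x:B|?M. ?f x) = (\<integral>x. H x * (\<Prod>i<n. indicator (X i \<inter> {0<..<real k}) (x i)) \<partial>?M)"
        unfolding set_lebesgue_integral_def
      proof (rule Bochner_Integration.integral_cong[OF refl])
        fix x assume x: "x \<in> space ?M"
        then have ext: "i \<notin> {..<n} \<Longrightarrow> x i = undefined" for i unfolding spM by (rule PiE_arb)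
        have "(\<Prod>i<n. indicator (X i \<inter> {0<..<real k}) (x i))
            = (\<Prod>i<n. indicator (X i) (x i)) * (\<Prod>i<n. indicator {0<..<real k} (x i) :: complex)"
          by (simp add: indicator_inter_arith prod.distrib)
        also have "(\<Prod>i<n. indicator (X i) (x i)) = (indicator B x :: complex)"
        proof (cases "x \<in> B")
          case True
          then show ?thesis using X(1) by (auto simp: PiE_iff intro!: prod.neutral)
        next
          case False
          then obtain i where "i < n" "x i \<notin> X i" using ext unfolding X(1) by (auto simp: PiE_iff extensional_def)
          then have "(\<Prod>i<n. indicator (X i) (x i) :: complex) = 0" by (intro prod_zero bexI[of _ i]) auto
          then show ?thesis using False by simp
        qed
        finally show "indicat_real B x *\<^sub>R ?f x = H x * (\<Prod>i<n. indicator (X i \<inter> {0<..<real k}) (x i))"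
          by (simp add: indicator_def)
      qed
      also have "\<dots> = 0"
      proof (rule box)
        fix i assume i: "i < n"
        show "X i \<inter> {0<..<real k} \<in> sets half_line"
          using X(2)[OF i] half_line_basics(2) by (rule sets.Int)
        have "emeasure half_line (X i \<inter> {0<..<real k}) \<le> emeasure half_line {0<..<real k}"
          by (intro emeasure_mono half_line_basics) auto
        then show "emeasure half_line (X i \<inter> {0<..<real k}) < \<infinity>"
          using half_line_basics(3) by (rule le_less_trans)
      qed
      finally show ?thesis .
    qed
    fix B assume B: "B \<in> sets ?M"
    have sM: "sets ?M = sigma_sets ?\<Omega> (prod_algebra {..<n} (\<lambda>_. half_line))"
      unfolding half_line_pow_def by (rule sets_PiM)
    have sint: "set_integrable ?M C ?f" if "C \<in> sets ?M" for C
      unfolding set_integrable_def by (rule integrable_mult_indicator[OF that int])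
    show "(LINT x:B|?M. ?f x) = 0"
      using B unfolding sM
    proof (induction B rule: sigma_sets_induct_disjoint[OF Int_stable_prod_algebra
            prod_algebra_sets_into_space, consumes 1, case_names basic empty compl union])
      case (compl B)
      have "(LINT x:?\<Omega>|?M. ?f x) = 0"
      proof (rule zero_on_box)
        show "?\<Omega> \<in> prod_algebra {..<n} (\<lambda>_. half_line)" unfolding prod_alg by auto
      qed
      moreover have "(LINT x:?\<Omega>|?M. ?f x) = (LINT x:B|?M. ?f x) + (LINT x:?\<Omega> - B|?M. ?f x)"
      proof (subst set_integral_Un[symmetric])
        have B: "B \<in> sets ?M" using compl by (simp add: sM)
        then have B': "?\<Omega> - B \<in> sets ?M" using sets.compl_sets[OF B] by (simp add: spM)
        show "set_integrable ?M B ?f" "set_integrable ?M (?\<Omega> - B) ?f" using B B' by (auto intro: sint)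
        have "B \<subseteq> ?\<Omega>" using sets.sets_into_space[OF B] by (simp add: spM)
        then show "(LINT x:?\<Omega>|?M. ?f x) = (LINT x:B \<union> (?\<Omega> - B)|?M. ?f x)" by (simp add: Un_absorb1)
      qed auto
      ultimately show ?case using compl by simp
    next
      case (union D)
      have D: "D i \<in> sets ?M" for i using union(2) by (auto simp: sM)
      have "(LINT x:(\<Union>i. D i)|?M. ?f x) = (\<Sum>i. LINT x:D i|?M. ?f x)"
        using D union(1) by (intro lebesgue_integral_countable_add sint) (auto simp: disjoint_family_on_def)
      then show ?case using union(3) by simp
    next
      case (basic B)
      then show ?case by (rule zero_on_box)
    next
      case empty
      show ?case by (simp add: set_lebesgue_integral_def)
    qed
  qed
  then have "AE x in ?M. \<forall>k. H x * (\<Prod>i<n. indicator {0<..<real k} (x i)) = 0"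
    unfolding AE_all_countable ..
  then show ?thesis
  proof (rule AE_mp, intro AE_I2 impI)
    fix x assume x: "x \<in> space ?M" and eq: "\<forall>k. H x * (\<Prod>i<n. indicator {0<..<real k} (x i)) = 0"
    obtain k where k: "(\<Sum>i<n. \<bar>x i\<bar>) < real k" using reals_Archimedean2 by blast
    have "x i \<in> {0<..<real k}" if "i < n" for i
    proof -
      have "x i \<in> space half_line" using x that unfolding spM by auto
      moreover have "\<bar>x i\<bar> \<le> (\<Sum>i<n. \<bar>x i\<bar>)" using that by (intro member_le_sum) auto
      ultimately show ?thesis using k by (auto simp: half_line_basics)
    qed
    then have "(\<Prod>i<n. indicator {0<..<real k} (x i) :: complex) = 1" by (intro prod.neutral) auto
    then show "H x = 0" using eq by (metis mult.right_neutral)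
  qed
qed

section \<open>Exponential vectors\<close>

text \<open>Oriented this way so that inner products with exponential vectors unfold to \<^const>\<open>fock_ip\<close>.\<close>

lemma abs_fock_tensor_powers:
  assumes "sqint half_line f"
  shows "abs_fock (\<lambda>n x. (\<Prod>i<n. f (x i)) / complex_of_real (sqrt (fact n))) = expvec (abs_l2 f)"
  using assms by (simp add: expvec.abs_eq l2_rel_def)

lemma l2_representative:
  obtains f where "sqint half_line f" "\<xi> = abs_l2 f"
proof
  show "sqint half_line (rep_l2 \<xi>)"
    using Quotient_rep_reflp[OF Quotient_l2, of \<xi>] by (simp add: l2_rel_def)
  show "\<xi> = abs_l2 (rep_l2 \<xi>)"
    by (rule Quotient_abs_rep[OF Quotient_l2, symmetric])
qed

text \<open>The \<open>n\<close>-th component of an exponential vector is homogeneous of degree \<open>n\<close>.\<close>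

lemma expvec_power_series:
  assumes f: "sqint half_line f" and F: "fock_fun F"
  shows "(\<lambda>n. ip (half_line_pow n) (\<lambda>x. (\<Prod>i<n. f (x i)) / complex_of_real (sqrt (fact n))) (F n) * z ^ n)
     sums cinner (expvec (z *\<^sub>C abs_l2 f)) (abs_fock F)"
proof -
  let ?e = "\<lambda>f n x. (\<Prod>i<n. f (x i)) / complex_of_real (sqrt (fact n))"
  have zf: "sqint half_line (\<lambda>x. z * f x)" using f by (rule sqint_scale)
  have "z *\<^sub>C abs_l2 f = abs_l2 (\<lambda>x. z * f x)"
    using f by (simp add: scaleC_l2.abs_eq l2_rel_def)
  then have "cinner (expvec (z *\<^sub>C abs_l2 f)) (abs_fock F) = fock_ip (?e (\<lambda>x. z * f x)) F"
    by (simp only: abs_fock_tensor_powers[OF zf, symmetric]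
        cinner_fock.abs_eq[OF fock_rel_refl[OF expvec_fock_fun[OF zf]] fock_rel_refl[OF F]])
  moreover have "(\<lambda>n. ip (half_line_pow n) (?e (\<lambda>x. z * f x) n) (F n)) sums fock_ip (?e (\<lambda>x. z * f x)) F"
    unfolding fock_ip_def
    by (intro summable_sums fock_ip_summable expvec_fock_fun zf F)
  moreover have "ip (half_line_pow n) (?e (\<lambda>x. z * f x) n) (F n)
      = ip (half_line_pow n) (?e f n) (F n) * z ^ n" for n
  proof -
    have "?e (\<lambda>x. z * f x) n = (\<lambda>x. z ^ n * ?e f n x)"
      by (simp add: prod.distrib fun_eq_iff)
    then show ?thesis by (simp only: ip_scale mult.commute)
  qed
  ultimately show ?thesis by simp
qed

lemma cinner_expvec: "cinner (expvec \<xi>) (expvec \<eta>) = exp (cinner \<xi> \<eta>)"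
proof -
  obtain f where f: "sqint half_line f" "\<xi> = abs_l2 f" by (rule l2_representative)
  obtain g where g: "sqint half_line g" "\<eta> = abs_l2 g" by (rule l2_representative)
  have g': "sqint half_line (\<lambda>x. cnj (g x))" using g(1) by (auto simp: sqint_def)
  let ?e = "\<lambda>f n x. (\<Prod>i<n. f (x i)) / complex_of_real (sqrt (fact n))"
  have ipn: "ip (half_line_pow n) (?e f n) (?e g n) = (ip half_line f g) ^ n /\<^sub>R fact n" for n
  proof -
    have "(\<lambda>x. ?e f n x * cnj (?e g n x)) = (\<lambda>x. (\<Prod>i<n. f (x i) * cnj (g (x i))) / fact n)"
    proof
      fix x :: "nat \<Rightarrow> real"
      have "complex_of_real (sqrt (fact n)) * complex_of_real (sqrt (fact n)) = fact n"
        by (simp flip: of_real_mult)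
      then show "?e f n x * cnj (?e g n x) = (\<Prod>i<n. f (x i) * cnj (g (x i))) / fact n"
        by (simp add: prod.distrib)
    qed
    then have "ip (half_line_pow n) (?e f n) (?e g n)
        = (\<integral>x. (\<Prod>i<n. f (x i) * cnj (g (x i))) \<partial>half_line_pow n) / fact n"
      by (simp add: ip_def)
    also have "(\<integral>x. (\<Prod>i<n. f (x i) * cnj (g (x i))) \<partial>half_line_pow n) = (ip half_line f g) ^ n"
      unfolding half_line_pow_def ip_def using f(1) g'
      by (subst half_line.product_integral_prod) (auto intro: sqint_mult_integrable)
    finally show ?thesis by (simp add: scaleR_conv_of_real field_simps)
  qed
  have "cinner (expvec \<xi>) (expvec \<eta>) = fock_ip (?e f) (?e g)"
    by (simp only: f(2) g(2) abs_fock_tensor_powers[OF f(1), symmetric] abs_fock_tensor_powers[OF g(1), symmetric]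
        cinner_fock.abs_eq[OF fock_rel_refl[OF expvec_fock_fun[OF f(1)]] fock_rel_refl[OF expvec_fock_fun[OF g(1)]]])
  also have "\<dots> = exp (ip half_line f g)"
    unfolding fock_ip_def ipn exp_def ..
  also have "ip half_line f g = cinner \<xi> \<eta>"
    using f g by (simp add: cinner_l2.abs_eq l2_rel_def)
  finally show ?thesis .
qed

lemma power_series_zero:
  fixes c :: "nat \<Rightarrow> complex"
  assumes "\<And>z. (\<lambda>n. c n * z ^ n) sums 0"
  shows "c n = 0"
proof -
  have zero: "(\<Sum>n. c n * z ^ n) = 0" for z by (rule sums_unique[OF assms, symmetric])
  have "summable (\<lambda>n. c n * 1 ^ n)" by (rule sums_summable[OF assms])
  then have "ereal (norm (1 :: complex)) \<le> conv_radius c" by (rule conv_radius_geI)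
  then have pos: "0 < fps_conv_radius (Abs_fps c)"
  proof -
    have "fps_nth (Abs_fps c) = c" by (simp add: fun_eq_iff)
    then show ?thesis
      unfolding fps_conv_radius_def using \<open>ereal (norm (1 :: complex)) \<le> conv_radius c\<close>
      by (metis ereal_less(2) less_le_trans norm_one zero_less_one)
  qed
  have "eventually (\<lambda>z. eval_fps (Abs_fps c) z = eval_fps 0 z) (nhds 0)"
    unfolding eval_fps_def by (simp add: zero)
  moreover have "0 < fps_conv_radius (0 :: complex fps)" by simp
  ultimately have "Abs_fps c = 0" by (intro eval_fps_eqD pos)
  then have "fps_nth (Abs_fps c) n = fps_nth 0 n" by (rule arg_cong)
  then show ?thesis by simp
qed

text \<open>A vector orthogonal to all \<open>e(z \<xi>)\<close> has, by uniqueness of power series coefficients, each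
  component orthogonal to all tensor powers \<open>\<xi>\<^sup>n\<close>.\<close>

theorem total_expvec: "total_vectors (range expvec)"
  unfolding total_vectors_def
proof (intro allI impI)
  fix u assume u: "\<forall>b\<in>range expvec. cinner u b = 0"
  define F where "F = rep_fock u"
  have F: "fock_fun F" "u = abs_fock F" by (simp_all add: F_def fock_fun_rep abs_rep_fock)
  have "AE x in half_line_pow n. F n x = 0" for n
  proof -
    define H where "H x = cnj (F n x)" for x
    have sF: "sqint (half_line_pow n) (F n)" using F by (simp add: fock_fun_def)
    have "H = (\<lambda>x. cnj (F n x))" by (simp add: H_def fun_eq_iff)
    then have H: "sqint (half_line_pow n) H" using sF by (auto simp: sqint_def)
    have sym: "AE x in half_line_pow n. H (x \<circ> p) = H x" if "p permutes {..<n}" for p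
    proof -
      have "AE x in half_line_pow n. F n (x \<circ> p) = F n x" using F that by (simp add: fock_fun_def)
      then show ?thesis unfolding H_def by eventually_elim simp
    qed
    have "(\<integral>x. H x * (\<Prod>i<n. f (x i)) \<partial>half_line_pow n) = 0" if f: "sqint half_line f" for f
    proof -
      have "cinner (expvec (z *\<^sub>C abs_l2 f)) (abs_fock F) = 0" for z
        using u cinner_commute[of "expvec (z *\<^sub>C abs_l2 f)" u] F(2) by simp
      then have "ip (half_line_pow n) (\<lambda>x. (\<Prod>i<n. f (x i)) / complex_of_real (sqrt (fact n))) (F n) = 0"
        using expvec_power_series[OF f F(1)] by (intro power_series_zero) simp
      moreover have "(\<lambda>x. (\<Prod>i<n. f (x i)) / complex_of_real (sqrt (fact n)) * cnj (F n x))
          = (\<lambda>x. H x * (\<Prod>i<n. f (x i)) / complex_of_real (sqrt (fact n)))"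
        by (simp add: H_def mult.commute)
      ultimately have "(\<integral>x. H x * (\<Prod>i<n. f (x i)) / complex_of_real (sqrt (fact n)) \<partial>half_line_pow n) = 0"
        unfolding ip_def by (simp only:)
      then show ?thesis by simp
    qed
    then have "AE x in half_line_pow n. H x = 0"
      by (intro AE_zero_if_zero_on_boxes H integral_zero_on_boxes[OF H sym])
    then show ?thesis unfolding H_def by eventually_elim simp
  qed
  then have "fock_rel F (\<lambda>_ _. 0)" using F by (simp add: fock_rel_def fock_fun_0)
  then show "u = 0"
    unfolding F(2) zero_fock_def using Quotient_rel_abs[OF Quotient_fock] by blast
qed

section \<open>Bounded operators and adjoints\<close>

lemma bounded_opsD:
  assumes "T \<in> bounded_ops"
  shows "bounded_linear T" "T (c *\<^sub>C v) = c *\<^sub>C T v" "T (v + w) = T v + T w" "T 0 = 0" "T (v - w) = T v - T w"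
proof -
  show bl: "bounded_linear T" and "T (c *\<^sub>C v) = c *\<^sub>C T v" using assms by (auto simp: bounded_ops_def)
  interpret bounded_linear T by (rule bl)
  show "T (v + w) = T v + T w" "T 0 = 0" "T (v - w) = T v - T w" by (rule add zero diff)+
qed

lemma bounded_ops_comp: "S \<in> bounded_ops \<Longrightarrow> T \<in> bounded_ops \<Longrightarrow> S \<circ> T \<in> bounded_ops"
  unfolding bounded_ops_def using bounded_linear_compose by (auto simp: o_def)

lemma bounded_ops_add: "S \<in> bounded_ops \<Longrightarrow> T \<in> bounded_ops \<Longrightarrow> (\<lambda>v. S v + T v) \<in> bounded_ops"
  unfolding bounded_ops_def by (auto intro: bounded_linear_add simp: scaleC_add_right)

lemma bounded_ops_scaleC: "T \<in> bounded_ops \<Longrightarrow> (\<lambda>v. c *\<^sub>C T v) \<in> bounded_ops"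
  unfolding bounded_ops_def
  by (auto intro: bounded_linear_compose[OF bounded_linear_scaleC] simp: scaleC_scaleC mult.commute)

lemma bounded_ops_id: "id \<in> bounded_ops"
  by (simp add: bounded_ops_def id_def bounded_linear_ident)

lemma bounded_ops_eqI:
  assumes "S \<in> bounded_ops" "T \<in> bounded_ops" "\<And>\<xi>. S (expvec \<xi>) = T (expvec \<xi>)"
  shows "S = T"
  using assms by (intro bounded_linear_eq_on_total[OF total_expvec]) (auto simp: bounded_ops_def)

lemma adjoint_exists:
  assumes T: "T \<in> bounded_ops"
  shows "\<exists>S\<in>bounded_ops. \<forall>v w. cinner (T v) w = cinner v (S w)"
proof -
  note T' = bounded_opsD[OF T]
  have "\<exists>s. \<forall>v. cinner (T v) w = cinner v s" for w
    by (rule riesz_representation)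
       (auto intro: bounded_linear_compose[OF cinner.bounded_linear_left T'(1)] simp: T' cinner_scaleC_left)
  then obtain S where S: "\<And>v w. cinner (T v) w = cinner v (S w)" by metis
  have S': "cinner (S w) v = cinner w (T v)" for v w
    using S[of v w] cinner_commute[of "S w" v] cinner_commute[of w "T v"] by simp
  obtain K where K: "\<And>x. norm (T x) \<le> norm x * K" "K > 0"
    using bounded_linear.pos_bounded[OF T'(1)] by blast
  have "S \<in> bounded_ops"
    unfolding bounded_ops_def
  proof (intro CollectI conjI allI)
    show "bounded_linear S"
    proof (rule bounded_linear_intro[of _ K])
      show "S (x + y) = S x + S y" for x y
        by (rule cinner_extensionality) (simp add: S' cinner_add_left)
      show "S (r *\<^sub>R x) = r *\<^sub>R S x" for r x
        by (rule cinner_extensionality) (simp add: S' cinner_scaleR_left)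
      show "norm (S x) \<le> norm x * K" for x
      proof -
        have "(norm (S x))\<^sup>2 = cmod (cinner (S x) (S x))" by (simp add: cinner_self norm_power)
        also have "\<dots> \<le> norm x * norm (T (S x))" unfolding S' by (rule norm_cinner_le)
        also have "\<dots> \<le> norm x * (norm (S x) * K)" by (intro mult_left_mono K) simp
        finally have "norm (S x) * norm (S x) \<le> norm (S x) * (norm x * K)"
          by (simp add: power2_eq_square mult_ac)
        then show ?thesis using K(2) by (cases "norm (S x) = 0") (auto simp: mult_le_cancel_left)
      qed
    qed
    show "S (c *\<^sub>C v) = c *\<^sub>C S v" for c v
      by (rule cinner_extensionality) (simp add: S' cinner_scaleC_left)
  qed
  then show ?thesis using S by blast
qed

lemma adj_spec:
  assumes T: "T \<in> bounded_ops"
  shows adj_bounded: "adj T \<in> bounded_ops" and cinner_adj: "cinner (T v) w = cinner v (adj T w)"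
    and adj_cinner: "cinner (adj T v) w = cinner v (T w)"
proof -
  have "\<exists>!S. S \<in> bounded_ops \<and> (\<forall>v w. cinner (T v) w = cinner v (S w))"
  proof (rule ex_ex1I)
    show "\<exists>S. S \<in> bounded_ops \<and> (\<forall>v w. cinner (T v) w = cinner v (S w))"
      using adjoint_exists[OF T] by blast
    fix S S' assume *: "S \<in> bounded_ops \<and> (\<forall>v w. cinner (T v) w = cinner v (S w))"
      and **: "S' \<in> bounded_ops \<and> (\<forall>v w. cinner (T v) w = cinner v (S' w))"
    show "S = S'"
    proof
      fix w show "S w = S' w"
      proof (rule cinner_extensionality_right)
        show "cinner z (S w) = cinner z (S' w)" for z
          using *[THEN conjunct2, rule_format, of z w] **[THEN conjunct2, rule_format, of z w] by simp
      qed
    qed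
  qed
  from theI'[OF this] have a1: "adj T \<in> bounded_ops" and a2: "\<forall>v w. cinner (T v) w = cinner v (adj T w)"
    unfolding adj_def[symmetric] by (rule conjunct1, rule conjunct2)
  show "adj T \<in> bounded_ops" by (rule a1)
  show a: "cinner (T v) w = cinner v (adj T w)" for v w by (rule a2[rule_format])
  show "cinner (adj T v) w = cinner v (T w)"
    using a[of w v] cinner_commute[of "adj T v" w] cinner_commute[of v "T w"] by simp
qed

section \<open>Weyl operators\<close>

definition weyl_factor :: "l2 \<Rightarrow> l2 \<Rightarrow> complex" where
  "weyl_factor \<xi> \<eta> = exp (- (complex_of_real (norm \<xi>))\<^sup>2 / 2 - cinner \<eta> \<xi>)"

text \<open>The prescribed images of the exponential vectors have the same Gram matrix as the exponential
  vectors themselves.\<close>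

lemma weyl_exists:
  "\<exists>W\<in>bounded_ops. (\<forall>v. norm (W v) = norm v) \<and> (\<forall>\<eta>. W (expvec \<eta>) = weyl_factor \<xi> \<eta> *\<^sub>C expvec (\<xi> + \<eta>))"
proof -
  let ?v = "\<lambda>\<eta>. weyl_factor \<xi> \<eta> *\<^sub>C expvec (\<xi> + \<eta>)"
  have gram: "cinner (expvec \<eta>) (expvec \<zeta>) = cinner (?v \<eta>) (?v \<zeta>)" for \<eta> \<zeta>
  proof -
    have "cnj (weyl_factor \<xi> \<zeta>) = exp (- (complex_of_real (norm \<xi>))\<^sup>2 / 2 - cinner \<xi> \<zeta>)"
      unfolding weyl_factor_def by (simp add: exp_cnj cinner_commute[of \<xi> \<zeta>])
    then have "cinner (?v \<eta>) (?v \<zeta>) = exp (- (complex_of_real (norm \<xi>))\<^sup>2 / 2 - cinner \<eta> \<xi>)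
      * (exp (- (complex_of_real (norm \<xi>))\<^sup>2 / 2 - cinner \<xi> \<zeta>) * exp (cinner (\<xi> + \<eta>) (\<xi> + \<zeta>)))"
      by (simp add: cinner_scaleC_left cinner_scaleC_right cinner_expvec weyl_factor_def)
    also have "\<dots> = exp (cinner \<eta> \<zeta>)"
      unfolding exp_add[symmetric]
      by (rule arg_cong[where f = exp]) (simp add: cinner_add_left cinner_add_right cinner_self)
    finally show ?thesis by (simp add: cinner_expvec)
  qed
  from isometric_extension[of expvec ?v, OF total_expvec gram]
  obtain W where "bounded_linear W" "\<forall>c x. W (c *\<^sub>C x) = c *\<^sub>C W x" "\<forall>x. norm (W x) = norm x"
    "\<forall>\<eta>. W (expvec \<eta>) = ?v \<eta>"
    by blast
  then show ?thesis by (intro bexI[of _ W]) (auto simp: bounded_ops_def)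
qed

lemma weyl_spec:
  shows weyl_bounded: "weyl \<xi> \<in> bounded_ops" and norm_weyl: "norm (weyl \<xi> v) = norm v"
    and weyl_expvec: "weyl \<xi> (expvec \<eta>) = weyl_factor \<xi> \<eta> *\<^sub>C expvec (\<xi> + \<eta>)"
proof -
  obtain W where W: "W \<in> bounded_ops" "\<And>v. norm (W v) = norm v"
    "\<And>\<eta>. W (expvec \<eta>) = weyl_factor \<xi> \<eta> *\<^sub>C expvec (\<xi> + \<eta>)" using weyl_exists[of \<xi>] by blast
  have "weyl \<xi> = W"
    unfolding weyl_def weyl_factor_def[symmetric]
  proof (rule the_equality)
    show "W' = W" if "W' \<in> bounded_ops \<and> (\<forall>\<eta>. W' (expvec \<eta>) = weyl_factor \<xi> \<eta> *\<^sub>C expvec (\<xi> + \<eta>))" for W'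
      using that W by (intro bounded_ops_eqI) auto
  qed (use W in auto)
  then show "weyl \<xi> \<in> bounded_ops" "norm (weyl \<xi> v) = norm v"
    "weyl \<xi> (expvec \<eta>) = weyl_factor \<xi> \<eta> *\<^sub>C expvec (\<xi> + \<eta>)" using W by auto
qed

lemma weyl_commute:
  assumes "cinner \<xi> \<eta> = 0"
  shows "weyl \<xi> \<circ> weyl \<eta> = weyl \<eta> \<circ> weyl \<xi>"
proof (rule bounded_ops_eqI)
  have "cinner \<eta> \<xi> = 0" using assms cinner_commute[of \<eta> \<xi>] by simp
  then show "(weyl \<xi> \<circ> weyl \<eta>) (expvec \<zeta>) = (weyl \<eta> \<circ> weyl \<xi>) (expvec \<zeta>)" for \<zeta>
    using assms
    by (simp add: weyl_expvec bounded_opsD[OF weyl_bounded] scaleC_scaleC weyl_factor_def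
        exp_add[symmetric] cinner_add_left add_ac diff_add_eq algebra_simps)
qed (auto intro: bounded_ops_comp weyl_bounded)

lemma weyl_inverse: "weyl \<xi> \<circ> weyl (- \<xi>) = id"
proof (rule bounded_ops_eqI)
  show "(weyl \<xi> \<circ> weyl (- \<xi>)) (expvec \<zeta>) = id (expvec \<zeta>)" for \<zeta>
    by (simp add: weyl_expvec bounded_opsD[OF weyl_bounded] scaleC_scaleC weyl_factor_def
        exp_add[symmetric] cinner_add_left cinner.minus_left cinner.minus_right cinner_self cinner.diff_left)
qed (auto intro: bounded_ops_comp weyl_bounded bounded_ops_id)

lemma weyl_inverse_apply: "weyl \<xi> (weyl (- \<xi>) v) = v" "weyl (- \<xi>) (weyl \<xi> v) = v"
  using fun_cong[OF weyl_inverse[of \<xi>], of v] fun_cong[OF weyl_inverse[of "- \<xi>"], of v] by simp_all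

lemma isometry_inner:
  assumes "T \<in> bounded_ops" "\<And>v. norm (T v) = norm v"
  shows "cinner (T v) (T w) = cinner v w"
proof -
  note T = bounded_opsD[OF assms(1)]
  have i: "inner (T v) (T w) = inner v w" for v w
  proof -
    have "(norm (T v + T w))\<^sup>2 = (norm (v + w))\<^sup>2" by (simp add: T(3)[symmetric] assms(2))
    moreover have "(norm (T v))\<^sup>2 = (norm v)\<^sup>2" "(norm (T w))\<^sup>2 = (norm w)\<^sup>2" by (simp_all add: assms(2))
    ultimately show ?thesis unfolding power2_norm_eq_inner by (simp add: inner_simps inner_commute)
  qed
  from i[of v w] i[of "\<i> *\<^sub>C v" w] show ?thesis
    by (simp add: T inner_eq_Re_cinner cinner_scaleC_left complex_eq_iff)
qed

lemma cinner_weyl: "cinner (weyl \<xi> v) w = cinner v (weyl (- \<xi>) w)"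
  using isometry_inner[OF weyl_bounded norm_weyl, of \<xi> v "weyl (- \<xi>) w"]
  by (simp add: weyl_inverse_apply)

section \<open>Irreducibility of the Weyl operators\<close>

lemma expvec_holomorphic:
  "\<exists>d. ((\<lambda>z. cinner (expvec (z *\<^sub>C \<xi>)) u) has_field_derivative d) (at z)"
proof -
  obtain f where f: "sqint half_line f" "\<xi> = abs_l2 f" by (rule l2_representative)
  define c where "c n = ip (half_line_pow n)
     (\<lambda>x. (\<Prod>i<n. f (x i)) / complex_of_real (sqrt (fact n))) (rep_fock u n)" for n
  have s: "(\<lambda>n. c n * z ^ n) sums cinner (expvec (z *\<^sub>C \<xi>)) u" for z
    using expvec_power_series[OF f(1) fock_fun_rep[of u], of z] by (simp add: c_def f(2) abs_rep_fock)
  have "(\<lambda>z. cinner (expvec (z *\<^sub>C \<xi>)) u) = (\<lambda>z. \<Sum>n. c n * z ^ n)"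
    using s by (simp add: fun_eq_iff sums_iff)
  then show ?thesis
    using termdiffs_strong_converges_everywhere[of c z] s by (auto simp: sums_iff)
qed

text \<open>The derivative is both complex linear and conjugate linear, hence zero.\<close>

lemma holomorphic_antiholomorphic_constant:
  fixes h k :: "complex \<Rightarrow> complex"
  assumes h: "\<And>z. \<exists>d. (h has_field_derivative d) (at z)"
    and k: "\<And>z. \<exists>d. (k has_field_derivative d) (at z)"
    and eq: "\<And>z. h z = cnj (k z)"
  shows "h z = h 0"
proof -
  have "(h has_field_derivative 0) (at z)" for z
  proof -
    obtain d e where d: "(h has_field_derivative d) (at z)" and e: "(k has_field_derivative e) (at z)"
      using h k by blast
    have 1: "(h has_derivative (\<lambda>v. d * v)) (at z)"
      using d by (simp add: has_field_derivative_def)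
    have "((\<lambda>z. cnj (k z)) has_derivative (\<lambda>v. cnj (e * v))) (at z)"
      using bounded_linear.has_derivative[OF bounded_linear_cnj, of k "\<lambda>v. e * v" "at z"] e
      by (simp add: has_field_derivative_def)
    moreover have "h = (\<lambda>z. cnj (k z))" using eq by (rule ext)
    ultimately have 2: "(h has_derivative (\<lambda>v. cnj (e * v))) (at z)" by simp
    have "(\<lambda>v. d * v) = (\<lambda>v. cnj (e * v))" by (rule has_derivative_unique[OF 1 2])
    then have "d * 1 = cnj (e * 1)" "d * \<i> = cnj (e * \<i>)" by meson+
    then have "d = 0" by (auto simp: complex_eq_iff)
    then show ?thesis using d by simp
  qed
  then obtain c where "\<And>z. h z = c"
    using has_field_derivative_zero_constant[of UNIV h] by auto
  then show ?thesis by simp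
qed

lemma weyl_vacuum: "weyl \<xi> (expvec 0) = exp (- (complex_of_real (norm \<xi>))\<^sup>2 / 2) *\<^sub>C expvec \<xi>"
  by (simp add: weyl_expvec weyl_factor_def cinner.zero_left)

text \<open>If \<open>X\<close> commutes with the Weyl operators, then moving \<open>W(\<xi>)\<close> across gives
  \<open>\<langle>X e(\<xi>)|e(\<eta>)\<rangle> = exp \<langle>\<xi>|\<eta>\<rangle> g(\<eta> - \<xi>)\<close> with \<open>g(\<zeta>) = \<langle>X e(0)|e(\<zeta>)\<rangle>\<close>. At \<open>\<eta> = 0\<close> the left side is
  holomorphic along \<open>z \<mapsto> z \<xi>\<close> and \<open>g\<close> is antiholomorphic, so \<open>g\<close> is constant.\<close>

lemma weyl_irreducible:
  assumes X: "X \<in> bounded_ops" and comm: "\<And>\<xi> v. X (weyl \<xi> v) = weyl \<xi> (X v)"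
  shows "\<exists>c. \<forall>v. X v = c *\<^sub>C v"
proof -
  define g where "g \<zeta> = cinner (X (expvec 0)) (expvec \<zeta>)" for \<zeta>
  note X' = bounded_opsD[OF X]
  have matrix: "cinner (X (expvec \<xi>)) (expvec \<eta>) = exp (cinner \<xi> \<eta>) * g (\<eta> - \<xi>)" for \<xi> \<eta>
  proof -
    let ?r = "(complex_of_real (norm \<xi>))\<^sup>2 / 2"
    have "exp ?r *\<^sub>C weyl \<xi> (expvec 0) = expvec \<xi>"
      by (simp add: weyl_vacuum scaleC_scaleC exp_add[symmetric])
    then have "cinner (X (expvec \<xi>)) (expvec \<eta>) = cinner (X (exp ?r *\<^sub>C weyl \<xi> (expvec 0))) (expvec \<eta>)"
      by simp
    also have "\<dots> = exp ?r * cinner (X (expvec 0)) (weyl (- \<xi>) (expvec \<eta>))"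
      by (simp add: X' comm cinner_scaleC_left cinner_weyl)
    also have "\<dots> = exp ?r * (cnj (weyl_factor (- \<xi>) \<eta>) * g (\<eta> - \<xi>))"
      by (simp add: weyl_expvec cinner_scaleC_right g_def)
    also have "cnj (weyl_factor (- \<xi>) \<eta>) = exp (- ?r + cinner \<xi> \<eta>)"
      by (simp add: weyl_factor_def exp_cnj cinner.minus_right cinner_commute[of \<xi> \<eta>])
    also have "exp ?r * (exp (- ?r + cinner \<xi> \<eta>) * g (\<eta> - \<xi>)) = exp (?r + (- ?r + cinner \<xi> \<eta>)) * g (\<eta> - \<xi>)"
      by (simp only: exp_add mult.assoc)
    finally show ?thesis by simp
  qed
  have g_const: "g (- \<xi>) = g 0" for \<xi>
  proof -
    define h where "h z = g (- (z *\<^sub>C \<xi>))" for z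
    have h1: "h z = cinner (expvec (z *\<^sub>C \<xi>)) (adj X (expvec 0))" for z
      using matrix[of "z *\<^sub>C \<xi>" 0] by (simp add: h_def cinner.zero_right cinner_adj[OF X])
    have h2: "h z = cnj (cinner (expvec (z *\<^sub>C (- \<xi>))) (X (expvec 0)))" for z
    proof -
      have "z *\<^sub>C (- \<xi>) = - (z *\<^sub>C \<xi>)" using scaleC_minus_right[of z 0 \<xi>] by simp
      then show ?thesis by (simp add: h_def g_def cinner_commute[of "X (expvec 0)"])
    qed
    have "h 1 = h 0"
    proof (rule holomorphic_antiholomorphic_constant[OF _ _ h2])
      show "\<exists>d. (h has_field_derivative d) (at z)" for z
      proof -
        have "h = (\<lambda>z. cinner (expvec (z *\<^sub>C \<xi>)) (adj X (expvec 0)))" using h1 by (rule ext)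
        then show ?thesis using expvec_holomorphic by simp
      qed
      show "\<exists>d. ((\<lambda>z. cinner (expvec (z *\<^sub>C - \<xi>)) (X (expvec 0))) has_field_derivative d) (at z)" for z
        by (rule expvec_holomorphic)
    qed
    then show ?thesis by (simp add: h_def)
  qed
  have "X = (\<lambda>v. g 0 *\<^sub>C v)"
  proof (rule bounded_ops_eqI[OF X])
    show "(\<lambda>v. g 0 *\<^sub>C v) \<in> bounded_ops" using bounded_ops_scaleC[OF bounded_ops_id] by simp
    fix \<xi>
    have "cinner (X (expvec \<xi>) - g 0 *\<^sub>C expvec \<xi>) (expvec \<eta>) = 0" for \<eta>
      using matrix[of \<xi> \<eta>] g_const[of "\<xi> - \<eta>"]
      by (simp add: cinner.diff_left cinner_scaleC_left cinner_expvec)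
    then have "X (expvec \<xi>) - g 0 *\<^sub>C expvec \<xi> = 0" using total_expvec unfolding total_vectors_def by blast
    then show "X (expvec \<xi>) = g 0 *\<^sub>C expvec \<xi>" by simp
  qed
  then show ?thesis by (intro exI[of _ "g 0"]) (simp add: fun_eq_iff)
qed

lemma weyl_scalar_imp_zero:
  assumes "\<And>v. weyl \<zeta> v = m *\<^sub>C v"
  shows "\<zeta> = 0"
proof -
  define k where "k = exp (- (complex_of_real (norm \<zeta>))\<^sup>2 / 2)"
  have k: "k *\<^sub>C expvec \<zeta> = m *\<^sub>C expvec 0"
    using assms[of "expvec 0"] by (simp add: weyl_vacuum k_def)
  from arg_cong[OF this, of "\<lambda>v. cinner v (expvec 0)"] have "k = m"
    by (simp add: cinner_scaleC_left cinner_expvec cinner.zero_left cinner.zero_right)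
  moreover have "k \<noteq> 0" by (simp add: k_def)
  ultimately have "k = m" "m \<noteq> 0" by simp_all
  from arg_cong[OF k, of "\<lambda>v. cinner v (expvec \<zeta>)"] this have "exp (cinner \<zeta> \<zeta>) = 1"
    by (simp add: cinner_scaleC_left cinner_expvec cinner.zero_left)
  then have "exp ((norm \<zeta>)\<^sup>2) = (1 :: real)"
    by (simp only: cinner_self exp_of_real of_real_eq_1_iff)
  then show ?thesis by simp
qed

section \<open>The shift semigroup\<close>

lemma sqint_shift:
  assumes "l2_rel f f" shows "sqint half_line (\<lambda>x. if t < x then f (x - t) else 0)"
  using shift.rsp[unfolded rel_fun_def, rule_format, OF refl assms, of t] by (simp add: l2_rel_def)

lemma shift_minus: "shift t (- \<xi>) = - shift t \<xi>"
  unfolding uminus_l2_def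
proof transfer
  fix t :: real and f assume f: "l2_rel f f"
  have "sqint half_line (\<lambda>x. - 1 * (if t < x then f (x - t) else 0))"
    by (intro sqint_scale sqint_shift f)
  moreover have "(\<lambda>x. - 1 * (if t < x then f (x - t) else 0)) = (\<lambda>x. if t < x then - 1 * f (x - t) else 0)"
    by auto
  ultimately show "l2_rel (\<lambda>x. if t < x then - 1 * f (x - t) else 0)
      (\<lambda>x. - 1 * (if t < x then f (x - t) else 0))"
    by (simp add: l2_rel_def)
qed

lemma shift_shift:
  assumes "0 \<le> t" shows "shift s (shift t \<xi>) = shift (s + t) \<xi>"
  using assms
proof transfer
  fix s t :: real and f assume t: "0 \<le> t" and f: "l2_rel f f"
  have "(\<lambda>x. if s < x then if t < x - s then f (x - s - t) else 0 else 0)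
      = (\<lambda>x. if s + t < x then f (x - (s + t)) else 0)"
    using t by (auto simp: fun_eq_iff algebra_simps)
  then show "l2_rel (\<lambda>x. if s < x then if t < x - s then f (x - s - t) else 0 else 0)
      (\<lambda>x. if s + t < x then f (x - (s + t)) else 0)"
    using sqint_shift[OF f, of "s + t"] by (simp add: l2_rel_def)
qed

lemma cinner_interval_ind_shift:
  assumes "s \<le> t" shows "cinner (interval_ind s) (shift t \<xi>) = 0"
  using assms
proof transfer
  fix s t :: real and f :: "real \<Rightarrow> complex" assume "s \<le> t"
  then have "(\<lambda>x. indicator {0<..<s} x * cnj (if t < x then f (x - t) else 0)) = (\<lambda>_. 0)"
    by (auto simp: fun_eq_iff indicator_def)
  then show "ip half_line (indicator {0<..<s}) (\<lambda>x. if t < x then f (x - t) else 0) = 0"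
    unfolding ip_def by simp
qed

lemma interval_ind_nonzero:
  assumes "0 < s" shows "interval_ind s \<noteq> 0"
proof -
  have "cinner (interval_ind s) (interval_ind s) = complex_of_real s"
    using assms
  proof transfer
    fix s :: real assume s: "0 < s"
    have "emeasure half_line {0<..<s} = emeasure lborel {0<..<s}"
      unfolding half_line_def by (intro emeasure_restrict_space) auto
    then have m: "measure half_line {0<..<s} = s" using s by (simp add: measure_def)
    have "ip half_line (indicator {0<..<s}) (indicator {0<..<s}) 
        = complex_of_real (\<integral>x. indicator {0<..<s} x \<partial>half_line)"
      unfolding ip_self by (intro arg_cong[where f = complex_of_real] Bochner_Integration.integral_cong)
         (auto simp: indicator_def)
    also have "(\<integral>x. indicator {0<..<s} x \<partial>half_line) = s"
    proof -
      have "space half_line \<inter> {0<..<s} = {0<..<s}" by (auto simp: half_line_basics)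
      then show ?thesis using m by (simp add: Int_commute)
    qed
    finally show "ip half_line (indicator {0<..<s}) (indicator {0<..<s}) = complex_of_real s" .
  qed
  then show ?thesis using assms by (auto simp: cinner.zero_left)
qed

section \<open>Operators intertwining Weyl operators\<close>

definition weyl_intertwiners :: "real \<Rightarrow> op set" where
  "weyl_intertwiners t = {T \<in> bounded_ops. \<forall>\<xi> v. T (weyl \<xi> v) = weyl (shift t \<xi>) (T v)}"

lemma adj_weyl_intertwiner:
  assumes T: "T \<in> weyl_intertwiners t"
  shows "adj T (weyl (shift t \<xi>) v) = weyl \<xi> (adj T v)"
proof (rule cinner_extensionality_right)
  fix u
  have b: "T \<in> bounded_ops" using T by (simp add: weyl_intertwiners_def)
  have "cinner u (adj T (weyl (shift t \<xi>) v)) = cinner (weyl (shift t (- \<xi>)) (T u)) v"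
    by (simp add: cinner_adj[OF b, symmetric] cinner_weyl shift_minus)
  also have "\<dots> = cinner (T (weyl (- \<xi>) u)) v" using T by (simp add: weyl_intertwiners_def)
  also have "\<dots> = cinner u (weyl \<xi> (adj T v))" by (simp add: cinner_adj[OF b] cinner_weyl)
  finally show "cinner u (adj T (weyl (shift t \<xi>) v)) = cinner u (weyl \<xi> (adj T v))" .
qed

text \<open>\<open>S\<^sup>* T\<close> commutes with all Weyl operators.\<close>

lemma weyl_intertwiners_scalar:
  assumes S: "S \<in> weyl_intertwiners t" and T: "T \<in> weyl_intertwiners t"
  shows "\<exists>c. \<forall>v. adj S (T v) = c *\<^sub>C v"
proof -
  have b: "S \<in> bounded_ops" "T \<in> bounded_ops" using S T by (auto simp: weyl_intertwiners_def)
  have "\<exists>c. \<forall>v. (adj S \<circ> T) v = c *\<^sub>C v"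
  proof (rule weyl_irreducible)
    show "adj S \<circ> T \<in> bounded_ops" by (intro bounded_ops_comp adj_bounded b)
    show "(adj S \<circ> T) (weyl \<xi> v) = weyl \<xi> ((adj S \<circ> T) v)" for \<xi> v
      using T by (simp add: weyl_intertwiners_def adj_weyl_intertwiner[OF S])
  qed
  then show ?thesis by simp
qed

lemma weyl_comp_intertwiner:
  assumes "T \<in> weyl_intertwiners t" and "\<And>\<eta>. cinner \<zeta> (shift t \<eta>) = 0"
  shows "weyl \<zeta> \<circ> T \<in> weyl_intertwiners t"
  using assms fun_cong[OF weyl_commute[of \<zeta> "shift t _"]]
  by (simp add: weyl_intertwiners_def bounded_ops_comp weyl_bounded)

lemma adj_comp_self_scalar_nonzero:
  assumes T: "T \<in> bounded_ops" and c: "\<And>v. adj T (T v) = c *\<^sub>C v" and v: "T v \<noteq> 0"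
  shows "c \<noteq> 0"
proof
  assume "c = 0"
  then have "cinner (T v) (T v) = 0" by (simp add: cinner_adj[OF T] c cinner.zero_right)
  then show False using v by (simp add: cinner_self)
qed

text \<open>The range of \<open>R\<close> lies in that of \<open>R'\<close>, so \<open>R\<close> factors through \<open>R'\<close> as a multiple of
  \<open>R' X\<close> with \<open>X = R'\<^sup>* R\<close>. Comparing the two intertwining relations, \<open>X\<close> undoes the shift by
  \<open>q = s' - s\<close>: it satisfies \<open>X W(S\<^sub>q \<xi>) = W(\<xi>) X\<close>, and it is a multiple of an isometry. For \<open>\<zeta>\<close>
  supported in \<open>(0,q)\<close> the operator \<open>W(\<zeta>)\<close> commutes with every \<open>W(S\<^sub>q \<xi>)\<close>, so \<open>X W(\<zeta>) X\<^sup>*\<close> commutes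
  with every \<open>W(\<xi>)\<close> and is scalar; then so is \<open>W(\<zeta>)\<close>, which is absurd for \<open>\<zeta> \<noteq> 0\<close>.

  The operator \<open>W\<close> accounts for the Weyl operator in the twisted product.\<close>

lemma no_intertwiner_absorption:
  assumes s: "0 \<le> s" "s < s'"
    and R: "R \<in> weyl_intertwiners s" "R v \<noteq> 0" and R': "R' \<in> weyl_intertwiners s'"
    and B: "total_vectors B"
    and W: "W \<in> bounded_ops" "\<And>v. W (W' v) = v"
    and absorb: "\<And>x. x \<in> B \<Longrightarrow> \<exists>u. R (W x) = R' u"
  shows False
proof -
  have b: "R \<in> bounded_ops" "R' \<in> bounded_ops" using R R' by (auto simp: weyl_intertwiners_def)
  note b' = b[THEN adj_bounded]
  obtain r where r: "\<And>v. adj R (R v) = r *\<^sub>C v" using weyl_intertwiners_scalar[OF R(1) R(1)] by blast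
  obtain r' where r': "\<And>v. adj R' (R' v) = r' *\<^sub>C v" using weyl_intertwiners_scalar[OF R' R'] by blast
  define X where "X = adj R' \<circ> R"
  have X: "X \<in> bounded_ops" unfolding X_def by (intro bounded_ops_comp b b')
  have "(\<lambda>v. r' *\<^sub>C (R \<circ> W) v) = R' \<circ> X \<circ> W"
  proof (rule bounded_linear_eq_on_total[OF B])
    have "(\<lambda>v. r' *\<^sub>C (R \<circ> W) v) \<in> bounded_ops" "R' \<circ> X \<circ> W \<in> bounded_ops"
      by (intro bounded_ops_scaleC bounded_ops_comp b X W)+
    note * = this[THEN bounded_opsD(1)] this[THEN bounded_opsD(2)]
    show "bounded_linear (\<lambda>v. r' *\<^sub>C (R \<circ> W) v)" "bounded_linear (R' \<circ> X \<circ> W)" by (rule *)+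
    show "r' *\<^sub>C (R \<circ> W) (c *\<^sub>C v) = c *\<^sub>C r' *\<^sub>C (R \<circ> W) v"
      "(R' \<circ> X \<circ> W) (c *\<^sub>C v) = c *\<^sub>C (R' \<circ> X \<circ> W) v" for c v by (rule *)+
    fix x assume "x \<in> B"
    then obtain u where u: "R (W x) = R' u" using absorb by blast
    show "r' *\<^sub>C (R \<circ> W) x = (R' \<circ> X \<circ> W) x"
      by (simp add: X_def u r' bounded_opsD(2)[OF b(2)])
  qed
  then have factor: "r' *\<^sub>C R v = R' (X v)" for v
    using fun_cong[of _ _ "W' v"] W(2) by (metis comp_apply)
  have "r' \<noteq> 0"
  proof
    assume r'0: "r' = 0"
    have "R' u = 0" for u
      using adj_comp_self_scalar_nonzero[OF b(2) r'] r'0 by blast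
    then have RW: "R (W x) = 0" if "x \<in> B" for x using absorb[OF that] by auto
    have "R \<circ> W = (\<lambda>v. 0)"
      by (rule bounded_linear_eq_on_total[OF B])
         (use bounded_ops_comp[OF b(1) W(1), THEN bounded_opsD(1)]
            bounded_ops_comp[OF b(1) W(1), THEN bounded_opsD(2)] RW in \<open>auto\<close>)
    then have "R (W (W' v)) = 0" by (metis comp_apply)
    then show False using R(2) W(2) by simp
  qed
  have "r \<noteq> 0" by (rule adj_comp_self_scalar_nonzero[OF b(1) r R(2)])
  define k where "k = r' * r"
  have k: "k \<noteq> 0" using \<open>r \<noteq> 0\<close> \<open>r' \<noteq> 0\<close> by (simp add: k_def)
  have XX: "adj X (X v) = k *\<^sub>C v" for v
  proof (rule cinner_extensionality)
    fix u
    have "cinner (adj X (X v)) u = cinner (X v) (adj R' (R u))"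
      unfolding adj_cinner[OF X] by (subst (2) X_def) simp
    also have "\<dots> = cinner (R' (X v)) (R u)" by (rule cinner_adj[OF b(2), symmetric])
    also have "\<dots> = r' * cinner (adj R (R v)) u"
      by (simp add: factor[symmetric] cinner_scaleC_left adj_cinner[OF b(1)])
    finally show "cinner (adj X (X v)) u = cinner (k *\<^sub>C v) u"
      by (simp add: r cinner_scaleC_left k_def)
  qed
  define q where "q = s' - s"
  have q: "0 < q" using s by (simp add: q_def)
  have XW: "X (weyl (shift q \<xi>) v) = weyl \<xi> (X v)" for \<xi> v
  proof -
    have "R' (X (weyl (shift q \<xi>) v)) = r' *\<^sub>C weyl (shift s (shift q \<xi>)) (R v)"
      using R(1) by (simp add: factor[symmetric] weyl_intertwiners_def)
    also have "\<dots> = weyl (shift s' \<xi>) (R' (X v))"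
      using q by (simp add: shift_shift factor[symmetric] bounded_opsD(2)[OF weyl_bounded] q_def)
    also have "\<dots> = R' (weyl \<xi> (X v))" using R' by (simp add: weyl_intertwiners_def)
    finally have "adj R' (R' (X (weyl (shift q \<xi>) v))) = adj R' (R' (weyl \<xi> (X v)))" by simp
    then have "(1 / r') *\<^sub>C r' *\<^sub>C X (weyl (shift q \<xi>) v) = (1 / r') *\<^sub>C r' *\<^sub>C weyl \<xi> (X v)"
      by (simp only: r')
    then show ?thesis using \<open>r' \<noteq> 0\<close> by (simp add: scaleC_scaleC)
  qed
  have WX: "adj X (weyl \<xi> v) = weyl (shift q \<xi>) (adj X v)" for \<xi> v
  proof (rule cinner_extensionality_right)
    show "cinner u (adj X (weyl \<xi> v)) = cinner u (weyl (shift q \<xi>) (adj X v))" for u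
      using XW[of "- \<xi>" u] cinner_weyl[of "- shift q \<xi>" u "adj X v"] cinner_weyl[of "- \<xi>" "X u" v]
      by (simp add: cinner_adj[OF X, symmetric] shift_minus)
  qed
  define \<zeta> where "\<zeta> = interval_ind q"
  have comm: "weyl \<zeta> (weyl (shift q \<xi>) v) = weyl (shift q \<xi>) (weyl \<zeta> v)" for \<xi> v
    using fun_cong[OF weyl_commute[OF cinner_interval_ind_shift[of q q \<xi>]], of v] by (simp add: \<zeta>_def)
  have "\<exists>m. \<forall>v. (X \<circ> weyl \<zeta> \<circ> adj X) v = m *\<^sub>C v"
  proof (rule weyl_irreducible)
    show "X \<circ> weyl \<zeta> \<circ> adj X \<in> bounded_ops" by (intro bounded_ops_comp X adj_bounded weyl_bounded)
    show "(X \<circ> weyl \<zeta> \<circ> adj X) (weyl \<xi> v) = weyl \<xi> ((X \<circ> weyl \<zeta> \<circ> adj X) v)" for \<xi> v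
      by (simp add: WX comm XW)
  qed
  then obtain m where m: "\<And>v. X (weyl \<zeta> (adj X v)) = m *\<^sub>C v" by auto
  have "weyl \<zeta> v = (m / k) *\<^sub>C v" for v
  proof -
    have "adj X (X (weyl \<zeta> (adj X (X v)))) = adj X (m *\<^sub>C X v)" by (simp add: m)
    then have "(k * k) *\<^sub>C weyl \<zeta> v = (m * k) *\<^sub>C v"
      by (simp add: XX bounded_opsD(2)[OF weyl_bounded] bounded_opsD(2)[OF adj_bounded[OF X]] scaleC_scaleC)
    then have "(1 / (k * k)) *\<^sub>C (k * k) *\<^sub>C weyl \<zeta> v = (1 / (k * k)) *\<^sub>C (m * k) *\<^sub>C v" by simp
    then show ?thesis using k by (simp add: scaleC_scaleC)
  qed
  then have "\<zeta> = 0" by (rule weyl_scalar_imp_zero)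
  then show False using interval_ind_nonzero[OF q] by (simp add: \<zeta>_def)
qed

section \<open>Totality of the intertwiners of a normal endomorphism\<close>

lemma orthonormal_basis_of_finite_span:
  fixes V :: "'a::complex_inner set"
  assumes "finite V"
  shows "\<exists>B. finite B \<and> (\<forall>b\<in>B. \<forall>c\<in>B. cinner b c = (if b = c then 1 else 0))
    \<and> (\<forall>v\<in>V. (\<Sum>b\<in>B. cinner v b *\<^sub>C b) = v)"
  using assms
proof (induction V rule: finite_induct)
  case (insert v V)
  then obtain B where B: "finite B" "\<And>b c. b \<in> B \<Longrightarrow> c \<in> B \<Longrightarrow> cinner b c = (if b = c then 1 else 0)"
    "\<And>v. v \<in> V \<Longrightarrow> (\<Sum>b\<in>B. cinner v b *\<^sub>C b) = v" by blast
  define p where "p x = (\<Sum>b\<in>B. cinner x b *\<^sub>C b)" for x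
  have p: "cinner (p x) c = cinner x c" if "c \<in> B" for x c
  proof -
    have "cinner (p x) c = (\<Sum>b\<in>B. cinner x b * cinner b c)"
      by (simp add: p_def cinner.sum_left cinner_scaleC_left)
    also have "\<dots> = (\<Sum>b\<in>B. if b = c then cinner x c else 0)"
      using B(2) that by (intro sum.cong) auto
    finally show ?thesis using B(1) that by simp
  qed
  define r where "r = v - p v"
  have r: "cinner r c = 0" if "c \<in> B" for c using p[OF that] by (simp add: r_def cinner.diff_left)
  show ?case
  proof (cases "r = 0")
    case True
    then have "(\<Sum>b\<in>B. cinner v b *\<^sub>C b) = v" by (simp add: r_def p_def)
    then show ?thesis using B by (intro exI[of _ B]) auto
  next
    case False
    define u where "u = (1 / norm r) *\<^sub>R r"
    have uu: "cinner u u = 1" using False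
      by (simp add: u_def cinner_scaleR_left cinner_scaleR_right cinner_self power2_eq_square)
    have uB: "cinner u c = 0" "cinner c u = 0" if "c \<in> B" for c
      using r[OF that] cinner_commute[of c u] by (simp_all add: u_def cinner_scaleR_left)
    have notin: "u \<notin> B" using uB uu by force
    have pu: "cinner (p x) u = 0" for x
      using uB by (simp add: p_def cinner.sum_left cinner_scaleC_left)
    have "cinner v u = cinner r u" using pu[of v] by (simp add: r_def cinner.diff_left)
    also have "\<dots> = norm r"
      using False by (simp add: u_def cinner_scaleR_right cinner_self power2_eq_square)
    finally have "cinner v u *\<^sub>C u = r"
      using False by (simp add: u_def scaleR_scaleC[symmetric])
    then have v: "(\<Sum>b\<in>insert u B. cinner v b *\<^sub>C b) = v"
      using notin B(1) by (simp add: r_def p_def)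
    have V: "(\<Sum>b\<in>insert u B. cinner w b *\<^sub>C b) = w" if "w \<in> V" for w
      using notin B(1) B(3)[OF that] pu[of w] by (simp add: p_def)
    show ?thesis
      using B(1,2) uu uB v V notin by (intro exI[of _ "insert u B"]) auto
  qed
qed (auto intro: exI[of _ "{}"])

definition rank_one :: "fock \<Rightarrow> fock \<Rightarrow> op" where
  "rank_one w v = (\<lambda>u. cinner u v *\<^sub>C w)"

lemma rank_one_bounded: "rank_one w v \<in> bounded_ops"
  unfolding bounded_ops_def rank_one_def
proof (intro CollectI conjI allI)
  show "bounded_linear (\<lambda>u. cinner u v *\<^sub>C w)"
  proof (rule bounded_linear_intro[of _ "norm v * norm w"])
    show "norm (cinner x v *\<^sub>C w) \<le> norm x * (norm v * norm w)" for x
      using mult_right_mono[OF norm_cinner_le[of x v] norm_ge_zero[of w]] by (simp add: mult.assoc)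
  qed (simp_all add: cinner_add_left scaleC_add_left cinner_scaleR_left scaleC_scaleC[symmetric] scaleR_scaleC[symmetric])
qed (simp add: cinner_scaleC_left scaleC_scaleC)

lemma adj_rank_one: "adj (rank_one w v) = rank_one v w"
proof
  show "adj (rank_one w v) u = rank_one v w u" for u
  proof (rule cinner_extensionality)
    show "cinner (adj (rank_one w v) u) z = cinner (rank_one v w u) z" for z
      unfolding adj_cinner[OF rank_one_bounded]
      by (simp add: rank_one_def cinner_scaleC_left cinner_scaleC_right cinner_commute[of v z] mult.commute)
  qed
qed

lemma star_endoD:
  assumes \<beta>: "unital_normal_star_endo \<beta>" and A: "A \<in> bounded_ops"
  shows "\<beta> A \<in> bounded_ops" "B \<in> bounded_ops \<Longrightarrow> \<beta> (\<lambda>v. A v + B v) = (\<lambda>v. \<beta> A v + \<beta> B v)"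
    "\<beta> (\<lambda>v. c *\<^sub>C A v) = (\<lambda>v. c *\<^sub>C \<beta> A v)"
    "B \<in> bounded_ops \<Longrightarrow> \<beta> (A \<circ> B) = \<beta> A \<circ> \<beta> B" "\<beta> (adj A) = adj (\<beta> A)"
  using assms by (simp_all add: unital_normal_star_endo_def)

definition endo_intertwiners :: "(op \<Rightarrow> op) \<Rightarrow> op set" where
  "endo_intertwiners \<beta> = {T \<in> bounded_ops. \<forall>A\<in>bounded_ops. \<beta> A \<circ> T = T \<circ> A}"

text \<open>Since \<open>A |w\<rangle>\<langle>v| = |A w\<rangle>\<langle>v|\<close>, the map \<open>w \<mapsto> \<beta>(|w\<rangle>\<langle>v|)\<psi>\<close> carries \<open>A\<close> to \<open>\<beta>(A)\<close>. Boundedness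
  comes from \<open>|v\<rangle>\<langle>w| |w\<rangle>\<langle>v| = \<parallel>w\<parallel>\<^sup>2 |v\<rangle>\<langle>v|\<close>.\<close>

lemma rank_one_intertwiner:
  assumes \<beta>: "unital_normal_star_endo \<beta>"
  shows "(\<lambda>w. \<beta> (rank_one w v) \<psi>) \<in> endo_intertwiners \<beta>"
proof -
  let ?T = "\<lambda>w. \<beta> (rank_one w v) \<psi>"
  have bd: "A \<in> bounded_ops \<Longrightarrow> \<beta> A \<in> bounded_ops" for A
    using \<beta> by (auto simp: unital_normal_star_endo_def)
  have add: "?T (w + w') = ?T w + ?T w'" for w w'
  proof -
    have "rank_one (w + w') v = (\<lambda>u. rank_one w v u + rank_one w' v u)"
      by (simp add: rank_one_def scaleC_add_right)
    moreover have "\<beta> (\<lambda>u. rank_one w v u + rank_one w' v u) = (\<lambda>u. \<beta> (rank_one w v) u + \<beta> (rank_one w' v) u)"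
      by (intro star_endoD[OF \<beta>] rank_one_bounded)
    ultimately show ?thesis by simp
  qed
  have scale: "?T (c *\<^sub>C w) = c *\<^sub>C ?T w" for c w
  proof -
    have "rank_one (c *\<^sub>C w) v = (\<lambda>u. c *\<^sub>C rank_one w v u)"
      by (simp add: rank_one_def scaleC_scaleC mult.commute)
    moreover have "\<beta> (\<lambda>u. c *\<^sub>C rank_one w v u) = (\<lambda>u. c *\<^sub>C \<beta> (rank_one w v) u)"
      by (intro star_endoD[OF \<beta>] rank_one_bounded)
    ultimately show ?thesis by simp
  qed
  have comp: "\<beta> A (\<beta> B u) = \<beta> (A \<circ> B) u" if "A \<in> bounded_ops" "B \<in> bounded_ops" for A B u
    using star_endoD(4)[OF \<beta> that] by simp
  define C where "C = cmod (cinner \<psi> (\<beta> (rank_one v v) \<psi>))"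
  have norm: "norm (?T w) \<le> norm w * sqrt C" for w
  proof -
    let ?R = "rank_one w v"
    have "rank_one v w \<circ> ?R = (\<lambda>u. cinner w w *\<^sub>C rank_one v v u)"
      by (simp add: rank_one_def fun_eq_iff cinner_scaleC_left scaleC_scaleC mult.commute)
    moreover have "\<beta> (\<lambda>u. cinner w w *\<^sub>C rank_one v v u) = (\<lambda>u. cinner w w *\<^sub>C \<beta> (rank_one v v) u)"
      by (intro star_endoD[OF \<beta>] rank_one_bounded)
    moreover have "adj (\<beta> ?R) = \<beta> (rank_one v w)"
      by (simp add: star_endoD(5)[OF \<beta> rank_one_bounded, symmetric] adj_rank_one)
    ultimately have "cinner (?T w) (?T w) = cinner \<psi> (cinner w w *\<^sub>C \<beta> (rank_one v v) \<psi>)"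
      by (simp add: cinner_adj[OF bd[OF rank_one_bounded]] comp rank_one_bounded)
    then have "complex_of_real ((norm (?T w))\<^sup>2) = complex_of_real ((norm w)\<^sup>2) * cinner \<psi> (\<beta> (rank_one v v) \<psi>)"
      by (simp add: cinner_self cinner_scaleC_right)
    from arg_cong[OF this, of cmod] have "(norm (?T w))\<^sup>2 = (norm w)\<^sup>2 * C"
      by (simp add: norm_mult norm_power C_def)
    also have "\<dots> = (norm w * sqrt C)\<^sup>2" by (simp add: power_mult_distrib C_def)
    finally show ?thesis by (simp add: C_def)
  qed
  have "?T \<in> bounded_ops"
    unfolding bounded_ops_def
    by (intro CollectI conjI allI bounded_linear_intro[of _ "sqrt C"] add norm scale)
       (simp add: scaleR_scaleC scale)
  moreover have "\<beta> A \<circ> ?T = ?T \<circ> A" if A: "A \<in> bounded_ops" for A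
  proof
    fix w
    have "A \<circ> rank_one w v = rank_one (A w) v"
      by (simp add: rank_one_def fun_eq_iff bounded_opsD(2)[OF A])
    then show "(\<beta> A \<circ> ?T) w = (?T \<circ> A) w" by (simp add: comp A rank_one_bounded)
  qed
  ultimately show ?thesis by (simp add: endo_intertwiners_def)
qed

text \<open>For \<open>\<phi>(A) = \<Sum>\<^sub>n \<langle>A v\<^sub>n|w\<^sub>n\<rangle>\<close> take the orthogonal projection onto the span of the first \<open>N\<close> vectors
  \<open>v\<^sub>n\<close>: it agrees with the identity on these and is a contraction, so \<open>\<phi>\<close> at the identity differs
  from zero only by the tail of the series.\<close>

lemma normal_functional_zero:
  assumes \<phi>: "normal_functional \<phi>"
    and fin: "\<And>B. finite B \<Longrightarrow> \<phi> (\<lambda>u. \<Sum>b\<in>B. rank_one b b u) = 0"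
  shows "\<phi> id = 0"
proof -
  obtain v w where v: "summable (\<lambda>n. (norm (v n :: fock))\<^sup>2)" and w: "summable (\<lambda>n. (norm (w n :: fock))\<^sup>2)"
    and \<phi>': "\<And>A. A \<in> bounded_ops \<Longrightarrow> (\<lambda>n. cinner (A (v n)) (w n)) sums \<phi> A"
    using \<phi> unfolding normal_functional_def by blast
  define s where "s n = (norm (v n))\<^sup>2 + (norm (w n))\<^sup>2" for n
  have s: "summable s" unfolding s_def by (intro summable_add v w)
  have small: "cmod (\<phi> id) \<le> (\<Sum>n. s (n + N))" for N
  proof -
    obtain B where B: "finite B" "\<And>b c. b \<in> B \<Longrightarrow> c \<in> B \<Longrightarrow> cinner b c = (if b = c then 1 else 0)"
      "\<And>x. x \<in> v ` {..<N} \<Longrightarrow> (\<Sum>b\<in>B. cinner x b *\<^sub>C b) = x"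
      using orthonormal_basis_of_finite_span[of "v ` {..<N}"] by auto
    define P where "P u = (\<Sum>b\<in>B. rank_one b b u)" for u
    have Pb: "P \<in> bounded_ops"
      unfolding bounded_ops_def P_def
      using rank_one_bounded bounded_opsD(2)[OF rank_one_bounded]
      by (auto simp: bounded_ops_def linear_sum[OF bounded_linear.linear[OF bounded_linear_scaleC]]
          intro!: bounded_linear_sum)
    have Pv: "P (v n) = v n" if "n < N" for n
      using B(3)[of "v n"] that by (simp add: P_def rank_one_def)
    have PP: "cinner (P u) (P u) = cinner (P u) u" for u
    proof -
      have "cinner (P u) b = cinner u b" if "b \<in> B" for b
      proof -
        have "cinner (P u) b = (\<Sum>c\<in>B. cinner u c * cinner c b)"
          by (simp add: P_def rank_one_def cinner.sum_left cinner_scaleC_left)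
        also have "\<dots> = (\<Sum>c\<in>B. if c = b then cinner u b else 0)"
          using B(2) that by (intro sum.cong) auto
        finally show ?thesis using B(1) that by simp
      qed
      then have "cinner (P u) (P u) = (\<Sum>b\<in>B. cnj (cinner u b) * cinner u b)"
        by (subst (2) P_def) (simp add: rank_one_def cinner.sum_right cinner_scaleC_right)
      also have "\<dots> = cinner (P u) u"
        unfolding P_def rank_one_def cinner.sum_left cinner_scaleC_left
        by (intro sum.cong refl) (simp add: cinner_commute[of _ u] mult.commute)
      finally show ?thesis .
    qed
    have Pn: "norm (P u) \<le> norm u" for u
    proof -
      have "norm (P u) * norm (P u) = cmod (cinner (P u) u)"
        unfolding PP[symmetric] by (simp add: cinner_self norm_power power2_eq_square norm_mult)
      also have "\<dots> \<le> norm (P u) * norm u" by (rule norm_cinner_le)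
      finally show ?thesis by (cases "P u = 0") (auto simp: mult_le_cancel_left)
    qed
    define d where "d n = cinner (v n - P (v n)) (w n)" for n
    have "\<phi> P = 0" using fin[OF B(1)] by (simp add: P_def[abs_def])
    then have d: "d sums \<phi> id"
      using sums_diff[OF \<phi>'[OF bounded_ops_id] \<phi>'[OF Pb]] by (simp add: d_def[abs_def] cinner.diff_left)
    have d0: "d n = 0" if "n < N" for n using Pv[OF that] by (simp add: d_def cinner.zero_left)
    have d_le: "cmod (d n) \<le> s n" for n
    proof -
      have "norm (v n - P (v n)) \<le> 2 * norm (v n)"
        using norm_triangle_ineq4[of "v n" "P (v n)"] Pn[of "v n"] by simp
      then have "cmod (d n) \<le> 2 * norm (v n) * norm (w n)"
        unfolding d_def using norm_cinner_le order_trans mult_right_mono norm_ge_zero by meson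
      also have "\<dots> \<le> s n" unfolding s_def using sum_squares_bound[of "norm (v n)" "norm (w n)"] by simp
      finally show ?thesis .
    qed
    have "\<phi> id = (\<Sum>n. d (n + N)) + (\<Sum>n<N. d n)"
      using d suminf_split_initial_segment[of d N] by (simp add: sums_iff)
    also have "(\<Sum>n<N. d n) = 0" using d0 by simp
    finally have "cmod (\<phi> id) = cmod (\<Sum>n. d (n + N))" by (simp only: add_0_right)
    also have "\<dots> \<le> (\<Sum>n. s (n + N))"
      using d_le summable_ignore_initial_segment[OF s] by (intro norm_suminf_le) auto
    finally show ?thesis .
  qed
  have "cmod (\<phi> id) \<le> 0"
  proof (rule field_le_epsilon)
    fix e :: real assume e: "0 < e"
    obtain N where "norm (\<Sum>n. s (n + N)) < e"
      using suminf_exist_split[OF e s] by auto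
    then show "cmod (\<phi> id) \<le> 0 + e" using small[of N] by simp
  qed
  then show ?thesis by simp
qed

lemma normal_functional_vector: "normal_functional (\<lambda>A. cinner (A x) x)"
  unfolding normal_functional_def
proof (intro exI conjI ballI)
  let ?x = "\<lambda>n :: nat. if n = 0 then x else 0"
  have fin: "finite {0 :: nat}" by simp
  show s: "summable (\<lambda>n. (norm (?x n))\<^sup>2)" by (rule summable_finite[OF fin]) auto
  then show "summable (\<lambda>n. (norm (?x n))\<^sup>2)" .
  fix A :: op assume "A \<in> bounded_ops"
  show "(\<lambda>n. cinner (A (?x n)) (?x n)) sums cinner (A x) x"
    using sums_finite[OF fin, of "\<lambda>n. cinner (A (?x n)) (?x n)"] by (simp add: cinner.zero_right)
qed

text \<open>If \<open>x\<close> is orthogonal to all ranges, then \<open>A \<mapsto> \<langle>\<beta>(A)x|x\<rangle>\<close> is a normal functional that vanishes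
  on the projections \<open>|b\<rangle>\<langle>b|\<close>, hence at the identity, where its value is \<open>\<parallel>x\<parallel>\<^sup>2\<close>.\<close>

lemma total_endo_intertwiners:
  assumes \<beta>: "unital_normal_star_endo \<beta>"
  shows "total_vectors {T w | T w. T \<in> endo_intertwiners \<beta>}"
  unfolding total_vectors_def
proof (intro allI impI)
  fix x assume "\<forall>y\<in>{T w | T w. T \<in> endo_intertwiners \<beta>}. cinner x y = 0"
  then have x: "cinner x (T w) = 0" if "T \<in> endo_intertwiners \<beta>" for T w using that by blast
  define \<phi> where "\<phi> A = cinner (\<beta> A x) x" for A
  have "normal_functional \<phi>"
    unfolding \<phi>_def using \<beta> normal_functional_vector[of x] unfolding unital_normal_star_endo_def by blast
  moreover have "\<phi> (\<lambda>u. \<Sum>b\<in>B. rank_one b b u) = 0 \<and> (\<lambda>u. \<Sum>b\<in>B. rank_one b b u) \<in> bounded_ops"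
    if "finite B" for B
    using that
  proof (induction B rule: finite_induct)
    case empty
    have "\<beta> (\<lambda>v. 0 *\<^sub>C id v) = (\<lambda>v. 0 *\<^sub>C \<beta> id v)"
      by (rule star_endoD(3)[OF \<beta> bounded_ops_id])
    then show ?case using bounded_ops_scaleC[OF bounded_ops_id, of 0] by (simp add: \<phi>_def cinner.zero_left)
  next
    case (insert b B)
    let ?S = "\<lambda>u. \<Sum>b\<in>B. rank_one b b u"
    have eq: "(\<lambda>u. \<Sum>b\<in>insert b B. rank_one b b u) = (\<lambda>u. rank_one b b u + ?S u)"
      using insert.hyps by simp
    have S: "?S \<in> bounded_ops" using insert.IH by simp
    have "\<beta> (\<lambda>u. rank_one b b u + ?S u) = (\<lambda>u. \<beta> (rank_one b b) u + \<beta> ?S u)"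
      by (rule star_endoD(2)[OF \<beta> rank_one_bounded S])
    moreover have "cinner (\<beta> (rank_one b b) x) x = 0"
    proof -
      have "cinner x (\<beta> (rank_one b b) x) = 0"
        using rank_one_intertwiner[OF \<beta>] by (rule x)
      then show ?thesis using cinner_commute[of "\<beta> (rank_one b b) x" x] by simp
    qed
    ultimately show ?case
      unfolding eq using insert.IH bounded_ops_add[OF rank_one_bounded S]
      by (simp add: \<phi>_def cinner_add_left)
  qed
  ultimately have "\<phi> id = 0" by (rule normal_functional_zero[OF _ conjunct1])
  moreover have "\<beta> id = id" using \<beta> by (simp add: unital_normal_star_endo_def)
  ultimately show "x = 0" by (simp add: \<phi>_def cinner_self)
qed

section \<open>Fibres of the CCR flow and isomorphisms\<close>

lemma intertwiners_eq_endo: "intertwiners \<alpha> a = endo_intertwiners (\<alpha> a)"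
  by (simp add: intertwiners_def endo_intertwiners_def)

text \<open>The flow is prescribed only on Weyl operators, and an operator \<open>X\<close> that intertwines these must be
  shown to intertwine all bounded \<open>A\<close>. For \<open>T\<close> in the fibre, \<open>T\<^sup>* X\<close> is a scalar \<open>c\<close>, so
  \<open>\<langle>\<alpha>(A) X v|T w\<rangle> = \<langle>X v|T A\<^sup>* w\<rangle> = c \<langle>A v|w\<rangle> = \<langle>X A v|T w\<rangle>\<close>, and
  the ranges of the \<open>T\<close> are total.\<close>

theorem ccr_flow_intertwiners:
  assumes \<alpha>: "ccr_flow P \<mu> \<alpha>" and a: "a \<in> P"
  shows "intertwiners \<alpha> a = weyl_intertwiners (\<mu> \<bullet> a)"
proof (intro equalityI subsetI)
  have endo: "unital_normal_star_endo (\<alpha> a)" and \<alpha>W: "\<alpha> a (weyl \<xi>) = weyl (shift (\<mu> \<bullet> a) \<xi>)" for \<xi>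
    using \<alpha> a by (auto simp: ccr_flow_def)
  show sub: "T \<in> weyl_intertwiners (\<mu> \<bullet> a)" if "T \<in> intertwiners \<alpha> a" for T
  proof -
    have "\<alpha> a (weyl \<xi>) \<circ> T = T \<circ> weyl \<xi>" for \<xi>
      using that weyl_bounded by (simp add: intertwiners_def)
    then show ?thesis using that unfolding weyl_intertwiners_def \<alpha>W
      by (auto simp: intertwiners_def fun_eq_iff)
  qed
  fix X assume X: "X \<in> weyl_intertwiners (\<mu> \<bullet> a)"
  then have Xb: "X \<in> bounded_ops" by (simp add: weyl_intertwiners_def)
  have "\<alpha> a A (X v) = X (A v)" if A: "A \<in> bounded_ops" for A v
  proof -
    have \<alpha>A: "\<alpha> a A \<in> bounded_ops" and adjA: "adj (\<alpha> a A) = \<alpha> a (adj A)"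
      using endo A by (auto simp: unital_normal_star_endo_def)
    have "cinner (\<alpha> a A (X v) - X (A v)) (T w) = 0" if T: "T \<in> intertwiners \<alpha> a" for T w
    proof -
      have Tb: "T \<in> bounded_ops" using T by (simp add: intertwiners_def)
      obtain c where c: "\<And>v. adj T (X v) = c *\<^sub>C v"
        using weyl_intertwiners_scalar[OF sub[OF T] X] by blast
      have "\<alpha> a (adj A) \<circ> T = T \<circ> adj A"
        using T adj_bounded[OF A] by (simp add: intertwiners_def)
      then have "\<alpha> a (adj A) (T w) = T (adj A w)" by (simp add: fun_eq_iff)
      then have "cinner (\<alpha> a A (X v)) (T w) = cinner (X v) (T (adj A w))"
        by (simp add: cinner_adj[OF \<alpha>A] adjA)
      also have "\<dots> = c * cinner v (adj A w)"
        by (simp add: adj_cinner[OF Tb, symmetric] c cinner_scaleC_left)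
      also have "\<dots> = cinner (adj T (X (A v))) w"
        by (simp add: c cinner_scaleC_left cinner_adj[OF A])
      also have "\<dots> = cinner (X (A v)) (T w)" by (rule adj_cinner[OF Tb])
      finally show ?thesis by (simp add: cinner.diff_left)
    qed
    then have "\<alpha> a A (X v) - X (A v) = 0"
      using total_endo_intertwiners[OF endo] unfolding total_vectors_def intertwiners_eq_endo by blast
    then show ?thesis by simp
  qed
  then show "X \<in> intertwiners \<alpha> a" using Xb by (simp add: intertwiners_def fun_eq_iff)
qed

lemma fibre_unitary_nonzero:
  assumes U: "fibre_unitary E F x U" and S: "S \<in> fibre E x" and ne: "S v \<noteq> (0 :: fock)"
    and zero: "(\<lambda>_. 0) \<in> fibre E x"
  shows "\<exists>v. U S v \<noteq> 0"
proof (rule ccontr)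
  assume "\<not> ?thesis"
  then have US: "U S = (\<lambda>_. 0)" by auto
  have "U (\<lambda>v. 0 *\<^sub>C S v) = (\<lambda>v. 0 *\<^sub>C U S v)" using U S unfolding fibre_unitary_def by blast
  then have "U (\<lambda>_. 0) = U S" by (simp add: US)
  then have "(\<lambda>_. 0) = S"
    using U S zero unfolding fibre_unitary_def bij_betw_def inj_on_def by blast
  then show False using ne by (simp add: fun_eq_iff)
qed

text \<open>The common fibre over \<open>a\<close> and \<open>a'\<close> in the first system contains some \<open>S \<noteq> 0\<close>. In the product of
  \<open>S\<close> with \<open>T\<close> over \<open>(a, a')\<close> the twist can be exchanged for the one over \<open>(a', a)\<close> by passing
  from \<open>T\<close> to another element \<open>T'\<close> of the same fibre. The isomorphism carries this
  equality to the second system.\<close>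

lemma isomorphic_twisted_height_le:
  fixes P :: "'v::euclidean_space set"
  assumes P: "\<And>x y. x \<in> P \<Longrightarrow> y \<in> P \<Longrightarrow> x + y \<in> P" and pos: "\<And>x. x \<in> P \<Longrightarrow> 0 \<le> \<mu>\<^sub>2 \<bullet> x"
    and \<alpha>1: "ccr_flow P \<mu>\<^sub>1 \<alpha>\<^sub>1" and \<alpha>2: "ccr_flow P \<mu>\<^sub>2 \<alpha>\<^sub>2"
    and iso: "isomorphic_over P (twisted_system P lam \<mu>\<^sub>1 \<alpha>\<^sub>1) (twisted_system P lam \<mu>\<^sub>2 \<alpha>\<^sub>2)"
    and a: "a \<in> P" "a' \<in> P" and eq: "\<mu>\<^sub>1 \<bullet> a = \<mu>\<^sub>1 \<bullet> a'"
  shows "\<mu>\<^sub>2 \<bullet> a' \<le> \<mu>\<^sub>2 \<bullet> a"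
proof (rule ccontr)
  assume "\<not> ?thesis"
  then have lt: "\<mu>\<^sub>2 \<bullet> a < \<mu>\<^sub>2 \<bullet> a'" by simp
  let ?E = "twisted_system P lam \<mu>\<^sub>1 \<alpha>\<^sub>1" and ?F = "twisted_system P lam \<mu>\<^sub>2 \<alpha>\<^sub>2"
  obtain \<theta> where U: "\<And>x. x \<in> P \<Longrightarrow> fibre_unitary ?E ?F x (\<theta> x)"
    and mult: "\<And>a b S T. a \<in> P \<Longrightarrow> b \<in> P \<Longrightarrow> S \<in> fibre ?E a \<Longrightarrow> T \<in> fibre ?E b \<Longrightarrow>
      \<theta> (a + b) (mult ?E a b S T) = mult ?F a b (\<theta> a S) (\<theta> b T)"
    using iso unfolding isomorphic_over_def by blast
  have multE: "mult ?E a b S T = S \<circ> weyl (complex_of_real (lam \<bullet> a) *\<^sub>C interval_ind (\<mu>\<^sub>1 \<bullet> b)) \<circ> T"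
    and multF: "mult ?F a b S T = S \<circ> weyl (complex_of_real (lam \<bullet> a) *\<^sub>C interval_ind (\<mu>\<^sub>2 \<bullet> b)) \<circ> T"
    for a b S T by (simp_all add: twisted_system_def)
  have fibE: "fibre ?E x = weyl_intertwiners (\<mu>\<^sub>1 \<bullet> x)" and fibF: "fibre ?F x = weyl_intertwiners (\<mu>\<^sub>2 \<bullet> x)"
    if "x \<in> P" for x
    using ccr_flow_intertwiners[OF \<alpha>1 that] ccr_flow_intertwiners[OF \<alpha>2 that]
    by (simp_all add: twisted_system_def)
  have bij: "bij_betw (\<theta> x) (weyl_intertwiners (\<mu>\<^sub>1 \<bullet> x)) (weyl_intertwiners (\<mu>\<^sub>2 \<bullet> x))" if "x \<in> P" for x
    using U[OF that] by (simp add: fibre_unitary_def fibE[OF that] fibF[OF that])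
  define t where "t = \<mu>\<^sub>1 \<bullet> a"
  have endo1: "unital_normal_star_endo (\<alpha>\<^sub>1 a)" and endo2: "unital_normal_star_endo (\<alpha>\<^sub>2 a')"
    using \<alpha>1 \<alpha>2 a by (auto simp: ccr_flow_def)
  have vac: "expvec 0 \<noteq> 0" using cinner_expvec[of 0 0] by (auto simp: cinner.zero_left)
  obtain S v where S: "S \<in> weyl_intertwiners t" "S v \<noteq> 0"
  proof -
    have "\<exists>S\<in>endo_intertwiners (\<alpha>\<^sub>1 a). \<exists>v. S v \<noteq> 0"
    proof (rule ccontr)
      assume "\<not> ?thesis"
      then have "\<forall>y\<in>{T w | T w. T \<in> endo_intertwiners (\<alpha>\<^sub>1 a)}. cinner (expvec 0) y = 0"
        by (auto simp: cinner.zero_right)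
      then show False using total_endo_intertwiners[OF endo1] vac unfolding total_vectors_def by blast
    qed
    then show ?thesis
      using that ccr_flow_intertwiners[OF \<alpha>1 a(1)] by (auto simp: intertwiners_eq_endo t_def)
  qed
  have Sa: "S \<in> fibre ?E a" "S \<in> fibre ?E a'" using S a eq by (simp_all add: fibE t_def)
  define R where "R = \<theta> a S"
  define R' where "R' = \<theta> a' S"
  have R: "R \<in> weyl_intertwiners (\<mu>\<^sub>2 \<bullet> a)" and R': "R' \<in> weyl_intertwiners (\<mu>\<^sub>2 \<bullet> a')"
    using bij_betwE[OF bij[OF a(1)]] bij_betwE[OF bij[OF a(2)]] S eq by (auto simp: R_def R'_def t_def)
  have "(\<lambda>_. 0) \<in> weyl_intertwiners t"
    unfolding weyl_intertwiners_def
    using bounded_ops_scaleC[OF bounded_ops_id, of 0] by (simp add: bounded_opsD(4)[OF weyl_bounded])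
  then obtain u where u: "R u \<noteq> 0"
    using fibre_unitary_nonzero[OF U[OF a(1)] Sa(1) S(2)] a by (auto simp: fibE t_def R_def)
  let ?\<zeta> = "complex_of_real (lam \<bullet> a) *\<^sub>C interval_ind (\<mu>\<^sub>2 \<bullet> a')"
  let ?\<zeta>' = "complex_of_real (lam \<bullet> a') *\<^sub>C interval_ind (\<mu>\<^sub>2 \<bullet> a)"
  have absorb: "\<exists>u. R (weyl ?\<zeta> (Y v)) = R' u" if Y: "Y \<in> weyl_intertwiners (\<mu>\<^sub>2 \<bullet> a')" for Y v
  proof -
    obtain T where T: "T \<in> weyl_intertwiners t" "Y = \<theta> a' T"
      using Y bij[OF a(2)] eq by (auto simp: bij_betw_def t_def)
    let ?\<xi> = "complex_of_real (lam \<bullet> a) *\<^sub>C interval_ind t"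
    let ?\<xi>' = "complex_of_real (lam \<bullet> a') *\<^sub>C interval_ind t"
    \<comment> \<open>\<open>T'\<close> stays in the fibre because Weyl operators of functions supported in \<open>(0,t)\<close> commute with
    those of functions supported beyond \<open>t\<close>.\<close>
    define T' where "T' = weyl (- ?\<xi>') \<circ> (weyl ?\<xi> \<circ> T)"
    have orth: "cinner ?\<xi> (shift t \<eta>) = 0" "cinner (- ?\<xi>') (shift t \<eta>) = 0" for \<eta>
      using cinner_interval_ind_shift[of t t \<eta>] by (simp_all add: cinner_scaleC_left cinner.minus_left)
    have T': "T' \<in> weyl_intertwiners t"
      unfolding T'_def by (intro weyl_comp_intertwiner T orth)
    have "mult ?E a a' S T = mult ?E a' a S T'"
      using eq by (simp add: multE T'_def t_def fun_eq_iff weyl_inverse_apply)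
    then have "mult ?F a a' (\<theta> a S) (\<theta> a' T) = mult ?F a' a (\<theta> a' S) (\<theta> a T')"
      using mult[OF a(1) a(2) Sa(1), of T] mult[OF a(2) a(1) Sa(2), of T'] T T' eq
      by (simp add: fibE a t_def add.commute)
    then have "R (weyl ?\<zeta> (Y v)) = R' (weyl ?\<zeta>' (\<theta> a T' v))"
      by (simp add: multF R_def R'_def T(2) fun_eq_iff)
    then show ?thesis by blast
  qed
  have W_inv: "weyl ?\<zeta> (weyl (- ?\<zeta>) v) = v" for v by (rule weyl_inverse_apply)
  have total2: "total_vectors {Y v | Y v. Y \<in> weyl_intertwiners (\<mu>\<^sub>2 \<bullet> a')}"
    using total_endo_intertwiners[OF endo2] ccr_flow_intertwiners[OF \<alpha>2 a(2)]
    by (simp add: intertwiners_eq_endo)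
  show False
    using pos[OF a(1)] lt R u R' total2 weyl_bounded W_inv
    by (rule no_intertwiner_absorption[where W = "weyl ?\<zeta>" and W' = "weyl (- ?\<zeta>)"])
       (use absorb in blast)
qed

theorem proposition4p7:
  fixes P :: "(real ^ 'd) set"
    and lam \<mu>\<^sub>1 \<mu>\<^sub>2 :: "real ^ 'd"
    and \<alpha>\<^sub>1 \<alpha>\<^sub>2 :: "real ^ 'd \<Rightarrow> op \<Rightarrow> op"
  assumes "closed P" "convex P" "cone P"
    and "{x - y | x y. x \<in> P \<and> y \<in> P} = UNIV"
    and "P \<inter> uminus ` P = {0}"
    and "lam \<in> Omega_star P" "\<mu>\<^sub>1 \<in> Omega_star P" "\<mu>\<^sub>2 \<in> Omega_star P"
    and "ccr_flow P \<mu>\<^sub>1 \<alpha>\<^sub>1" "ccr_flow P \<mu>\<^sub>2 \<alpha>\<^sub>2"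
    and "isomorphic_over P (twisted_system P lam \<mu>\<^sub>1 \<alpha>\<^sub>1) (twisted_system P lam \<mu>\<^sub>2 \<alpha>\<^sub>2)"
  shows "(\<exists>c. \<mu>\<^sub>1 = c *\<^sub>R \<mu>\<^sub>2) \<and> (\<exists>c. \<mu>\<^sub>2 = c *\<^sub>R \<mu>\<^sub>1)"
proof -
  have add: "x + y \<in> P" if "x \<in> P" "y \<in> P" for x y
    using that assms(2,3) convex_cone by blast
  have diff: "\<exists>x\<in>P. \<exists>y\<in>P. z = x - y" for z
  proof -
    have "z \<in> {x - y | x y. x \<in> P \<and> y \<in> P}" using assms(4) by simp
    then show ?thesis by blast
  qed
  have nonneg: "0 \<le> \<mu>\<^sub>2 \<bullet> x" if "x \<in> P" for x
    using assms(8) that by (cases "x = 0") (auto simp: Omega_star_def less_imp_le)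
  have same_height: "\<mu>\<^sub>2 \<bullet> x = \<mu>\<^sub>2 \<bullet> y" if "x \<in> P" "y \<in> P" "\<mu>\<^sub>1 \<bullet> x = \<mu>\<^sub>1 \<bullet> y" for x y
    using isomorphic_twisted_height_le[OF add nonneg assms(9,10,11), of x y]
      isomorphic_twisted_height_le[OF add nonneg assms(9,10,11), of y x] that by force
  have kernel: "\<mu>\<^sub>2 \<bullet> z = 0" if z: "\<mu>\<^sub>1 \<bullet> z = 0" for z
  proof -
    obtain x y where "x \<in> P" "y \<in> P" "z = x - y" using diff by blast
    then show ?thesis using same_height[of x y] z by (simp add: inner_diff_right)
  qed
  obtain x where x: "x \<in> P" "x \<noteq> 0"
    using diff[of "1 :: real ^ 'd"] by (metis diff_self zero_neq_one)
  then have pos: "0 < \<mu>\<^sub>1 \<bullet> x" "0 < \<mu>\<^sub>2 \<bullet> x" using assms(7,8) by (auto simp: Omega_star_def)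
  then have "\<mu>\<^sub>1 \<noteq> 0" by auto
  define c where "c = (\<mu>\<^sub>1 \<bullet> \<mu>\<^sub>2) / (\<mu>\<^sub>1 \<bullet> \<mu>\<^sub>1)"
  \<comment> \<open>The component of \<open>\<mu>\<^sub>2\<close> orthogonal to \<open>\<mu>\<^sub>1\<close>; it lies in the kernel of \<open>\<mu>\<^sub>1\<close>, hence of \<open>\<mu>\<^sub>2\<close>.\<close>
  define y where "y = \<mu>\<^sub>2 - c *\<^sub>R \<mu>\<^sub>1"
  have y1: "\<mu>\<^sub>1 \<bullet> y = 0" using \<open>\<mu>\<^sub>1 \<noteq> 0\<close> by (simp add: y_def c_def inner_diff_right)
  have "y \<bullet> y = \<mu>\<^sub>2 \<bullet> y - c * (\<mu>\<^sub>1 \<bullet> y)" by (simp add: y_def inner_diff_left)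
  then have "y = 0" using y1 kernel[OF y1] by simp
  then have \<mu>2: "\<mu>\<^sub>2 = c *\<^sub>R \<mu>\<^sub>1" by (simp add: y_def)
  have "c \<noteq> 0" using \<mu>2 pos by auto
  then have "\<mu>\<^sub>1 = (1 / c) *\<^sub>R \<mu>\<^sub>2" by (simp add: \<mu>2)
  then show ?thesis using \<mu>2 by blast
qed

end
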